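(* For every prime number $\ell$, $$\mathbf D\left(\sqrt{\ell}\bmod\mathbb Q^{\mathrm{ab}\times2}\right)=e_{-1}\wedge e_\ell .$$
   Context: Let $\overline{\mathbb Q}$ be the algebraic closure of $\mathbb Q$ in $\mathbb C$, $G=\mathrm{Gal}(\overline{\mathbb Q}/\mathbb Q)$, $\mathbb Q^{\mathrm{ab}}\subset\overline{\mathbb Q}$ the maximal abelian extension of $\mathbb Q$, $G^{\mathrm{ab}}=\mathrm{Gal}(\mathbb Q^{\mathrm{ab}}/\mathbb Q)$. Put $[\sigma,\tau]=\sigma\tau\sigma^{-1}\tau^{-1}$. Let $[G,G]$ be the closed subgroup of $G$ topologically generated by all $[\sigma,\tau]$, and $[G,G]^\epsilon$ the closed subgroup topologically generated by all $[\sigma,\tau]^2$ and $[\sigma,[\tau,\eta]]$ ($\sigma,\tau,\eta\in G$). Put $G^{\mathrm{ab}+\epsilon}=G/[G,G]^\epsilon$ and $G^\epsilon=[G,G]/[G,G]^\epsilon$; there is a canonical central extension $\Sigma^\epsilon_G:\ 1\to G^\epsilon\to G^{\mathrm{ab}+\epsilon}\to G^{\mathrm{ab}}\to1$. Cohomology is continuous cochain cohomology, with $\mathbb Z/2\mathbb Z$ a discrete trivial module. Let $H^2(G^{\mathrm{ab}},\mathbb Z/2\mathbb Z)^-$ be the quotient of $H^2(G^{\mathrm{ab}},\mathbb Z/2\mathbb Z)$ by the subgroup of classes of extensions of $G^{\mathrm{ab}}$ by $\mathbb Z/2\mathbb Z$ whose middle group is abelian. Definition of the injective homomorphism $\mathbf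 D:H^0(G^{\mathrm{ab}},\mathbb Q^{\mathrm{ab}\times}/\mathbb Q^{\mathrm{ab}\times2})\to\bigwedge^2H^1(G^{\mathrm{ab}},\mathbb Z/2\mathbb Z)$ (exterior square over $\mathbb Z/2\mathbb Z$): it is the composite of (i) the Kummer isomorphism $H^0(G^{\mathrm{ab}},\mathbb Q^{\mathrm{ab}\times}/\mathbb Q^{\mathrm{ab}\times2})\to H^1(G^\epsilon,\mathbb Z/2\mathbb Z)$ sending $u\bmod\mathbb Q^{\mathrm{ab}\times2}$ to the homomorphism $c$ with $\sigma\sqrt u=(-1)^{c_\sigma}\sqrt u$ for $\sigma\in G^\epsilon$; (ii) the injective homomorphism $H^1(G^\epsilon,\mathbb Z/2\mathbb Z)\to H^2(G^{\mathrm{ab}},\mathbb Z/2\mathbb Z)^-$ sending $c$ to the image of the class $c\circ[\Sigma_G^\epsilon]$, i.e. of the class of the 2-cocycle $(\sigma,\tau)\mapsto c(\vartheta(\sigma)\vartheta(\tau)\vartheta(\sigma\tau)^{-1})$ for any continuous section $\vartheta:G^{\mathrm{ab}}\to G^{\mathrm{ab}+\epsilon}$; (iii) the inverse of the isomorphism $\bigwedge^2H^1(G^{\mathrm{ab}},\mathbb Z/2\mathbb Z)\to H^2(G^{\mathrm{ab}},\mathbb Z/2\mathbb Z)^-$ induced by cup product. For $p=-1$ and for each prime $p$ let $e_p\in H^1(G^{\mathrm{ab}},\mathbb Z/2\mathbb Z)$ be the homomorphism defined by $\sigma\sqrt p=(-1)^{(e_p)_\sigma}\sqrt p$ ($\sigma\in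 G^{\mathrm{ab}}$). The class of $\sqrt\ell$ in $\mathbb Q^{\mathrm{ab}\times}/\mathbb Q^{\mathrm{ab}\times2}$ is $G^{\mathrm{ab}}$-invariant. *)

theory Defs
  imports
    "HOL-Analysis.Analysis"
    "HOL-Algebra.Algebra"
    "HOL-Algebra.Algebraic_Closure_Type"
    "HOL-Algebra.Bij"
    "HOL-Library.Z2"
    "HOL-Library.Poly_Mapping"
    "HOL-Computational_Algebra.Computational_Algebra"
begin

hide_const (open) Divisibility.irreducible Divisibility.prime

section \<open>Fields of algebraic numbers and their Galois groups\<close>

abbreviation complex_ring :: "complex ring" where
  "complex_ring \<equiv> ring_of_type_algebra"

definition Qbar :: "complex set" where
  "Qbar = {x. algebraic x}"

text \<open>Galois groups over the rationals consist of extensional functions, so that every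
  automorphism is represented by exactly one HOL function; the product is composition.\<close>

definition Gal :: "complex set \<Rightarrow> (complex \<Rightarrow> complex) monoid" where
  "Gal F = (BijGroup F)
     \<lparr>carrier := {\<sigma> \<in> Bij F.
        \<sigma> \<in> ring_hom (complex_ring\<lparr>carrier := F\<rparr>) (complex_ring\<lparr>carrier := F\<rparr>) \<and>
        (\<forall>q\<in>\<rat>. \<sigma> q = q)}\<rparr>"

text \<open>The Krull topology, described as the topology of pointwise convergence with respect to
  the discrete topology on the field.\<close>

definition krull :: "complex set \<Rightarrow> (complex \<Rightarrow> complex) topology" where
  "krull F = subtopology (product_topology (\<lambda>_. discrete_topology F) F) (carrier (Gal F))"

text \<open>A Galois extension of the rationals inside the complex numbers is an algebraic and normal
  one: separability is automatic, and since the complex numbers are algebraically closed, a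
  rational polynomial splits in \<open>F\<close> iff \<open>F\<close> contains all its complex roots.\<close>

definition galois_extension :: "complex set \<Rightarrow> bool" where
  "galois_extension F \<longleftrightarrow> subfield F complex_ring \<and> F \<subseteq> Qbar \<and>
     (\<forall>p :: rat poly. irreducible p \<and> (\<exists>x\<in>F. poly (map_poly of_rat p) x = 0) \<longrightarrow>
        {x. poly (map_poly of_rat p) x = 0} \<subseteq> F)"

definition abelian_extension :: "complex set \<Rightarrow> bool" where
  "abelian_extension F \<longleftrightarrow> galois_extension F \<and> comm_group (Gal F)"

definition Qab :: "complex set" where
  "Qab = (GREATEST F. abelian_extension F)"


section \<open>Topologically generated subgroups and topological quotients\<close>

definition commutator :: "('a, 'b) monoid_scheme \<Rightarrow> 'a \<Rightarrow> 'a \<Rightarrow> 'a" where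
  "commutator G \<sigma> \<tau> = \<sigma> \<otimes>\<^bsub>G\<^esub> \<tau> \<otimes>\<^bsub>G\<^esub> inv\<^bsub>G\<^esub> \<sigma> \<otimes>\<^bsub>G\<^esub> inv\<^bsub>G\<^esub> \<tau>"

definition top_generate :: "('a, 'b) monoid_scheme \<Rightarrow> 'a topology \<Rightarrow> 'a set \<Rightarrow> 'a set" where
  "top_generate G T S = (\<lambda>H. subgroup H G \<and> closedin T H) hull S"

definition comm_subgroup :: "('a, 'b) monoid_scheme \<Rightarrow> 'a topology \<Rightarrow> 'a set" where
  "comm_subgroup G T =
     top_generate G T {commutator G \<sigma> \<tau> | \<sigma> \<tau>. \<sigma> \<in> carrier G \<and> \<tau> \<in> carrier G}"

definition eps_subgroup :: "('a, 'b) monoid_scheme \<Rightarrow> 'a topology \<Rightarrow> 'a set" where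
  "eps_subgroup G T = top_generate G T
     ({commutator G \<sigma> \<tau> [^]\<^bsub>G\<^esub> (2::nat) | \<sigma> \<tau>. \<sigma> \<in> carrier G \<and> \<tau> \<in> carrier G} \<union>
      {commutator G \<sigma> (commutator G \<tau> \<eta>) | \<sigma> \<tau> \<eta>.
         \<sigma> \<in> carrier G \<and> \<tau> \<in> carrier G \<and> \<eta> \<in> carrier G})"

definition quot_topology :: "('a, 'b) monoid_scheme \<Rightarrow> 'a topology \<Rightarrow> 'a set \<Rightarrow> 'a set topology" where
  "quot_topology G T N = topology (\<lambda>U. U \<subseteq> carrier (G Mod N) \<and>
     openin T {\<sigma> \<in> topspace T. N #>\<^bsub>G\<^esub> \<sigma> \<in> U})"

lemma openin_quot_topology:
  assumes "topspace T = carrier G"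
  shows "openin (quot_topology G T N) U \<longleftrightarrow>
    U \<subseteq> carrier (G Mod N) \<and> openin T {\<sigma> \<in> topspace T. N #>\<^bsub>G\<^esub> \<sigma> \<in> U}"
proof -
  let ?p = "\<lambda>U. {\<sigma> \<in> topspace T. N #>\<^bsub>G\<^esub> \<sigma> \<in> U}"
  have "?p (S \<inter> S') = ?p S \<inter> ?p S'" for S S'
    by auto
  moreover have "?p (\<Union>K) = \<Union>(?p ` K)" for K
    by auto
  ultimately have "istopology (\<lambda>U. U \<subseteq> carrier (G Mod N) \<and> openin T (?p U))"
    unfolding istopology_def by auto
  then show ?thesis
    by (simp add: quot_topology_def topology_inverse')
qed


section \<open>Continuous cochain cohomology with coefficients in the trivial module Z/2\<close>

text \<open>For trivial coefficients all coboundaries in degree 1 vanish, so the first cohomology group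
  is the group of continuous homomorphisms. It is written as a multiplicative monoid record
  although its operation is pointwise addition; the same applies below.\<close>

definition H1 :: "('a, 'b) monoid_scheme \<Rightarrow> 'a topology \<Rightarrow> ('a \<Rightarrow> bit) monoid" where
  "H1 G T = \<lparr>carrier = {h \<in> extensional (carrier G).
       continuous_map T (discrete_topology UNIV) h \<and>
       (\<forall>\<sigma>\<in>carrier G. \<forall>\<tau>\<in>carrier G. h (\<sigma> \<otimes>\<^bsub>G\<^esub> \<tau>) = h \<sigma> + h \<tau>)},
     mult = (\<lambda>h k. \<lambda>\<sigma>\<in>carrier G. h \<sigma> + k \<sigma>),
     one = (\<lambda>\<sigma>\<in>carrier G. 0)\<rparr>"

definition cocycles2 :: "('a, 'b) monoid_scheme \<Rightarrow> 'a topology \<Rightarrow> ('a \<times> 'a \<Rightarrow> bit) monoid" where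
  "cocycles2 G T = \<lparr>carrier = {f \<in> extensional (carrier G \<times> carrier G).
       continuous_map (prod_topology T T) (discrete_topology UNIV) f \<and>
       (\<forall>\<sigma>\<in>carrier G. \<forall>\<tau>\<in>carrier G. \<forall>\<eta>\<in>carrier G.
          f (\<tau>, \<eta>) - f (\<sigma> \<otimes>\<^bsub>G\<^esub> \<tau>, \<eta>) + f (\<sigma>, \<tau> \<otimes>\<^bsub>G\<^esub> \<eta>) - f (\<sigma>, \<tau>) = 0)},
     mult = (\<lambda>f g. \<lambda>x\<in>carrier G \<times> carrier G. f x + g x),
     one = (\<lambda>x\<in>carrier G \<times> carrier G. 0)\<rparr>"

definition coboundaries2 :: "('a, 'b) monoid_scheme \<Rightarrow> 'a topology \<Rightarrow> ('a \<times> 'a \<Rightarrow> bit) set" where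
  "coboundaries2 G T =
     {(\<lambda>(\<sigma>, \<tau>)\<in>carrier G \<times> carrier G. g \<tau> - g (\<sigma> \<otimes>\<^bsub>G\<^esub> \<tau>) + g \<sigma>) | g.
        continuous_map T (discrete_topology UNIV) g}"

definition H2 :: "('a, 'b) monoid_scheme \<Rightarrow> 'a topology \<Rightarrow> ('a \<times> 'a \<Rightarrow> bit) set monoid" where
  "H2 G T = cocycles2 G T Mod coboundaries2 G T"

definition class2 :: "('a, 'b) monoid_scheme \<Rightarrow> 'a topology \<Rightarrow> ('a \<times> 'a \<Rightarrow> bit) \<Rightarrow> ('a \<times> 'a \<Rightarrow> bit) set" where
  "class2 G T f = coboundaries2 G T #>\<^bsub>cocycles2 G T\<^esub> f"

text \<open>The middle group of the extension of \<open>G\<close> by Z/2 defined by a 2-cocycle. The cocycle need not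
  be normalized, whence the form of the unit element.\<close>

definition ext_group :: "('a, 'b) monoid_scheme \<Rightarrow> ('a \<times> 'a \<Rightarrow> bit) \<Rightarrow> (bit \<times> 'a) monoid" where
  "ext_group G f = \<lparr>carrier = UNIV \<times> carrier G,
     mult = (\<lambda>(a, \<sigma>) (b, \<tau>). (a + b + f (\<sigma>, \<tau>), \<sigma> \<otimes>\<^bsub>G\<^esub> \<tau>)),
     one = (- f (\<one>\<^bsub>G\<^esub>, \<one>\<^bsub>G\<^esub>), \<one>\<^bsub>G\<^esub>)\<rparr>"

definition abelian_classes :: "('a, 'b) monoid_scheme \<Rightarrow> 'a topology \<Rightarrow> ('a \<times> 'a \<Rightarrow> bit) set set" where
  "abelian_classes G T = {A \<in> carrier (H2 G T). \<exists>f\<in>A. comm_group (ext_group G f)}"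

definition H2minus :: "('a, 'b) monoid_scheme \<Rightarrow> 'a topology \<Rightarrow> ('a \<times> 'a \<Rightarrow> bit) set set monoid" where
  "H2minus G T = H2 G T Mod abelian_classes G T"

definition class2minus ::
  "('a, 'b) monoid_scheme \<Rightarrow> 'a topology \<Rightarrow> ('a \<times> 'a \<Rightarrow> bit) \<Rightarrow> ('a \<times> 'a \<Rightarrow> bit) set set" where
  "class2minus G T f = abelian_classes G T #>\<^bsub>H2 G T\<^esub> class2 G T f"

definition cup :: "('a, 'b) monoid_scheme \<Rightarrow> ('a \<Rightarrow> bit) \<Rightarrow> ('a \<Rightarrow> bit) \<Rightarrow> 'a \<times> 'a \<Rightarrow> bit" where
  "cup G h k = (\<lambda>(\<sigma>, \<tau>)\<in>carrier G \<times> carrier G. h \<sigma> * k \<tau>)"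


section \<open>The exterior square over Z/2\<close>

text \<open>\<open>V\<close> is an abelian group of exponent 2, written multiplicatively. Its exterior square is the
  Z/2-vector space with basis \<open>V \<times> V\<close> modulo the relations of biadditivity and
  alternation; linearity in the scalars is automatic over the prime field.\<close>

definition free2 :: "('a, 'b) monoid_scheme \<Rightarrow> ('a \<times> 'a \<Rightarrow>\<^sub>0 bit) monoid" where
  "free2 V = \<lparr>carrier = {s. Poly_Mapping.keys s \<subseteq> carrier V \<times> carrier V}, mult = (+), one = 0\<rparr>"

abbreviation pair :: "'a \<Rightarrow> 'a \<Rightarrow> ('a \<times> 'a \<Rightarrow>\<^sub>0 bit)" where
  "pair a b \<equiv> Poly_Mapping.single (a, b) 1"

definition ext2_relations :: "('a, 'b) monoid_scheme \<Rightarrow> ('a \<times> 'a \<Rightarrow>\<^sub>0 bit) set" where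
  "ext2_relations V = generate (free2 V)
     ({pair (a \<otimes>\<^bsub>V\<^esub> b) c - pair a c - pair b c | a b c.
         a \<in> carrier V \<and> b \<in> carrier V \<and> c \<in> carrier V} \<union>
      {pair a (b \<otimes>\<^bsub>V\<^esub> c) - pair a b - pair a c | a b c.
         a \<in> carrier V \<and> b \<in> carrier V \<and> c \<in> carrier V} \<union>
      {pair a a | a. a \<in> carrier V})"

definition ext2 :: "('a, 'b) monoid_scheme \<Rightarrow> ('a \<times> 'a \<Rightarrow>\<^sub>0 bit) set monoid" where
  "ext2 V = free2 V Mod ext2_relations V"

definition wedge :: "('a, 'b) monoid_scheme \<Rightarrow> 'a \<Rightarrow> 'a \<Rightarrow> ('a \<times> 'a \<Rightarrow>\<^sub>0 bit) set" where
  "wedge V a b = ext2_relations V #>\<^bsub>free2 V\<^esub> pair a b"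

definition cup_map :: "('a, 'b) monoid_scheme \<Rightarrow> 'a topology \<Rightarrow>
    (('a \<Rightarrow> bit) \<times> ('a \<Rightarrow> bit) \<Rightarrow>\<^sub>0 bit) set \<Rightarrow> ('a \<times> 'a \<Rightarrow> bit) set set" where
  "cup_map G T = (THE \<Phi>. \<Phi> \<in> hom (ext2 (H1 G T)) (H2minus G T) \<and>
     \<Phi> \<in> extensional (carrier (ext2 (H1 G T))) \<and>
     (\<forall>h\<in>carrier (H1 G T). \<forall>k\<in>carrier (H1 G T).
        \<Phi> (wedge (H1 G T) h k) = class2minus G T (cup G h k)))"


section \<open>The groups attached to the absolute Galois group of the rationals\<close>

abbreviation GQ :: "(complex \<Rightarrow> complex) monoid" where
  "GQ \<equiv> Gal Qbar"

abbreviation Gab :: "(complex \<Rightarrow> complex) monoid" where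
  "Gab \<equiv> Gal Qab"

abbreviation Tab :: "(complex \<Rightarrow> complex) topology" where
  "Tab \<equiv> krull Qab"

definition GQ_comm :: "(complex \<Rightarrow> complex) set" where
  "GQ_comm = comm_subgroup GQ (krull Qbar)"

definition GQ_eps :: "(complex \<Rightarrow> complex) set" where
  "GQ_eps = eps_subgroup GQ (krull Qbar)"

definition Gabeps :: "(complex \<Rightarrow> complex) set monoid" where
  "Gabeps = GQ Mod GQ_eps"

definition Tabeps :: "(complex \<Rightarrow> complex) set topology" where
  "Tabeps = quot_topology GQ (krull Qbar) GQ_eps"

text \<open>The cosets that make up \<open>Geps\<close> are literally elements of \<open>Gabeps\<close>.\<close>

definition Geps :: "(complex \<Rightarrow> complex) set monoid" where
  "Geps = GQ\<lparr>carrier := GQ_comm\<rparr> Mod GQ_eps"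

definition Teps :: "(complex \<Rightarrow> complex) set topology" where
  "Teps = quot_topology (GQ\<lparr>carrier := GQ_comm\<rparr>) (subtopology (krull Qbar) GQ_comm) GQ_eps"

definition sections :: "((complex \<Rightarrow> complex) \<Rightarrow> (complex \<Rightarrow> complex) set) set" where
  "sections = {\<theta>. continuous_map Tab Tabeps \<theta> \<and>
     (\<forall>\<sigma>\<in>carrier Gab. \<forall>\<rho>\<in>\<theta> \<sigma>. restrict \<rho> Qab = \<sigma>)}"


section \<open>The homomorphism D\<close>

definition Qab_units :: "complex monoid" where
  "Qab_units = units_of (complex_ring\<lparr>carrier := Qab\<rparr>)"

definition Qab_squares :: "complex set" where
  "Qab_squares = {x [^]\<^bsub>Qab_units\<^esub> (2::nat) | x. x \<in> carrier Qab_units}"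

definition sqclass :: "complex \<Rightarrow> complex set" where
  "sqclass u = Qab_squares #>\<^bsub>Qab_units\<^esub> u"

definition H0 :: "complex set set" where
  "H0 = {U \<in> carrier (Qab_units Mod Qab_squares). \<forall>\<sigma>\<in>carrier Gab. \<sigma> ` U = U}"

definition sgn_of :: "bit \<Rightarrow> complex" where
  "sgn_of b = (if b = 0 then 1 else - 1)"

definition kummer :: "complex set \<Rightarrow> (complex \<Rightarrow> complex) set \<Rightarrow> bit" where
  "kummer U = (THE c. c \<in> carrier (H1 Geps Teps) \<and>
     (\<forall>u\<in>U. \<forall>r. r\<^sup>2 = u \<longrightarrow> (\<forall>A\<in>carrier Geps. \<forall>\<sigma>\<in>A. \<sigma> r = sgn_of (c A) * r)))"

definition section_cocycle :: "((complex \<Rightarrow> complex) set \<Rightarrow> bit) \<Rightarrow>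
    ((complex \<Rightarrow> complex) \<Rightarrow> (complex \<Rightarrow> complex) set) \<Rightarrow>
    (complex \<Rightarrow> complex) \<times> (complex \<Rightarrow> complex) \<Rightarrow> bit" where
  "section_cocycle c \<theta> = (\<lambda>(\<sigma>, \<tau>)\<in>carrier Gab \<times> carrier Gab.
     c (\<theta> \<sigma> \<otimes>\<^bsub>Gabeps\<^esub> \<theta> \<tau> \<otimes>\<^bsub>Gabeps\<^esub> inv\<^bsub>Gabeps\<^esub> (\<theta> (\<sigma> \<otimes>\<^bsub>Gab\<^esub> \<tau>))))"

text \<open>The class does not depend on the continuous section, so the set below is a singleton.\<close>

definition push_ext :: "((complex \<Rightarrow> complex) set \<Rightarrow> bit) \<Rightarrow>
    ((complex \<Rightarrow> complex) \<times> (complex \<Rightarrow> complex) \<Rightarrow> bit) set set" where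
  "push_ext c = the_elem ((\<lambda>\<theta>. class2minus Gab Tab (section_cocycle c \<theta>)) ` sections)"

definition D_map :: "complex set \<Rightarrow>
    (((complex \<Rightarrow> complex) \<Rightarrow> bit) \<times> ((complex \<Rightarrow> complex) \<Rightarrow> bit) \<Rightarrow>\<^sub>0 bit) set" where
  "D_map = (\<lambda>U\<in>H0. inv_into (carrier (ext2 (H1 Gab Tab))) (cup_map Gab Tab) (push_ext (kummer U)))"

text \<open>Used for \<open>p = - 1\<close> and for primes \<open>p\<close>; the choice of the square root is immaterial.\<close>

definition e_char :: "int \<Rightarrow> (complex \<Rightarrow> complex) \<Rightarrow> bit" where
  "e_char p = (THE h. h \<in> carrier (H1 Gab Tab) \<and>
     (\<forall>\<sigma>\<in>carrier Gab. \<sigma> (csqrt (of_int p)) = sgn_of (h \<sigma>) * csqrt (of_int p)))"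

end

theory Submission
  imports Defs
begin

text \<open>Let \<open>s = \<surd>\<ell>\<close> and \<open>r = \<surd>s\<close>. For a continuous section \<open>\<theta>\<close> put
  \<open>m(\<sigma>) = \<theta>(\<sigma>)(r) / r\<close>; this is a fourth root of unity, and \<open>m(\<sigma>)\<^sup>2 = (-1)^{e_\<ell>(\<sigma>)}\<close>. The Kummer
  character of \<open>s\<close>, evaluated on the cocycle of the section, is the twisted coboundary
  \<open>\<sigma>(m(\<tau>)) m(\<sigma>) / m(\<sigma>\<tau>)\<close> of \<open>m\<close>. As \<open>\<sigma>(m(\<tau>)) / m(\<tau>) = (-1)^{e_{-1}(\<sigma>) e_\<ell>(\<tau>)}\<close>, its difference
  to the cup product of \<open>e_{-1}\<close> and \<open>e_\<ell>\<close> is symmetric, that is, the class of an abelian extension.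
  Finally, \<open>\<Lambda>\<^sup>2 H\<^sup>1 \<rightarrow> H\<^sup>2\<^sup>-\<close> is injective, since an element of the exterior square vanishes as soon as its
  alternating form on the group does.\<close>

text \<open>Most of the work makes the defining choices effective. \<open>push_ext\<close> extracts
  the element of an image over all continuous sections, so it has content only once such a section
  exists. Countability of \<open>Qbar\<close> provides one: the extension of \<sigma> with
  lexicographically least values in a fixed enumeration is canonical, and canonicity yields
  continuity, because an automorphism fixing enough conjugates carries the initial values for
  \<sigma> to those for a nearby element unchanged. The cocycle can be evaluated on r because r
  survives the passage to the quotient by [G,G]^eps: r^2 and all quotients \<sigma> r / r lie in
  \<open>Qab\<close>, so [G,G] acts on r by signs, compatibly with the action of G. These quotients
  are also the origin of e_{-1}: \<sigma> acts on the fourth roots of unity through that character.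
  Since abelian extensions are the symmetric cocycles, equality in \<open>H2minus\<close> is the
  symmetry of a sum of cocycles, and the alternating form of a tensor measures how far its cup
  product is from being symmetric.\<close>

hide_const (open) up_ring.coeff up_ring.monom Module.smult Polynomials.degree Polynomials.lead_coeff

section \<open>Extension of embeddings\<close>

text \<open>Isomorphisms between subrings are represented by their graphs. This is symmetric in domain and
  range, so that a maximal one is total and surjective for the same reason, and polynomials over the
  domain and their images become pairs of polynomials.\<close>

definition pair_ring :: "('a :: idom \<times> 'a) set \<Rightarrow> bool" where
  "pair_ring R \<longleftrightarrow> (1, 1) \<in> R \<and>
     (\<forall>x y x' y'. (x, y) \<in> R \<longrightarrow> (x', y') \<in> R \<longrightarrow> (x - x', y - y') \<in> R \<and> (x * x', y * y') \<in> R) \<and>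
     (\<forall>x y. (x, y) \<in> R \<longrightarrow> (x = 0 \<longleftrightarrow> y = 0))"

definition pair_poly :: "('a :: idom \<times> 'a) set \<Rightarrow> 'a poly \<Rightarrow> 'a poly \<Rightarrow> bool" where
  "pair_poly R p q \<longleftrightarrow> (\<forall>i. (coeff p i, coeff q i) \<in> R)"

lemma pair_ringD:
  assumes "pair_ring R"
  shows "(1, 1) \<in> R" "(0, 0) \<in> R"
    and "(x, y) \<in> R \<Longrightarrow> (x', y') \<in> R \<Longrightarrow> (x - x', y - y') \<in> R"
    and "(x, y) \<in> R \<Longrightarrow> (x', y') \<in> R \<Longrightarrow> (x + x', y + y') \<in> R"
    and "(x, y) \<in> R \<Longrightarrow> (x', y') \<in> R \<Longrightarrow> (x * x', y * y') \<in> R"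
    and "(x, y) \<in> R \<Longrightarrow> (- x, - y) \<in> R"
    and "(x, y) \<in> R \<Longrightarrow> x = 0 \<longleftrightarrow> y = 0"
    and "(x, y) \<in> R \<Longrightarrow> (x, y') \<in> R \<Longrightarrow> y = y'"
    and "(x, y) \<in> R \<Longrightarrow> (x', y) \<in> R \<Longrightarrow> x = x'"
proof -
  have d: "(x - x', y - y') \<in> R" if "(x, y) \<in> R" "(x', y') \<in> R" for x y x' y'
    using assms that unfolding pair_ring_def by blast
  show one: "(1, 1) \<in> R"
    using assms unfolding pair_ring_def by blast
  show zero: "(0, 0) \<in> R"
    using d[OF one one] by simp
  have m: "(- x, - y) \<in> R" if "(x, y) \<in> R" for x y
    using d[OF zero that] by simp
  show "(x, y) \<in> R \<Longrightarrow> (x', y') \<in> R \<Longrightarrow> (x - x', y - y') \<in> R"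
    by (rule d)
  show "(x, y) \<in> R \<Longrightarrow> (x', y') \<in> R \<Longrightarrow> (x + x', y + y') \<in> R"
    using d[OF _ m, of x y x' y'] by simp
  show "(x, y) \<in> R \<Longrightarrow> (- x, - y) \<in> R"
    by (rule m)
  show "(x, y) \<in> R \<Longrightarrow> (x', y') \<in> R \<Longrightarrow> (x * x', y * y') \<in> R"
    using assms unfolding pair_ring_def by blast
  have z: "x = 0 \<longleftrightarrow> y = 0" if "(x, y) \<in> R" for x y
    using assms that unfolding pair_ring_def by blast
  show "(x, y) \<in> R \<Longrightarrow> x = 0 \<longleftrightarrow> y = 0"
    by (rule z)
  show "(x, y) \<in> R \<Longrightarrow> (x, y') \<in> R \<Longrightarrow> y = y'"
    using z[OF d, of x y x y'] by simp
  show "(x, y) \<in> R \<Longrightarrow> (x', y) \<in> R \<Longrightarrow> x = x'"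
    using z[OF d, of x y x' y] by simp
qed

lemma pair_ring_converse: "pair_ring (R\<inverse>) \<longleftrightarrow> pair_ring R"
  unfolding pair_ring_def converse_iff by blast

lemma pair_ring_sum:
  assumes "pair_ring R" "\<And>i. i \<in> I \<Longrightarrow> (f i, g i) \<in> R"
  shows "(sum f I, sum g I) \<in> R"
  using assms(2)
  by (induction I rule: infinite_finite_induct) (auto intro: pair_ringD[OF assms(1)])

lemma pair_ring_of_int:
  assumes "pair_ring R"
  shows "(of_int n, of_int n) \<in> R"
proof -
  have "(of_nat n, of_nat n) \<in> R" for n
    by (induction n) (auto intro: pair_ringD[OF assms])
  then show ?thesis
    by (cases n) (auto intro!: pair_ringD(6,3)[OF assms] pair_ringD[OF assms] simp del: of_nat_Suc)
qed

section \<open>Paired polynomials, pseudo-division and the adjunction of one element\<close>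

context
  fixes R :: "('a :: idom \<times> 'a) set"
  assumes R: "pair_ring R"
begin

lemma pair_poly_0: "pair_poly R 0 0"
  using pair_ringD[OF R] by (simp add: pair_poly_def)

lemma pair_poly_const: "(a, b) \<in> R \<Longrightarrow> pair_poly R [:a:] [:b:]"
  using pair_ringD(2)[OF R] by (auto simp: pair_poly_def coeff_pCons split: nat.split)

lemma pair_poly_add: "pair_poly R p q \<Longrightarrow> pair_poly R p' q' \<Longrightarrow> pair_poly R (p + p') (q + q')"
  using pair_ringD(4)[OF R] by (simp add: pair_poly_def)

lemma pair_poly_diff: "pair_poly R p q \<Longrightarrow> pair_poly R p' q' \<Longrightarrow> pair_poly R (p - p') (q - q')"
  using pair_ringD(3)[OF R] by (simp add: pair_poly_def)

lemma pair_poly_mult: "pair_poly R p q \<Longrightarrow> pair_poly R p' q' \<Longrightarrow> pair_poly R (p * p') (q * q')"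
  unfolding pair_poly_def coeff_mult by (blast intro: pair_ring_sum[OF R] pair_ringD(5)[OF R])

lemma pair_poly_smult: "(a, b) \<in> R \<Longrightarrow> pair_poly R p q \<Longrightarrow> pair_poly R (smult a p) (smult b q)"
  using pair_ringD(5)[OF R] by (simp add: pair_poly_def)

lemma pair_poly_monom: "(a, b) \<in> R \<Longrightarrow> pair_poly R (monom a n) (monom b n)"
  using pair_ringD(2)[OF R] by (simp add: pair_poly_def)

lemma pair_poly_X: "pair_poly R [:0, 1:] [:0, 1:]"
  using pair_poly_monom[of 1 1 1] pair_ringD(1)[OF R] by (simp add: monom_altdef)

lemma pair_poly_of_int:
  assumes "\<And>i. coeff p i \<in> \<int>"
  shows "pair_poly R p p"
  unfolding pair_poly_def using assms pair_ring_of_int[OF R] by (metis Ints_cases)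

lemma pair_poly_zero_iff: "pair_poly R p q \<Longrightarrow> p = 0 \<longleftrightarrow> q = 0"
  using pair_ringD(7)[OF R] unfolding pair_poly_def poly_eq_iff coeff_0 by blast

lemma pair_poly_degree:
  assumes "pair_poly R p q"
  shows "degree p = degree q"
proof -
  have "coeff p i = 0 \<longleftrightarrow> coeff q i = 0" for i
    using assms pair_ringD(7)[OF R] unfolding pair_poly_def by blast
  then show ?thesis
    by (simp add: Polynomial.degree_def)
qed

lemma pair_poly_lead: "pair_poly R p q \<Longrightarrow> (lead_coeff p, lead_coeff q) \<in> R"
  using pair_poly_degree unfolding pair_poly_def by metis

text \<open>A pair ring may lack inverses, so leading coefficients cannot be divided out; scaling
  the dividend keeps all coefficients in \<open>R\<close>. Both components run through the same
  steps, and paired polynomials have equal degree, so the bound on the first remainder also governs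
  the second.\<close>

lemma pair_poly_pseudo_div:
  assumes "pair_poly R f1 f2" and g: "pair_poly R g1 g2" "g1 \<noteq> 0"
  shows "\<exists>c d s1 s2 r1 r2. (c, d) \<in> R \<and> c \<noteq> 0 \<and> pair_poly R s1 s2 \<and> pair_poly R r1 r2 \<and>
           smult c f1 = g1 * s1 + r1 \<and> smult d f2 = g2 * s2 + r2 \<and> (r1 = 0 \<or> degree r1 < degree g1)"
  using assms(1)
\<comment> \<open>The measure puts the zero polynomial strictly below nonzero constants, so that
  cancelling a constant still counts as progress.\<close>
proof (induction "if f1 = 0 then 0 else Suc (degree f1)" arbitrary: f1 f2 rule: less_induct)
  case less
  show ?case
  proof (cases "f1 = 0 \<or> degree f1 < degree g1")
    case True
    then have "(1, 1) \<in> R \<and> (1 :: 'a) \<noteq> 0 \<and> pair_poly R 0 0 \<and> pair_poly R f1 f2 \<and>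
      smult 1 f1 = g1 * 0 + f1 \<and> smult 1 f2 = g2 * 0 + f2 \<and> (f1 = 0 \<or> degree f1 < degree g1)"
      using pair_ringD(1)[OF R] pair_poly_0 less.prems by simp
    then show ?thesis
      by blast
  next
    case False
    define k where "k = degree f1 - degree g1"
    define u where "u = monom (lead_coeff f1) k"
    define v where "v = monom (lead_coeff f2) k"
    define a where "a = lead_coeff g1"
    define b where "b = lead_coeff g2"
    have uv: "pair_poly R u v"
      unfolding u_def v_def by (intro pair_poly_monom pair_poly_lead less.prems)
    have ab: "(a, b) \<in> R"
      unfolding a_def b_def by (intro pair_poly_lead g)
    define h1 where "h1 = smult a f1 - g1 * u"
    define h2 where "h2 = smult b f2 - g2 * v"
    have h: "pair_poly R h1 h2"
      unfolding h1_def h2_def by (intro pair_poly_diff pair_poly_smult pair_poly_mult ab uv g less.prems)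
    have a0: "a \<noteq> 0"
      using g by (simp add: a_def)
    have u0: "u \<noteq> 0"
      using False by (simp add: u_def)
    have "lead_coeff f1 \<noteq> 0"
      using False by simp
    then have "degree u = k"
      unfolding u_def by (rule degree_monom_eq)
    then have du: "degree (g1 * u) = degree f1"
      using False g u0 by (simp add: degree_mult_eq k_def)
    have "degree h1 \<le> degree f1"
      unfolding h1_def using du a0 by (intro degree_diff_le) auto
    moreover have "coeff h1 (degree f1) = 0"
    proof -
      have "coeff (g1 * u) (degree f1) = lead_coeff (g1 * u)"
        by (simp add: du)
      also have "\<dots> = a * lead_coeff f1"
        unfolding lead_coeff_mult a_def using lead_coeff_monom[of "lead_coeff f1" k] by (simp add: u_def)
      finally show ?thesis
        by (simp add: h1_def)
    qed
    ultimately have "h1 = 0 \<or> degree h1 < degree f1"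
      using eq_zero_or_degree_less by blast
    then have "(if h1 = 0 then 0 else Suc (degree h1)) < (if f1 = 0 then 0 else Suc (degree f1))"
      using False by auto
    from less.hyps[OF this h] obtain c d s1 s2 r1 r2 where
      *: "(c, d) \<in> R" "c \<noteq> 0" "pair_poly R s1 s2" "pair_poly R r1 r2"
         "smult c h1 = g1 * s1 + r1" "smult d h2 = g2 * s2 + r2" "r1 = 0 \<or> degree r1 < degree g1"
      by blast
    have "smult (c * a) f1 = g1 * (s1 + smult c u) + r1"
      using *(5) by (simp add: h1_def algebra_simps smult_diff_right)
    moreover have "smult (d * b) f2 = g2 * (s2 + smult d v) + r2"
      using *(6) by (simp add: h2_def algebra_simps smult_diff_right)
    moreover have "(c * a, d * b) \<in> R" "c * a \<noteq> 0"
      using * ab a0 pair_ringD(5)[OF R] by auto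
    moreover have "pair_poly R (s1 + smult c u) (s2 + smult d v)"
      by (intro pair_poly_add pair_poly_smult * uv)
    ultimately show ?thesis
      using *(4,7) by blast
  qed
qed

definition adjoin :: "'a \<Rightarrow> 'a \<Rightarrow> ('a \<times> 'a) set" where
  "adjoin a b = {(poly p a, poly q b) | p q. pair_poly R p q}"

lemma subset_adjoin: "R \<subseteq> adjoin a b"
proof safe
  fix x y assume "(x, y) \<in> R"
  then have "pair_poly R [:x:] [:y:]"
    by (rule pair_poly_const)
  then show "(x, y) \<in> adjoin a b"
    unfolding adjoin_def by force
qed

lemma mem_adjoin: "(a, b) \<in> adjoin a b"
  unfolding adjoin_def using pair_poly_X by force

text \<open>Sending a to b is well defined and injective if a polynomial kills a exactly when its
  partner kills b. From a to b, the remainder modulo \<open>g1\<close> vanishes by minimality. From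
  b to a, minimality of \<open>g2\<close> among the polynomials killing b is not given, and the
  argument is in effect that \<open>g1\<close> is irreducible.\<close>

lemma pair_ring_adjoin:
  assumes g: "pair_poly R g1 g2" "g1 \<noteq> 0" "poly g1 a = 0" "poly g2 b = 0"
    and min: "\<And>f1 f2. pair_poly R f1 f2 \<Longrightarrow> f1 \<noteq> 0 \<Longrightarrow> poly f1 a = 0 \<Longrightarrow> degree g1 \<le> degree f1"
  shows "pair_ring (adjoin a b)"
proof -
  have fwd: "poly f2 b = 0" if f: "pair_poly R f1 f2" "poly f1 a = 0" for f1 f2
  proof -
    obtain c d s1 s2 r1 r2 where
      *: "(c, d) \<in> R" "c \<noteq> 0" "pair_poly R r1 r2"
         "smult c f1 = g1 * s1 + r1" "smult d f2 = g2 * s2 + r2" "r1 = 0 \<or> degree r1 < degree g1"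
      using pair_poly_pseudo_div[OF f(1) g(1,2)] by blast
    have "poly r1 a = 0"
      using arg_cong[OF *(4), of "\<lambda>p. poly p a"] f g by simp
    then have "r1 = 0"
      using min[OF *(3)] *(6) by fastforce
    then have "r2 = 0"
      using pair_poly_zero_iff[OF *(3)] by simp
    moreover have "d \<noteq> 0"
      using pair_ringD(7)[OF R] * by blast
    ultimately show ?thesis
      using arg_cong[OF *(5), of "\<lambda>p. poly p b"] g by simp
  qed
  have bwd: "poly f1 a = 0" if f: "pair_poly R f1 f2" "poly f2 b = 0" for f1 f2
  \<comment> \<open>A counterexample \<open>h\<close> of least degree is divided into
    \<open>g\<close>. The remainder is no counterexample, so it vanishes at a, and hence so does the
    quotient \<open>s1\<close>. As \<open>degree h1\<close> is positive, minimality of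
    \<open>g1\<close> leaves only \<open>s1 = 0\<close>. Thus \<open>g1\<close> has smaller degree
    than \<open>h1\<close>, and reducing \<open>h\<close> modulo \<open>g\<close> gives a smaller
    counterexample.\<close>
  proof (rule ccontr)
    define bad where "bad = (\<lambda>n. \<exists>f1 f2. pair_poly R f1 f2 \<and> poly f2 b = 0 \<and> poly f1 a \<noteq> 0 \<and> degree f1 = n)"
    assume "poly f1 a \<noteq> 0"
    then have "bad (degree f1)"
      using f by (auto simp: bad_def)
    then have "bad (LEAST n. bad n)"
      by (rule LeastI)
    then obtain h1 h2 where h: "pair_poly R h1 h2" "poly h2 b = 0" "poly h1 a \<noteq> 0" "degree h1 = (LEAST n. bad n)"
      by (auto simp: bad_def)
    have h0: "h1 \<noteq> 0" "h2 \<noteq> 0"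
      using h pair_poly_zero_iff[OF h(1)] by auto
    obtain c d s1 s2 r1 r2 where
      *: "(c, d) \<in> R" "c \<noteq> 0" "pair_poly R s1 s2" "pair_poly R r1 r2"
         "smult c g1 = h1 * s1 + r1" "smult d g2 = h2 * s2 + r2" "r1 = 0 \<or> degree r1 < degree h1"
      using pair_poly_pseudo_div[OF g(1) h(1)] h0 by blast
    have r2b: "poly r2 b = 0"
      using arg_cong[OF *(6), of "\<lambda>p. poly p b"] g h by simp
    have r1a: "poly r1 a = 0"
    proof (cases "r1 = 0")
      case False
      then have "\<not> bad (degree r1)"
        using * h(4) not_less_Least by metis
      then show ?thesis
        using * r2b by (auto simp: bad_def)
    qed simp
    have s1a: "poly s1 a = 0"
      using arg_cong[OF *(5), of "\<lambda>p. poly p a"] g h r1a by simp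
    have dh: "degree h1 \<noteq> 0"
    proof
      assume "degree h1 = 0"
      then obtain w where "h2 = [:w:]"
        using pair_poly_degree[OF h(1)] degree_eq_zeroE by metis
      then show False
        using h h0 by simp
    qed
    have "s1 = 0"
    proof (rule ccontr)
      assume s0: "s1 \<noteq> 0"
      then have ds: "degree g1 \<le> degree s1"
        using min[OF *(3)] s1a by simp
      have "degree (h1 * s1) = degree h1 + degree s1"
        using h0 s0 by (simp add: degree_mult_eq)
      moreover have "degree r1 < degree (h1 * s1)"
        using * calculation dh by auto
      ultimately have "degree (smult c g1) = degree h1 + degree s1"
        using *(5) by (simp add: degree_add_eq_left)
      then show False
        using *(2) ds dh by simp
    qed
    then have "smult c g1 = r1"
      using * by simp
    then have "degree r1 = degree g1" "r1 \<noteq> 0"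
      using *(2) g by auto
    then have "degree g1 < degree h1"
      using * by auto
    moreover obtain c' d' t1 t2 u1 u2 where
      **: "(c', d') \<in> R" "c' \<noteq> 0" "pair_poly R t1 t2" "pair_poly R u1 u2"
         "smult c' h1 = g1 * t1 + u1" "smult d' h2 = g2 * t2 + u2" "u1 = 0 \<or> degree u1 < degree g1"
      using pair_poly_pseudo_div[OF h(1) g(1,2)] by blast
    have "poly u2 b = 0"
      using arg_cong[OF **(6), of "\<lambda>p. poly p b"] g h by simp
    moreover have "poly u1 a \<noteq> 0"
    proof -
      have "poly u1 a = c' * poly h1 a"
        using arg_cong[OF **(5), of "\<lambda>p. poly p a"] g by simp
      then show ?thesis
        using h(3) **(2) by simp
    qed
    ultimately have "bad (degree u1)" "degree u1 < degree h1"
      using ** by (auto simp: bad_def)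
    then show False
      using h(4) not_less_Least by metis
  qed
  show ?thesis
    unfolding pair_ring_def
  proof (intro conjI allI impI)
    show "(1, 1) \<in> adjoin a b"
      using subset_adjoin pair_ringD(1)[OF R] by blast
  next
    fix x y x' y' assume "(x, y) \<in> adjoin a b" "(x', y') \<in> adjoin a b"
    then obtain p q p' q' where *: "pair_poly R p q" "pair_poly R p' q'"
      "x = poly p a" "y = poly q b" "x' = poly p' a" "y' = poly q' b"
      unfolding adjoin_def by blast
    show "(x - x', y - y') \<in> adjoin a b"
      unfolding adjoin_def using pair_poly_diff[OF *(1,2)] *(3-) by (force simp del: poly_diff simp: poly_diff[symmetric])
    show "(x * x', y * y') \<in> adjoin a b"
      unfolding adjoin_def using pair_poly_mult[OF *(1,2)] *(3-) by (force simp del: poly_mult simp: poly_mult[symmetric])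
  next
    fix x y assume "(x, y) \<in> adjoin a b"
    then show "x = 0 \<longleftrightarrow> y = 0"
      using fwd bwd by (auto simp: adjoin_def)
  qed
qed

end

section \<open>Automorphisms of the algebraic numbers\<close>

lemma complex_ring_simps [simp]:
  "carrier complex_ring = UNIV" "mult complex_ring = (*)" "one complex_ring = 1"
  "\<zero>\<^bsub>complex_ring\<^esub> = 0" "add complex_ring = (+)"
  by (simp_all add: ring_of_type_algebra_def)

lemma field_complex_ring: "field complex_ring"
  by (rule field_from_type_algebra)

lemmas ring_complex_ring = field.is_ring[OF field_complex_ring]

lemma complex_ring_uminus [simp]: "a_inv complex_ring x = - x"
  by (rule abelian_group.minus_equality[OF ring.is_abelian_group[OF ring_complex_ring]]) simp_all

lemma complex_ring_inv: "x \<noteq> 0 \<Longrightarrow> m_inv complex_ring x = inverse x"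
  by (rule comm_monoid.comm_inv_char[OF cring.axioms(2)[OF field_from_type_algebra[THEN fieldE(1)]]]) simp_all

lemma complex_ring_pow [simp]: "x [^]\<^bsub>complex_ring\<^esub> (n :: nat) = x ^ n"
  by (induction n) (simp_all add: ac_simps)

lemma subfieldD:
  assumes "subfield F complex_ring"
  shows "0 \<in> F" "1 \<in> F"
    and "x \<in> F \<Longrightarrow> y \<in> F \<Longrightarrow> x + y \<in> F"
    and "x \<in> F \<Longrightarrow> y \<in> F \<Longrightarrow> x - y \<in> F"
    and "x \<in> F \<Longrightarrow> y \<in> F \<Longrightarrow> x * y \<in> F"
    and "x \<in> F \<Longrightarrow> - x \<in> F"
    and "x \<in> F \<Longrightarrow> inverse x \<in> F"
    and "x \<in> F \<Longrightarrow> y \<in> F \<Longrightarrow> x / y \<in> F"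
proof -
  note s = subfieldE(1)[OF assms]
  show zero: "0 \<in> F" and "1 \<in> F"
    using subringE(2,3)[OF s] by simp_all
  show "x \<in> F \<Longrightarrow> y \<in> F \<Longrightarrow> x + y \<in> F"
    using subringE(7)[OF s, of x y] by simp
  show mult: "x \<in> F \<Longrightarrow> y \<in> F \<Longrightarrow> x * y \<in> F" for x y
    using subringE(6)[OF s, of x y] by simp
  show "x \<in> F \<Longrightarrow> - x \<in> F"
    using subringE(5)[OF s, of x] by simp
  show "x \<in> F \<Longrightarrow> y \<in> F \<Longrightarrow> x - y \<in> F"
    using subringE(7)[OF s, of x "- y"] subringE(5)[OF s, of y] by simp
  show inv: "x \<in> F \<Longrightarrow> inverse x \<in> F" for x
    using ring.subfield_m_inv(1)[OF ring_complex_ring assms, of x] zero by (cases "x = 0") (simp_all add: complex_ring_inv)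
  show "x \<in> F \<Longrightarrow> y \<in> F \<Longrightarrow> x / y \<in> F"
    unfolding divide_inverse by (intro mult inv)
qed

lemma subfield_complexI:
  assumes "1 \<in> F"
    and "\<And>x y. x \<in> F \<Longrightarrow> y \<in> F \<Longrightarrow> x + y \<in> F"
    and "\<And>x y. x \<in> F \<Longrightarrow> y \<in> F \<Longrightarrow> x * y \<in> F"
    and "\<And>x. x \<in> F \<Longrightarrow> - x \<in> F"
    and "\<And>x. x \<in> F \<Longrightarrow> x \<noteq> 0 \<Longrightarrow> inverse x \<in> F"
  shows "subfield F complex_ring"
  using assms by (intro field.subfieldI'[OF field_complex_ring] ring.subringI[OF ring_complex_ring]) (simp_all add: complex_ring_inv)

lemma subfield_of_int: "subfield F complex_ring \<Longrightarrow> of_int n \<in> F"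
proof -
  assume F: "subfield F complex_ring"
  have "of_nat k \<in> F" for k
    by (induction k) (auto intro: subfieldD[OF F])
  then show ?thesis
    by (cases n) (auto intro!: subfieldD(4)[OF F] subfieldD[OF F] simp del: of_nat_Suc)
qed

lemma subfield_Rats: "subfield F complex_ring \<Longrightarrow> \<rat> \<subseteq> F"
  by (auto simp: subfield_of_int subfieldD(8) elim!: Rats_cases')

lemma subfield_RatsI: "subfield (\<rat> :: complex set) complex_ring"
  by (rule subfield_complexI) auto

lemma subfield_sum:
  "subfield F complex_ring \<Longrightarrow> (\<And>i. i \<in> I \<Longrightarrow> f i \<in> F) \<Longrightarrow> sum f I \<in> F"
  by (induction I rule: infinite_finite_induct) (simp_all add: subfieldD)

lemma subfield_power: "subfield F complex_ring \<Longrightarrow> x \<in> F \<Longrightarrow> x ^ n \<in> F"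
  by (induction n) (simp_all add: subfieldD)

lemma subfield_poly:
  "subfield F complex_ring \<Longrightarrow> (\<And>i. coeff p i \<in> F) \<Longrightarrow> x \<in> F \<Longrightarrow> poly p x \<in> F"
  unfolding poly_altdef by (intro subfield_sum subfieldD(5) subfield_power)

text \<open>HOL-Algebra lists coefficients from the leading one down, \<open>Poly\<close> from the
  constant one up; hence the reversal.\<close>

lemma eval_complex_ring: "ring.eval complex_ring p x = poly (Poly (rev p)) x"
proof (induction p)
  case (Cons a p)
  then show ?case
    by (simp add: Poly_append poly_monom ring.eval.simps[OF ring_complex_ring])
qed (simp add: ring.eval.simps[OF ring_complex_ring])

text \<open>Links the two notions of algebraicity, so that the HOL-Algebra theorem that the
  algebraic elements form a subfield applies to \<open>Qbar\<close>.\<close>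

lemma algebraic_over_Rats_iff: "\<not> ring.transcendental complex_ring \<rat> x \<longleftrightarrow> algebraic x"
proof
  assume "\<not> ring.transcendental complex_ring \<rat> x"
  then obtain p where p: "p \<in> carrier (\<rat>[X]\<^bsub>complex_ring\<^esub>)" "p \<noteq> []" "ring.eval complex_ring p x = 0"
    using domain.algebraicE[OF field.axioms(1)[OF field_complex_ring] subfieldE(1)[OF subfield_RatsI]]
    by (auto simp: over_def)
  then have *: "set p \<subseteq> \<rat>" "hd p \<noteq> 0"
    by (auto simp: univ_poly_carrier[symmetric] polynomial_def)
  have "Poly (rev p) \<noteq> 0"
  proof -
    have "coeff (Poly (rev p)) (length p - 1) = hd p"
      using p(2) by (simp add: coeff_Poly_eq nth_default_def rev_nth hd_conv_nth)
    then show ?thesis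
      using *(2) by (metis coeff_0)
  qed
  moreover have "coeff (Poly (rev p)) i \<in> \<rat>" for i
    using *(1) nth_mem[of "length p - Suc i" p] by (auto simp: coeff_Poly_eq nth_default_def rev_nth)
  ultimately show "algebraic x"
    using p(3) by (intro algebraicI'[of "Poly (rev p)"]) (auto simp: eval_complex_ring)
next
  assume "algebraic x"
  then obtain p where p: "\<And>i. coeff p i \<in> \<int>" "p \<noteq> 0" "poly p x = 0"
    unfolding algebraic_def by blast
  have "set (coeffs p) \<subseteq> \<rat>"
    using p(1) Ints_subset_Rats by (auto simp: coeffs_def)
  moreover have "hd (rev (coeffs p)) \<noteq> 0"
    using p(2) by (simp add: hd_rev last_coeffs_eq_coeff_degree)
  ultimately show "\<not> ring.transcendental complex_ring \<rat> x"
    using p by (intro ring.algebraicI[OF ring_complex_ring, unfolded over_def, of "rev (coeffs p)"])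
      (auto simp: univ_poly_carrier[symmetric] polynomial_def eval_complex_ring)
qed

lemma subfield_Qbar: "subfield Qbar complex_ring"
  using field.subfield_of_algebraics[OF field_complex_ring subfield_RatsI]
  by (simp add: algebraic_over_Rats_iff over_def Qbar_def)

section \<open>Minimal polynomials over a pair ring and extension to all of
  \<open>Qbar\<close>\<close>

lemma Qbar_int_poly: "a \<in> Qbar \<Longrightarrow> \<exists>p. (\<forall>i. coeff p i \<in> \<int>) \<and> p \<noteq> 0 \<and> poly p a = 0"
  by (auto simp: Qbar_def algebraic_def)

text \<open>The substitute for a minimal polynomial of a over the domain of \<open>R\<close>,
  carried along with its image over the range. Over a mere ring it cannot in general be made
  monic.\<close>

definition minimal_pair :: "(complex \<times> complex) set \<Rightarrow> complex poly \<Rightarrow> complex poly \<Rightarrow> complex \<Rightarrow> bool" where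
  "minimal_pair R g1 g2 a \<longleftrightarrow> pair_poly R g1 g2 \<and> g1 \<noteq> 0 \<and> poly g1 a = 0 \<and>
     (\<forall>f1 f2. pair_poly R f1 f2 \<longrightarrow> f1 \<noteq> 0 \<longrightarrow> poly f1 a = 0 \<longrightarrow> degree g1 \<le> degree f1)"

text \<open>Pair rings pair each integer with itself, so an integer polynomial killing a is its own
  partner and there is a least degree.\<close>

lemma ex_minimal_pair:
  assumes R: "pair_ring R" and a: "a \<in> Qbar"
  shows "\<exists>g1 g2. minimal_pair R g1 g2 a"
proof -
  define ok where "ok = (\<lambda>n. \<exists>f1 f2. pair_poly R f1 f2 \<and> f1 \<noteq> 0 \<and> poly f1 a = 0 \<and> degree f1 = n)"
  obtain p where p: "\<And>i. coeff p i \<in> \<int>" "p \<noteq> 0" "poly p a = 0"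
    using a Qbar_int_poly by blast
  then have "ok (degree p)"
    using pair_poly_of_int[OF R] by (auto simp: ok_def)
  then have "ok (LEAST n. ok n)"
    by (rule LeastI)
  then obtain g1 g2 where g: "pair_poly R g1 g2" "g1 \<noteq> 0" "poly g1 a = 0" "degree g1 = (LEAST n. ok n)"
    by (auto simp: ok_def)
  have "degree g1 \<le> degree f1" if "pair_poly R f1 f2" "f1 \<noteq> 0" "poly f1 a = 0" for f1 f2
    unfolding g(4) using that by (intro Least_le) (auto simp: ok_def)
  then show ?thesis
    using g by (auto simp: minimal_pair_def)
qed

text \<open>Beyond \<open>pair_ring_adjoin\<close>, the new range has to stay algebraic: an integer
  polynomial killing a is its own partner, and the extended isomorphism forces it to kill b.\<close>

lemma adjoin_minimal_pair:
  assumes R: "pair_ring R" "R \<subseteq> Qbar \<times> Qbar" and a: "a \<in> Qbar"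
    and g: "minimal_pair R g1 g2 a" "poly g2 b = 0"
  shows "pair_ring (adjoin R a b)" "adjoin R a b \<subseteq> Qbar \<times> Qbar"
proof -
  show adj: "pair_ring (adjoin R a b)"
    using g unfolding minimal_pair_def by (intro pair_ring_adjoin[OF R(1)]) auto
  obtain p where p: "\<And>i. coeff p i \<in> \<int>" "p \<noteq> 0" "poly p a = 0"
    using a Qbar_int_poly by blast
  have "(poly p a, poly p b) \<in> adjoin R a b"
    using pair_poly_of_int[OF R(1) p(1)] by (auto simp: adjoin_def[OF R(1)])
  then have "poly p b = 0"
    using pair_ringD(7)[OF adj] p(3) by blast
  then have b: "b \<in> Qbar"
    using p by (auto simp: Qbar_def intro: algebraicI)
  show "adjoin R a b \<subseteq> Qbar \<times> Qbar"
  proof safe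
    fix x y assume "(x, y) \<in> adjoin R a b"
    then obtain p q where *: "pair_poly R p q" "x = poly p a" "y = poly q b"
      by (auto simp: adjoin_def[OF R(1)])
    then have "coeff p i \<in> Qbar" "coeff q i \<in> Qbar" for i
      using R(2) by (auto simp: pair_poly_def)
    then show "x \<in> Qbar" "y \<in> Qbar"
      using * a b by (auto intro!: subfield_poly[OF subfield_Qbar])
  qed
qed

lemma ex_adjoin:
  assumes R: "pair_ring R" "R \<subseteq> Qbar \<times> Qbar" and a: "a \<in> Qbar"
  shows "\<exists>b. pair_ring (adjoin R a b) \<and> adjoin R a b \<subseteq> Qbar \<times> Qbar"
proof -
  obtain g1 g2 where g: "minimal_pair R g1 g2 a"
    using ex_minimal_pair[OF R(1) a] by blast
  \<comment> \<open>Partners have equal degree, and a constant \<open>g1\<close> could not be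
    nonzero and vanish at a; so \<open>g2\<close> is nonconstant and has a complex root.\<close>
  have "degree g2 \<noteq> 0"
  proof
    assume "degree g2 = 0"
    then have "degree g1 = 0"
      using pair_poly_degree[OF R(1)] g unfolding minimal_pair_def by metis
    then obtain c where "g1 = [:c:]"
      using degree_eq_zeroE by blast
    then show False
      using g by (auto simp: minimal_pair_def)
  qed
  then obtain b where "poly g2 b = 0"
    using fundamental_theorem_of_algebra constant_degree by metis
  then show ?thesis
    using adjoin_minimal_pair[OF R a g] by blast
qed

text \<open>Invariance of the rationals follows from additivity, multiplicativity and
  \<open>\<sigma> 1 = 1\<close>, so automorphisms can be built without checking it
  separately.\<close>

lemma Gal_iff:
  assumes F: "subfield F complex_ring"
  shows "\<sigma> \<in> carrier (Gal F) \<longleftrightarrow> \<sigma> \<in> extensional F \<and> bij_betw \<sigma> F F \<and> \<sigma> 1 = 1 \<and>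
    (\<forall>x\<in>F. \<forall>y\<in>F. \<sigma> (x + y) = \<sigma> x + \<sigma> y \<and> \<sigma> (x * y) = \<sigma> x * \<sigma> y)" (is "_ \<longleftrightarrow> ?R")
proof
  show "\<sigma> \<in> carrier (Gal F) \<Longrightarrow> ?R"
    by (auto simp: Gal_def Bij_def ring_hom_def)
next
  assume R: ?R
  then have in_F: "\<sigma> x \<in> F" if "x \<in> F" for x
    using that bij_betwE by blast
  have add: "\<sigma> (x + y) = \<sigma> x + \<sigma> y" and mult: "\<sigma> (x * y) = \<sigma> x * \<sigma> y"
    if "x \<in> F" "y \<in> F" for x y
    using R that by blast+
  have z: "\<sigma> 0 = 0"
    using add[of 0 0] subfieldD(1)[OF F] by simp
  have m: "\<sigma> (- x) = - \<sigma> x" if "x \<in> F" for x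
    using add[of x "- x"] z that subfieldD(6)[OF F that] by (simp add: eq_neg_iff_add_eq_0 add.commute)
  have nat: "\<sigma> (of_nat k) = of_nat k" for k
  proof (induction k)
    case (Suc k)
    have "of_nat k \<in> F"
      using subfield_of_int[OF F, of "int k"] by simp
    then show ?case
      using Suc R add[of 1 "of_nat k"] subfieldD(2)[OF F] by simp
  qed (simp add: z)
  have int: "\<sigma> (of_int n) = of_int n" for n
  proof (cases n rule: int_cases2)
    case (nonneg k)
    then show ?thesis
      using nat[of k] by simp
  next
    case (nonpos k)
    then show ?thesis
      using nat[of k] m[of "of_nat k"] subfield_of_int[OF F, of "int k"] by simp
  qed
  have "\<sigma> q = q" if q: "q \<in> \<rat>" for q
  proof -
    obtain a b where ab: "q = of_int a / of_int b" "b > 0"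
      using Rats_cases'[OF q] by metis
    have "q \<in> F"
      using q subfield_Rats[OF F] by blast
    then have "\<sigma> (q * of_int b) = \<sigma> q * of_int b"
      using mult[of q "of_int b"] subfield_of_int[OF F, of b] int[of b] by simp
    then show ?thesis
      using ab int[of a] by (metis less_numeral_extra(3) nonzero_eq_divide_eq of_int_eq_0_iff)
  qed
  then show "\<sigma> \<in> carrier (Gal F)"
    using R in_F by (auto simp: Gal_def Bij_def ring_hom_def)
qed

text \<open>A maximal pair ring in \<open>Qbar \<times> Qbar\<close>, given by Zorn's lemma, is
  total because any missing algebraic number could be adjoined. The same argument for its converse
  gives surjectivity.\<close>

lemma extend_to_Qbar:
  assumes R: "pair_ring R" "R \<subseteq> Qbar \<times> Qbar"
  shows "\<exists>\<rho>\<in>carrier GQ. \<forall>x y. (x, y) \<in> R \<longrightarrow> \<rho> x = y"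
proof -
  define A where "A = {S. pair_ring S \<and> R \<subseteq> S \<and> S \<subseteq> Qbar \<times> Qbar}"
  have "\<exists>M\<in>A. \<forall>Y\<in>A. M \<subseteq> Y \<longrightarrow> Y = M"
  proof (rule subset_Zorn_nonempty)
    show "A \<noteq> {}"
      using R by (auto simp: A_def)
  next
    fix Ch assume Ch: "Ch \<noteq> {}" "subset.chain A Ch"
    have two: "\<exists>S\<in>Ch. u \<in> S \<and> v \<in> S" if "u \<in> \<Union>Ch" "v \<in> \<Union>Ch" for u v
      using that Ch(2) unfolding subset.chain_def by blast
    have pr: "pair_ring S" "R \<subseteq> S" "S \<subseteq> Qbar \<times> Qbar" if "S \<in> Ch" for S
      using that Ch(2) unfolding subset.chain_def A_def by auto
    have "pair_ring (\<Union>Ch)"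
      unfolding pair_ring_def
    proof (intro conjI allI impI)
      show "(1, 1) \<in> \<Union>Ch"
        using Ch(1) pr pair_ringD(1) by blast
    next
      fix x y x' y' assume "(x, y) \<in> \<Union>Ch" "(x', y') \<in> \<Union>Ch"
      then obtain S where S: "S \<in> Ch" "(x, y) \<in> S" "(x', y') \<in> S"
        using two by blast
      show "(x - x', y - y') \<in> \<Union>Ch"
        using S pair_ringD(3)[OF pr(1)] by blast
      show "(x * x', y * y') \<in> \<Union>Ch"
        using S pair_ringD(5)[OF pr(1)] by blast
    next
      fix x y assume "(x, y) \<in> \<Union>Ch"
      then show "x = 0 \<longleftrightarrow> y = 0"
        using pair_ringD(7)[OF pr(1)] by blast
    qed
    moreover have "\<Union>Ch \<subseteq> Qbar \<times> Qbar"
      using pr(3) by (rule Union_least)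
    ultimately show "\<Union>Ch \<in> A"
      using pr(2) Ch(1) by (auto simp: A_def)
  qed
  then obtain M where M: "M \<in> A" "\<And>Y. Y \<in> A \<Longrightarrow> M \<subseteq> Y \<Longrightarrow> Y = M"
    by blast
  have pM: "pair_ring M" "R \<subseteq> M" "M \<subseteq> Qbar \<times> Qbar"
    using M by (auto simp: A_def)
  have dom: "\<exists>b. (a, b) \<in> M" if a: "a \<in> Qbar" for a
  proof -
    obtain b where "pair_ring (adjoin M a b)" "adjoin M a b \<subseteq> Qbar \<times> Qbar"
      using ex_adjoin[OF pM(1,3) a] by blast
    moreover note subset_adjoin[OF pM(1), of a b]
    ultimately have "adjoin M a b = M"
      using pM(2) by (intro M) (auto simp: A_def)
    then show ?thesis
      using mem_adjoin[OF pM(1), of a b] by auto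
  qed
  have ran: "\<exists>b. (b, a) \<in> M" if a: "a \<in> Qbar" for a
  proof -
    have pc: "pair_ring (M\<inverse>)" "M\<inverse> \<subseteq> Qbar \<times> Qbar"
      using pM by (auto simp: pair_ring_converse)
    obtain b where b: "pair_ring (adjoin (M\<inverse>) a b)" "adjoin (M\<inverse>) a b \<subseteq> Qbar \<times> Qbar"
      using ex_adjoin[OF pc a] by blast
    moreover have "M \<subseteq> (adjoin (M\<inverse>) a b)\<inverse>"
      using subset_adjoin[OF pc(1), of a b] by (auto dest: subsetD)
    ultimately have "(adjoin (M\<inverse>) a b)\<inverse> = M"
      using pM(2) by (intro M) (auto simp: A_def pair_ring_converse)
    then show ?thesis
      using mem_adjoin[OF pc(1), of a b] by blast
  qed
  define \<rho> where "\<rho> = (\<lambda>x\<in>Qbar. THE y. (x, y) \<in> M)"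
  have \<rho>: "\<rho> x = y" if "(x, y) \<in> M" for x y
    using that pM(3) pair_ringD(8)[OF pM(1)] by (auto simp: \<rho>_def)
  have \<rho>M: "(x, \<rho> x) \<in> M" if "x \<in> Qbar" for x
    using dom[OF that] \<rho> by blast
  have "\<rho> \<in> carrier GQ"
    unfolding Gal_iff[OF subfield_Qbar]
  proof (intro conjI ballI)
    show "\<rho> \<in> extensional Qbar"
      by (simp add: \<rho>_def)
    show "\<rho> 1 = 1"
      using pair_ringD(1)[OF pM(1)] by (rule \<rho>)
    have "inj_on \<rho> Qbar"
      by (rule inj_onI) (metis \<rho>M pair_ringD(9)[OF pM(1)])
    moreover have "\<rho> ` Qbar = Qbar"
    proof
      show "\<rho> ` Qbar \<subseteq> Qbar"
        using \<rho>M pM(3) by blast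
      show "Qbar \<subseteq> \<rho> ` Qbar"
      proof
        fix y assume "y \<in> Qbar"
        then obtain x where "(x, y) \<in> M"
          using ran by blast
        then show "y \<in> \<rho> ` Qbar"
          using \<rho>[of x y] pM(3) by blast
      qed
    qed
    ultimately show "bij_betw \<rho> Qbar Qbar"
      by (simp add: bij_betw_def)
  next
    fix x y assume "x \<in> Qbar" "y \<in> Qbar"
    then show "\<rho> (x + y) = \<rho> x + \<rho> y" "\<rho> (x * y) = \<rho> x * \<rho> y"
      using \<rho>M pair_ringD(4,5)[OF pM(1)] by (auto intro!: \<rho>)
  qed
  then show ?thesis
    using \<rho> pM(2) by blast
qed

section \<open>Galois groups\<close>

abbreviation Aut :: "complex set \<Rightarrow> (complex \<Rightarrow> complex) set" where
  "Aut F \<equiv> carrier (Gal F)"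

lemma Gal_simps:
  "\<sigma> \<in> Aut F \<Longrightarrow> \<tau> \<in> Aut F \<Longrightarrow> \<sigma> \<otimes>\<^bsub>Gal F\<^esub> \<tau> = compose F \<sigma> \<tau>"
  "\<one>\<^bsub>Gal F\<^esub> = (\<lambda>x\<in>F. x)"
  by (simp_all add: Gal_def BijGroup_def)

lemma Gal_mult_apply:
  "\<sigma> \<in> Aut F \<Longrightarrow> \<tau> \<in> Aut F \<Longrightarrow> x \<in> F \<Longrightarrow> (\<sigma> \<otimes>\<^bsub>Gal F\<^esub> \<tau>) x = \<sigma> (\<tau> x)"
  by (simp add: Gal_simps compose_def)

lemma Gal_one_apply: "x \<in> F \<Longrightarrow> \<one>\<^bsub>Gal F\<^esub> x = x"
  by (simp add: Gal_simps)

locale number_field =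
  fixes F :: "complex set"
  assumes sf: "subfield F complex_ring"
begin

lemmas sf_simps = subfieldD[OF sf] subfield_of_int[OF sf]

lemma Gal_hom:
  assumes "\<sigma> \<in> Aut F"
  shows "x \<in> F \<Longrightarrow> y \<in> F \<Longrightarrow> \<sigma> (x + y) = \<sigma> x + \<sigma> y"
    and "x \<in> F \<Longrightarrow> y \<in> F \<Longrightarrow> \<sigma> (x * y) = \<sigma> x * \<sigma> y"
    and "\<sigma> 1 = 1" "\<sigma> 0 = 0"
    and "x \<in> F \<Longrightarrow> \<sigma> (- x) = - \<sigma> x"
    and "x \<in> F \<Longrightarrow> y \<in> F \<Longrightarrow> \<sigma> (x - y) = \<sigma> x - \<sigma> y"
    and "x \<in> F \<Longrightarrow> \<sigma> x \<in> F"
    and "x \<in> F \<Longrightarrow> y \<in> F \<Longrightarrow> \<sigma> x = \<sigma> y \<longleftrightarrow> x = y"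
    and "x \<in> F \<Longrightarrow> \<sigma> x = 0 \<longleftrightarrow> x = 0"
    and "\<sigma> ` F = F"
    and "\<sigma> \<in> extensional F"
    and "x \<in> F \<Longrightarrow> \<sigma> (inverse x) = inverse (\<sigma> x)"
    and "x \<in> F \<Longrightarrow> y \<in> F \<Longrightarrow> \<sigma> (x / y) = \<sigma> x / \<sigma> y"
    and "x \<in> F \<Longrightarrow> \<sigma> (x ^ n) = \<sigma> x ^ n"
    and "q \<in> \<rat> \<Longrightarrow> \<sigma> q = q"
proof -
  have *: "\<sigma> \<in> extensional F" "bij_betw \<sigma> F F" "\<sigma> 1 = 1"
    and add: "\<And>x y. x \<in> F \<Longrightarrow> y \<in> F \<Longrightarrow> \<sigma> (x + y) = \<sigma> x + \<sigma> y"
    and mult: "\<And>x y. x \<in> F \<Longrightarrow> y \<in> F \<Longrightarrow> \<sigma> (x * y) = \<sigma> x * \<sigma> y"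
    using assms unfolding Gal_iff[OF sf] by blast+
  have F0: "0 \<in> F"
    by (rule sf_simps)
  show z: "\<sigma> 0 = 0"
    using add[OF F0 F0] by simp
  have minus: "\<sigma> (- x) = - \<sigma> x" if "x \<in> F" for x
    using add[OF that sf_simps(6)[OF that]] z by (simp add: eq_neg_iff_add_eq_0 add.commute)
  show "x \<in> F \<Longrightarrow> \<sigma> (- x) = - \<sigma> x"
    by (rule minus)
  show "x \<in> F \<Longrightarrow> y \<in> F \<Longrightarrow> \<sigma> (x - y) = \<sigma> x - \<sigma> y"
    using add[of x "- y"] minus[of y] sf_simps(6)[of y] by simp
  show "x \<in> F \<Longrightarrow> \<sigma> x \<in> F"
    using *(2) bij_betwE by blast
  have inj: "\<sigma> x = \<sigma> y \<longleftrightarrow> x = y" if "x \<in> F" "y \<in> F" for x y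
    using *(2) that bij_betw_def inj_on_eq_iff by metis
  then show "x \<in> F \<Longrightarrow> y \<in> F \<Longrightarrow> \<sigma> x = \<sigma> y \<longleftrightarrow> x = y"
    by blast
  show nz: "x \<in> F \<Longrightarrow> \<sigma> x = 0 \<longleftrightarrow> x = 0" for x
    using inj[OF _ F0] z by simp
  show "\<sigma> ` F = F"
    using *(2) by (simp add: bij_betw_def)
  have inv: "\<sigma> (inverse x) = inverse (\<sigma> x)" if "x \<in> F" for x
  proof (cases "x = 0")
    case False
    then have "\<sigma> x * \<sigma> (inverse x) = 1"
      using mult[OF that sf_simps(7)[OF that]] *(3) by simp
    then show ?thesis
      by (simp add: inverse_unique)
  qed (simp add: z)
  then show "x \<in> F \<Longrightarrow> \<sigma> (inverse x) = inverse (\<sigma> x)"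
    by blast
  show "x \<in> F \<Longrightarrow> y \<in> F \<Longrightarrow> \<sigma> (x / y) = \<sigma> x / \<sigma> y"
    unfolding divide_inverse using mult inv sf_simps(7) by simp
  show "x \<in> F \<Longrightarrow> \<sigma> (x ^ n) = \<sigma> x ^ n"
    by (induction n) (auto simp: mult *(3) subfield_power[OF sf])
  show "q \<in> \<rat> \<Longrightarrow> \<sigma> q = q"
    using assms by (simp add: Gal_def)
  show "x \<in> F \<Longrightarrow> y \<in> F \<Longrightarrow> \<sigma> (x + y) = \<sigma> x + \<sigma> y"
    "x \<in> F \<Longrightarrow> y \<in> F \<Longrightarrow> \<sigma> (x * y) = \<sigma> x * \<sigma> y"
    using add mult by blast+
  show "\<sigma> \<in> extensional F" "\<sigma> 1 = 1"
    using * by blast+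
qed

lemma Gal_eqI:
  "\<sigma> \<in> Aut F \<Longrightarrow> \<tau> \<in> Aut F \<Longrightarrow> (\<And>x. x \<in> F \<Longrightarrow> \<sigma> x = \<tau> x) \<Longrightarrow> \<sigma> = \<tau>"
  using Gal_hom(11) extensionalityI by blast

lemma group_Gal: "group (Gal F)"
proof (rule groupI)
  show mult: "\<sigma> \<otimes>\<^bsub>Gal F\<^esub> \<tau> \<in> Aut F"
    if *: "\<sigma> \<in> Aut F" "\<tau> \<in> Aut F" for \<sigma> \<tau>
  proof -
    have "bij_betw (compose F \<sigma> \<tau>) F F"
      using * by (auto simp: Gal_iff[OF sf] intro: bij_betw_compose)
    then have "compose F \<sigma> \<tau> \<in> Aut F"
      unfolding Gal_iff[OF sf] by (simp add: compose_def Gal_hom[OF *(1)] Gal_hom[OF *(2)] sf_simps)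
    then show ?thesis
      by (simp add: Gal_simps(1)[OF *])
  qed
  show one: "\<one>\<^bsub>Gal F\<^esub> \<in> Aut F"
    unfolding Gal_iff[OF sf] Gal_simps by (auto simp: sf_simps bij_betw_def inj_on_def)
  show "\<sigma> \<otimes>\<^bsub>Gal F\<^esub> \<tau> \<otimes>\<^bsub>Gal F\<^esub> \<eta> = \<sigma> \<otimes>\<^bsub>Gal F\<^esub> (\<tau> \<otimes>\<^bsub>Gal F\<^esub> \<eta>)"
    if "\<sigma> \<in> Aut F" "\<tau> \<in> Aut F" "\<eta> \<in> Aut F" for \<sigma> \<tau> \<eta>
    using that mult by (intro Gal_eqI) (simp_all add: Gal_mult_apply Gal_hom)
  show "\<one>\<^bsub>Gal F\<^esub> \<otimes>\<^bsub>Gal F\<^esub> \<sigma> = \<sigma>" if "\<sigma> \<in> Aut F" for \<sigma>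
    using that one mult by (intro Gal_eqI) (simp_all add: Gal_mult_apply Gal_hom Gal_one_apply)
  show "\<exists>\<tau>\<in>Aut F. \<tau> \<otimes>\<^bsub>Gal F\<^esub> \<sigma> = \<one>\<^bsub>Gal F\<^esub>" if \<sigma>: "\<sigma> \<in> Aut F" for \<sigma>
  proof -
    define \<tau> where "\<tau> = (\<lambda>x\<in>F. inv_into F \<sigma> x)"
    have bij: "bij_betw \<sigma> F F"
      using \<sigma> by (simp add: Gal_iff[OF sf])
    have \<tau>\<sigma>: "\<tau> (\<sigma> x) = x" if "x \<in> F" for x
      using that bij Gal_hom(7)[OF \<sigma> that] by (simp add: \<tau>_def bij_betw_inv_into_left)
    have \<sigma>\<tau>: "\<tau> x \<in> F" "\<sigma> (\<tau> x) = x" if "x \<in> F" for x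
      using that bij bij_betwE[OF bij_betw_inv_into[OF bij]]
      by (auto simp: \<tau>_def bij_betw_inv_into_right)
    have "bij_betw \<tau> F F"
      by (rule bij_betw_byWitness[where f' = \<sigma>]) (auto simp: \<tau>\<sigma> \<sigma>\<tau> Gal_hom(7)[OF \<sigma>])
    moreover have "\<tau> (x + y) = \<tau> x + \<tau> y" "\<tau> (x * y) = \<tau> x * \<tau> y" if "x \<in> F" "y \<in> F" for x y
      using that \<tau>\<sigma>[of "\<tau> x + \<tau> y"] \<tau>\<sigma>[of "\<tau> x * \<tau> y"] by (simp_all add: Gal_hom[OF \<sigma>] \<sigma>\<tau> sf_simps)
    moreover have "\<tau> 1 = 1"
      using \<tau>\<sigma>[OF sf_simps(2)] by (simp add: Gal_hom[OF \<sigma>])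
    ultimately have \<tau>: "\<tau> \<in> Aut F"
      unfolding Gal_iff[OF sf] by (simp add: \<tau>_def)
    then have "\<tau> \<otimes>\<^bsub>Gal F\<^esub> \<sigma> = \<one>\<^bsub>Gal F\<^esub>"
      using \<sigma> one mult by (intro Gal_eqI) (simp_all add: Gal_mult_apply \<tau>\<sigma> Gal_one_apply)
    then show ?thesis
      using \<tau> by blast
  qed
qed

sublocale G: group "Gal F"
  by (rule group_Gal)

lemma Gal_inv_apply:
  assumes "\<sigma> \<in> Aut F" "x \<in> F"
  shows "(inv\<^bsub>Gal F\<^esub> \<sigma>) (\<sigma> x) = x" "\<sigma> ((inv\<^bsub>Gal F\<^esub> \<sigma>) x) = x"
  using assms Gal_mult_apply[of "inv\<^bsub>Gal F\<^esub> \<sigma>" F \<sigma> x] Gal_mult_apply[of \<sigma> F "inv\<^bsub>Gal F\<^esub> \<sigma>" x]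
  by (simp_all add: Gal_one_apply)

lemma Gal_sum:
  "\<sigma> \<in> Aut F \<Longrightarrow> (\<And>i. i \<in> I \<Longrightarrow> f i \<in> F) \<Longrightarrow> \<sigma> (sum f I) = (\<Sum>i\<in>I. \<sigma> (f i))"
  by (induction I rule: infinite_finite_induct) (simp_all add: Gal_hom subfield_sum[OF sf])

lemma Gal_poly:
  assumes "\<sigma> \<in> Aut F" "\<And>i. coeff p i \<in> F" "\<And>i. \<sigma> (coeff p i) = coeff p i" "x \<in> F"
  shows "\<sigma> (poly p x) = poly p (\<sigma> x)"
  unfolding poly_altdef using assms
  by (simp add: Gal_sum Gal_hom sf_simps subfield_power[OF sf])

lemma Gal_rat_poly:
  assumes "\<sigma> \<in> Aut F" "\<And>i. coeff p i \<in> \<rat>" "x \<in> F"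
  shows "\<sigma> (poly p x) = poly p (\<sigma> x)"
  using assms subfield_Rats[OF sf] by (intro Gal_poly) (auto simp: Gal_hom)

lemma pair_ring_graph:
  assumes "\<sigma> \<in> Aut F"
  shows "pair_ring {(x, \<sigma> x) | x. x \<in> F}"
  unfolding pair_ring_def using sf_simps by (auto simp: Gal_hom[OF assms] intro!: exI[of _ 1])

end

interpretation Qb: number_field Qbar
  by (rule number_field.intro) (rule subfield_Qbar)

subsection \<open>Rational polynomials\<close>

lemma map_poly_of_rat_mult:
  "map_poly of_rat (p * q) = map_poly of_rat p * (map_poly of_rat q :: 'a :: field_char_0 poly)"
  by (rule poly_eqI) (simp add: coeff_map_poly coeff_mult of_rat_sum of_rat_mult)

lemma map_poly_of_rat_add:
  "map_poly of_rat (p + q) = map_poly of_rat p + (map_poly of_rat q :: 'a :: field_char_0 poly)"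
  by (rule poly_eqI) (simp add: coeff_map_poly of_rat_add)

lemma degree_map_poly_of_rat: "degree (map_poly of_rat p :: 'a :: field_char_0 poly) = degree p"
  by (rule degree_map_poly) simp

lemma map_poly_of_rat_eq_0: "(map_poly of_rat p :: 'a :: field_char_0 poly) = 0 \<longleftrightarrow> p = 0"
  by (rule map_poly_eq_0_iff) simp_all

text \<open>A nonzero polynomial of least degree vanishing at x: division with remainder makes it
  divide all the others, and a proper factorisation would produce a smaller one.\<close>

lemma ex_min_rat_poly:
  assumes "algebraic (x :: complex)"
  shows "\<exists>m :: rat poly. irreducible m \<and> poly (map_poly of_rat m) x = 0 \<and>
    (\<forall>f. poly (map_poly of_rat f) x = 0 \<longrightarrow> m dvd f)"
proof -
  define ok where "ok = (\<lambda>n. \<exists>f :: rat poly. f \<noteq> 0 \<and> poly (map_poly of_rat f) x = 0 \<and> degree f = n)"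
  obtain p where p: "p \<noteq> 0" "\<forall>i. coeff p i \<in> \<rat>" "poly p x = 0"
    using assms unfolding algebraic_altdef by blast
  then obtain f where "p = map_poly of_rat f"
    using ratpolyE by blast
  then have "ok (degree f)"
    using p by (auto simp: ok_def map_poly_of_rat_eq_0)
  then have "ok (LEAST n. ok n)"
    by (rule LeastI)
  then obtain m :: "rat poly" where m: "m \<noteq> 0" "poly (map_poly of_rat m) x = 0" "degree m = (LEAST n. ok n)"
    by (auto simp: ok_def)
  have least: "f = 0" if "poly (map_poly of_rat f) x = 0" "degree f < degree m" for f :: "rat poly"
  proof (rule ccontr)
    assume "f \<noteq> 0"
    then have "ok (degree f)"
      using that by (auto simp: ok_def)
    then show False
      using that(2) m(3) not_less_Least by metis
  qed
  have dvd: "m dvd f" if "poly (map_poly of_rat f) x = 0" for f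
  proof -
    have "map_poly of_rat f = map_poly of_rat (f div m) * map_poly of_rat m + (map_poly of_rat (f mod m) :: complex poly)"
      unfolding map_poly_of_rat_mult[symmetric] map_poly_of_rat_add[symmetric] by simp
    then have "poly (map_poly of_rat (f mod m)) x = 0"
      using m(2) that by simp
    moreover have "f mod m = 0 \<or> degree (f mod m) < degree m"
      using degree_mod_less[OF m(1), of f] .
    ultimately show ?thesis
      using least by (auto simp: mod_eq_0_iff_dvd)
  qed
  have nonunit: "degree f \<noteq> 0" if "f \<noteq> 0" "poly (map_poly of_rat f) x = 0" for f :: "rat poly"
  proof
    assume "degree f = 0"
    then obtain c where "f = [:c:]"
      using degree_eq_zeroE by blast
    then show False
      using that by (simp add: map_poly_pCons)
  qed
  have "irreducible m"
  proof (rule Factorial_Ring.irreducibleI)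
    show "\<not> m dvd 1"
      using nonunit[OF m(1,2)] is_unit_iff_degree[OF m(1)] by simp
  next
    fix a b assume ab: "m = a * b"
    then have nz: "a \<noteq> 0" "b \<noteq> 0"
      using m(1) by auto
    have deg: "degree m = degree a + degree b"
      using nz ab by (simp add: degree_mult_eq)
    have "poly (map_poly of_rat a) x = 0 \<or> poly (map_poly of_rat b) x = 0"
      using m(2) unfolding ab map_poly_of_rat_mult by simp
    then have "degree a = 0 \<or> degree b = 0"
      using least[of a] least[of b] nz deg by (metis add_cancel_right_left add_cancel_right_right le_add1 le_add2 order_le_less)
    then show "a dvd 1 \<or> b dvd 1"
      using is_unit_iff_degree[OF nz(1)] is_unit_iff_degree[OF nz(2)] by simp
  qed (rule m(1))
  then show ?thesis
    using m(2) dvd by (intro exI[of _ m] conjI allI impI)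
qed

lemma finite_conjugates:
  assumes "x \<in> Qbar"
  shows "\<exists>C. finite C \<and> C \<subseteq> Qbar \<and> (\<forall>\<rho>\<in>carrier GQ. \<rho> x \<in> C)"
proof -
  obtain p where p: "\<And>i. coeff p i \<in> \<int>" "p \<noteq> 0" "poly p x = 0"
    using Qbar_int_poly[OF assms] by blast
  have "finite {y. poly p y = 0}"
    using p(2) by (rule poly_roots_finite)
  moreover have "{y. poly p y = 0} \<subseteq> Qbar"
    using p by (auto simp: Qbar_def intro: algebraicI)
  moreover have "poly p (\<rho> x) = 0" if "\<rho> \<in> carrier GQ" for \<rho>
    using Qb.Gal_rat_poly[OF that, of p x] p Ints_subset_Rats assms that by (auto simp: Qb.Gal_hom)
  ultimately show ?thesis
    by blast
qed

subsection \<open>Extension and restriction of automorphisms\<close>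

text \<open>An irreducible p is associated to the minimal polynomial of x, hence of least degree
  over the identity on the rationals. Sending x to y is therefore an admissible one-step extension,
  which then extends to \<open>Qbar\<close>.\<close>

lemma ex_conjugating:
  assumes p: "irreducible p" and roots: "poly (map_poly of_rat p) x = 0" "poly (map_poly of_rat p) y = 0"
  shows "\<exists>\<rho>\<in>carrier GQ. \<rho> x = (y :: complex)"
proof -
  let ?R = "Id_on \<rat> :: (complex \<times> complex) set"
  let ?p = "map_poly of_rat p :: complex poly"
  have p0: "p \<noteq> 0"
    using p by auto
  have rat: "coeff ?p i \<in> \<rat>" for i
    by (simp add: coeff_map_poly)
  have R: "pair_ring ?R" "?R \<subseteq> Qbar \<times> Qbar"
    using subfield_Rats[OF subfield_Qbar] by (auto simp: pair_ring_def)
  have x: "x \<in> Qbar"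
    using algebraicI'[of ?p x, OF rat] roots(1) p0 by (simp add: Qbar_def map_poly_of_rat_eq_0)
  obtain m :: "rat poly" where m: "irreducible m" "poly (map_poly of_rat m) x = 0"
      "\<And>f. poly (map_poly of_rat f) x = 0 \<Longrightarrow> m dvd f"
    using x ex_min_rat_poly unfolding Qbar_def by blast
  have "minimal_pair ?R ?p ?p x"
    unfolding minimal_pair_def
  proof (intro conjI allI impI)
    show "pair_poly ?R ?p ?p"
      using rat by (auto simp: pair_poly_def)
    show "?p \<noteq> 0" "poly ?p x = 0"
      using p0 roots by (auto simp: map_poly_of_rat_eq_0)
  next
    fix f1 f2 assume f: "pair_poly ?R f1 f2" "f1 \<noteq> 0" "poly f1 x = 0"
    then have "\<forall>i. coeff f1 i \<in> \<rat>"
      by (auto simp: pair_poly_def)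
    then obtain f where f1: "f1 = map_poly of_rat f"
      using ratpolyE by blast
    have "m dvd p"
      using m(3) roots by blast
    then have "p dvd m"
      using p m(1) irreducibleD' irreducible_not_unit by metis
    moreover have "m dvd f"
      using m(3) f f1 by blast
    moreover have "f \<noteq> 0"
      using f f1 by auto
    ultimately have "degree p \<le> degree f"
      using dvd_imp_degree_le dvd_trans by metis
    then show "degree ?p \<le> degree f1"
      by (simp add: f1 degree_map_poly_of_rat)
  qed
  from adjoin_minimal_pair[OF R x this roots(2)] have
    "pair_ring (adjoin ?R x y)" "adjoin ?R x y \<subseteq> Qbar \<times> Qbar"
    by auto
  from extend_to_Qbar[OF this] show ?thesis
    using mem_adjoin[OF R(1)] by blast
qed

locale galois_field =
  fixes F :: "complex set"
  assumes gal: "galois_extension F"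

sublocale galois_field \<subseteq> number_field F
  using gal by (intro number_field.intro) (simp add: galois_extension_def)

context galois_field
begin

lemma sub_Qbar: "F \<subseteq> Qbar"
  using gal by (simp add: galois_extension_def)

text \<open>Normality acts here: \<open>\<rho> x\<close> is another root of the irreducible rational
  polynomial of x.\<close>

lemma conj_closed:
  assumes "\<rho> \<in> carrier GQ" "x \<in> F"
  shows "\<rho> x \<in> F"
proof -
  have "x \<in> Qbar"
    using assms sub_Qbar by blast
  then obtain m :: "rat poly" where m: "irreducible m" "poly (map_poly of_rat m) x = 0"
    using ex_min_rat_poly unfolding Qbar_def by blast
  have "poly (map_poly of_rat m) (\<rho> x) = 0"
    using Qb.Gal_rat_poly[OF assms(1), of "map_poly of_rat m" x] m(2) \<open>x \<in> Qbar\<close>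
    by (simp add: coeff_map_poly Qb.Gal_hom[OF assms(1)])
  then show ?thesis
    using gal m assms(2) unfolding galois_extension_def by blast
qed

lemma restrict_Gal:
  assumes \<rho>: "\<rho> \<in> carrier GQ"
  shows "restrict \<rho> F \<in> Aut F"
proof -
  have "inj_on \<rho> F"
    using Qb.Gal_hom(8)[OF \<rho>] sub_Qbar by (auto simp: inj_on_def)
  moreover have "y \<in> \<rho> ` F" if "y \<in> F" for y
    using conj_closed[OF Qb.G.inv_closed[OF \<rho>] that] Qb.Gal_inv_apply(2)[OF \<rho>, of y] sub_Qbar that
    by (metis imageI subsetD)
  ultimately have "bij_betw \<rho> F F"
    using conj_closed[OF \<rho>] by (auto simp: bij_betw_def)
  then have "bij_betw (restrict \<rho> F) F F"
    by (simp cong: bij_betw_cong)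
  then show ?thesis
    unfolding Gal_iff[OF sf] by (simp add: Qb.Gal_hom[OF \<rho>] sf_simps subsetD[OF sub_Qbar])
qed

lemma restrict_mult:
  assumes "\<rho> \<in> carrier GQ" "\<rho>' \<in> carrier GQ"
  shows "restrict (\<rho> \<otimes>\<^bsub>GQ\<^esub> \<rho>') F = restrict \<rho> F \<otimes>\<^bsub>Gal F\<^esub> restrict \<rho>' F"
  using assms sub_Qbar
  by (intro Gal_eqI restrict_Gal G.m_closed Qb.G.m_closed)
    (auto simp: Gal_mult_apply restrict_Gal conj_closed)

lemma restrict_inv:
  assumes "\<rho> \<in> carrier GQ"
  shows "restrict (inv\<^bsub>GQ\<^esub> \<rho>) F = inv\<^bsub>Gal F\<^esub> (restrict \<rho> F)"
proof -
  have "restrict (inv\<^bsub>GQ\<^esub> \<rho>) F \<otimes>\<^bsub>Gal F\<^esub> restrict \<rho> F = \<one>\<^bsub>Gal F\<^esub>"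
    using assms sub_Qbar
    by (intro Gal_eqI G.m_closed restrict_Gal Qb.G.inv_closed G.one_closed)
      (auto simp: Gal_mult_apply restrict_Gal Gal_one_apply conj_closed Qb.Gal_inv_apply)
  then show ?thesis
    using assms by (simp add: G.inv_equality restrict_Gal)
qed

text \<open>S consists of the coefficients of a minimal polynomial of \<beta> over F. An
  automorphism of F fixing them maps this polynomial to itself, so \<beta> may be sent to \<beta>.
  In topological terms, the restrictions of the stabiliser of \<beta> contain a neighbourhood of the
  identity; the continuity of the section rests on this.\<close>

lemma ex_extension_fixing:
  assumes \<beta>: "\<beta> \<in> Qbar"
  shows "\<exists>S. finite S \<and> S \<subseteq> F \<and> (\<forall>\<sigma>\<in>Aut F. (\<forall>s\<in>S. \<sigma> s = s) \<longrightarrow>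
    (\<exists>\<rho>\<in>carrier GQ. restrict \<rho> F = \<sigma> \<and> \<rho> \<beta> = \<beta>))"
proof -
  have Id: "pair_ring (Id_on F)"
    using sf_simps by (auto simp: pair_ring_def)
  obtain g g2 where g: "minimal_pair (Id_on F) g g2 \<beta>"
    using ex_minimal_pair[OF Id \<beta>] by blast
  then have g': "pair_poly (Id_on F) g g2" "g \<noteq> 0" "poly g \<beta> = 0"
    and min: "\<And>f1 f2. pair_poly (Id_on F) f1 f2 \<Longrightarrow> f1 \<noteq> 0 \<Longrightarrow> poly f1 \<beta> = 0 \<Longrightarrow> degree g \<le> degree f1"
    unfolding minimal_pair_def by blast+
  have gF: "coeff g i \<in> F" for i
    using g'(1) by (auto simp: pair_poly_def)
  have "\<exists>\<rho>\<in>carrier GQ. restrict \<rho> F = \<sigma> \<and> \<rho> \<beta> = \<beta>"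
    if \<sigma>: "\<sigma> \<in> Aut F" and fix_S: "\<forall>s\<in>range (coeff g). \<sigma> s = s" for \<sigma>
  proof -
    let ?R = "{(x, \<sigma> x) | x. x \<in> F}"
    have R: "pair_ring ?R" "?R \<subseteq> Qbar \<times> Qbar"
      using pair_ring_graph[OF \<sigma>] sub_Qbar Gal_hom(7)[OF \<sigma>] by auto
    have "minimal_pair ?R g g \<beta>"
      unfolding minimal_pair_def
    proof (intro conjI allI impI)
      show "pair_poly ?R g g"
        using gF fix_S by (auto simp: pair_poly_def)
      show "g \<noteq> 0" "poly g \<beta> = 0"
        using g' by blast+
      fix f1 f2 assume f: "pair_poly ?R f1 f2" "f1 \<noteq> 0" "poly f1 \<beta> = 0"
      then have "pair_poly (Id_on F) f1 f1"
        by (auto simp: pair_poly_def)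
      then show "degree g \<le> degree f1"
        using min f by blast
    qed
    moreover note g'(3)
    ultimately have "pair_ring (adjoin ?R \<beta> \<beta>)" "adjoin ?R \<beta> \<beta> \<subseteq> Qbar \<times> Qbar"
      by (rule adjoin_minimal_pair[OF R \<beta>])+
    from extend_to_Qbar[OF this] obtain \<rho> where
      \<rho>: "\<rho> \<in> carrier GQ" "\<And>x y. (x, y) \<in> adjoin ?R \<beta> \<beta> \<Longrightarrow> \<rho> x = y"
      by blast
    have "\<rho> x = \<sigma> x" if "x \<in> F" for x
      using \<rho>(2) subset_adjoin[OF R(1), of \<beta> \<beta>] that by blast
    then have "restrict \<rho> F = \<sigma>"
      using \<sigma> \<rho>(1) by (intro Gal_eqI restrict_Gal) auto
    then show ?thesis
      using \<rho> mem_adjoin[OF R(1), of \<beta> \<beta>] by blast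
  qed
  moreover have "finite (range (coeff g))"
    by (rule finite_subset[of _ "insert 0 (set (coeffs g))"]) (auto simp: range_coeff)
  ultimately show ?thesis
    using gF by (intro exI[of _ "range (coeff g)"]) auto
qed

lemma ex_extension:
  assumes \<sigma>: "\<sigma> \<in> Aut F"
  shows "\<exists>\<rho>\<in>carrier GQ. restrict \<rho> F = \<sigma>"
proof -
  have "{(x, \<sigma> x) | x. x \<in> F} \<subseteq> Qbar \<times> Qbar"
    using sub_Qbar Gal_hom(7)[OF \<sigma>] by auto
  from extend_to_Qbar[OF pair_ring_graph[OF \<sigma>] this]
  obtain \<rho> where \<rho>: "\<rho> \<in> carrier GQ" "\<And>x. x \<in> F \<Longrightarrow> \<rho> x = \<sigma> x"
    by auto
  then have "restrict \<rho> F = \<sigma>"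
    using \<sigma> \<rho>(1) by (intro Gal_eqI restrict_Gal) auto
  then show ?thesis
    using \<rho> by blast
qed

end

subsection \<open>Separating elements\<close>

text \<open>The primitive element argument, phrased for automorphisms: \<open>\<beta> + t b\<close>
  retains the information of both \<beta> and b for all but finitely many t.\<close>

lemma ex_separating:
  assumes "finite B" "B \<subseteq> Qbar"
  shows "\<exists>\<beta>\<in>Qbar. \<forall>g\<in>carrier GQ. \<forall>h\<in>carrier GQ. g \<beta> = h \<beta> \<longrightarrow> (\<forall>b\<in>B. g b = h b)"
  using assms
proof (induction B rule: finite_induct)
  case empty
  then show ?case
    using Qb.sf_simps(1) by (intro bexI[of _ 0]) simp_all
next
  case (insert b B)
  from insert.prems have "B \<subseteq> Qbar"
    by simp
  from insert.IH[OF this] obtain \<beta> where \<beta>: "\<beta> \<in> Qbar"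
    "\<And>g h. g \<in> carrier GQ \<Longrightarrow> h \<in> carrier GQ \<Longrightarrow> g \<beta> = h \<beta> \<Longrightarrow> \<forall>b\<in>B. g b = h b"
    by blast
  have b: "b \<in> Qbar"
    using insert by auto
  obtain C D where C: "finite C" "\<forall>\<rho>\<in>carrier GQ. \<rho> \<beta> \<in> C" and D: "finite D" "\<forall>\<rho>\<in>carrier GQ. \<rho> b \<in> D"
    using finite_conjugates[OF \<beta>(1)] finite_conjugates[OF b] by blast
  \<comment> \<open>The values t for which conjugates of \<open>\<beta> + t b\<close> coincide
    although the images of b differ. Pairs with u = v contribute only 0, the value of division by
    zero.\<close>
  define bad where "bad = (\<lambda>(x, y, u, v). (x - y) / (v - u)) ` (C \<times> C \<times> D \<times> D)"
  have "finite bad"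
    using C D by (simp add: bad_def)
  then have "\<not> range of_nat \<subseteq> bad"
    using infinite_UNIV_nat finite_imageD[OF _ inj_of_nat] finite_subset by metis
  then obtain t :: nat where t: "of_nat t \<notin> bad"
    by blast
  define \<gamma> where "\<gamma> = \<beta> + of_nat t * b"
  have tQ: "of_nat t \<in> Qbar"
    using Qb.sf_simps(9)[of "int t"] by simp
  have \<gamma>: "\<gamma> \<in> Qbar"
    unfolding \<gamma>_def by (intro Qb.sf_simps \<beta>(1) b tQ)
  have "\<forall>b'\<in>insert b B. g b' = h b'" if gh: "g \<in> carrier GQ" "h \<in> carrier GQ" "g \<gamma> = h \<gamma>" for g h
  proof -
    have eq: "g \<beta> + of_nat t * g b = h \<beta> + of_nat t * h b"
      using gh \<beta>(1) b tQ by (simp add: \<gamma>_def Qb.Gal_hom Qb.sf_simps)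
    have "g b = h b"
    proof (rule ccontr)
      assume "g b \<noteq> h b"
      then have "of_nat t = (g \<beta> - h \<beta>) / (h b - g b)"
        using eq by (simp add: field_simps)
      then have "of_nat t \<in> bad"
        unfolding bad_def using C(2) D(2) gh by (intro image_eqI[of _ _ "(g \<beta>, h \<beta>, g b, h b)"]) auto
      then show False
        using t by blast
    qed
    then show ?thesis
      using eq \<beta>(2)[OF gh(1,2)] by auto
  qed
  then show ?case
    using \<gamma> by blast
qed

section \<open>The Krull topology\<close>

abbreviation locally_constant :: "'a topology \<Rightarrow> ('a \<Rightarrow> 'b) \<Rightarrow> bool" where
  "locally_constant Y f \<equiv> continuous_map Y (discrete_topology UNIV) f"

lemma locally_constant_iff:
  "locally_constant Y f \<longleftrightarrow>
    (\<forall>x\<in>topspace Y. \<exists>U. openin Y U \<and> x \<in> U \<and> (\<forall>y\<in>U. f y = f x))" (is "_ \<longleftrightarrow> ?R")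
proof
  assume f: "locally_constant Y f"
  show ?R
  proof
    fix x assume "x \<in> topspace Y"
    then have "openin Y {y \<in> topspace Y. f y \<in> {f x}} \<and> x \<in> {y \<in> topspace Y. f y \<in> {f x}} \<and>
        (\<forall>y\<in>{y \<in> topspace Y. f y \<in> {f x}}. f y = f x)"
      using openin_continuous_map_preimage[OF f, of "{f x}"] by simp
    then show "\<exists>U. openin Y U \<and> x \<in> U \<and> (\<forall>y\<in>U. f y = f x)"
      by blast
  qed
next
  assume R: ?R
  have "openin Y {x \<in> topspace Y. f x \<in> A}" for A
  proof (subst openin_subopen, safe)
    fix x assume x: "x \<in> topspace Y" "f x \<in> A"
    from R[rule_format, OF x(1)] obtain U where U: "openin Y U" "x \<in> U" "\<forall>y\<in>U. f y = f x"
      by (elim exE conjE)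
    have "U \<subseteq> {x \<in> topspace Y. f x \<in> A}"
    proof
      fix y assume y: "y \<in> U"
      then have "f y = f x"
        using U(3) by blast
      then show "y \<in> {x \<in> topspace Y. f x \<in> A}"
        using x(2) y openin_subset[OF U(1)] by auto
    qed
    with U(1,2) show "\<exists>T. openin Y T \<and> x \<in> T \<and> T \<subseteq> {x \<in> topspace Y. f x \<in> A}"
      by (intro exI[of _ U] conjI)
  qed
  then show "locally_constant Y f"
    by (simp add: continuous_map_def)
qed

text \<open>On the intersection of two neighbourhoods both f and g are constant, and h is determined
  by them. Finitely many locally constant data are merged in this way.\<close>

lemma locally_constant_combine:
  assumes "locally_constant Y f" "locally_constant Y g"
    and "\<And>x y. x \<in> topspace Y \<Longrightarrow> y \<in> topspace Y \<Longrightarrow> f x = f y \<Longrightarrow> g x = g y \<Longrightarrow> h x = h y"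
  shows "locally_constant Y h"
  unfolding locally_constant_iff
proof
  fix x assume x: "x \<in> topspace Y"
  obtain U where U: "openin Y U" "x \<in> U" "\<forall>y\<in>U. f y = f x"
    using assms(1)[unfolded locally_constant_iff, rule_format, OF x] by (elim exE conjE)
  obtain V where V: "openin Y V" "x \<in> V" "\<forall>y\<in>V. g y = g x"
    using assms(2)[unfolded locally_constant_iff, rule_format, OF x] by (elim exE conjE)
  have "h y = h x" if "y \<in> U \<inter> V" for y
    using U(3) V(3) that x openin_subset[OF U(1)] by (intro assms(3)) auto
  then show "\<exists>U. openin Y U \<and> x \<in> U \<and> (\<forall>y\<in>U. h y = h x)"
    using U(1,2) V(1,2) by (intro exI[of _ "U \<inter> V"] conjI openin_Int ballI IntI)
qed

context number_field
begin

lemma Gal_subset_PiE: "Aut F \<subseteq> (\<Pi>\<^sub>E x\<in>F. F)"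
  using Gal_hom(7,11) by (auto simp: PiE_def Pi_def)

lemma topspace_krull [simp]: "topspace (krull F) = Aut F"
  using Gal_subset_PiE by (auto simp: krull_def)

text \<open>Basic open sets of the product topology constrain finitely many coordinates; with
  discrete factors this amounts to prescribing finitely many values.\<close>

lemma openin_krull_iff:
  "openin (krull F) U \<longleftrightarrow> U \<subseteq> Aut F \<and> (\<forall>\<sigma>\<in>U. \<exists>S. finite S \<and> S \<subseteq> F \<and>
     (\<forall>\<tau>\<in>Aut F. (\<forall>s\<in>S. \<tau> s = \<sigma> s) \<longrightarrow> \<tau> \<in> U))" (is "_ \<longleftrightarrow> ?R")
proof
  assume U: "openin (krull F) U"
  then obtain V where V: "openin (product_topology (\<lambda>_. discrete_topology F) F) V" "U = V \<inter> Aut F"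
    by (auto simp: krull_def openin_subtopology)
  show ?R
  proof (intro conjI ballI)
    show "U \<subseteq> Aut F"
      using V by blast
  next
    fix \<sigma> assume \<sigma>: "\<sigma> \<in> U"
    then obtain W where W: "finite {i \<in> F. W i \<noteq> F}" "\<sigma> \<in> Pi\<^sub>E F W" "Pi\<^sub>E F W \<subseteq> V"
      using V unfolding openin_product_topology_alt by fastforce
    have "\<tau> \<in> U" if \<tau>: "\<tau> \<in> Aut F" "\<forall>s\<in>{i \<in> F. W i \<noteq> F}. \<tau> s = \<sigma> s" for \<tau>
    proof -
      have "\<tau> x \<in> W x" if "x \<in> F" for x
      proof (cases "W x = F")
        case True
        then show ?thesis
          using Gal_hom(7)[OF \<tau>(1) that] by simp
      next
        case False
        then have "\<tau> x = \<sigma> x"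
          using \<tau>(2) that by blast
        then show ?thesis
          using W(2) that by (auto simp: PiE_def)
      qed
      then have "\<tau> \<in> Pi\<^sub>E F W"
        using Gal_hom(11)[OF \<tau>(1)] by (auto simp: PiE_def)
      then show ?thesis
        using W(3) V(2) \<tau>(1) by blast
    qed
    then show "\<exists>S. finite S \<and> S \<subseteq> F \<and> (\<forall>\<tau>\<in>Aut F. (\<forall>s\<in>S. \<tau> s = \<sigma> s) \<longrightarrow> \<tau> \<in> U)"
      using W(1) by (intro exI[of _ "{i \<in> F. W i \<noteq> F}"]) auto
  qed
next
  assume R: ?R
  show "openin (krull F) U"
  proof (subst openin_subopen, safe)
    fix \<sigma> assume \<sigma>: "\<sigma> \<in> U"
    then obtain S where S: "finite S" "S \<subseteq> F"
      "\<And>\<tau>. \<tau> \<in> Aut F \<Longrightarrow> \<forall>s\<in>S. \<tau> s = \<sigma> s \<Longrightarrow> \<tau> \<in> U"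
      using R by meson
    define W where "W = (\<Pi>\<^sub>E x\<in>F. if x \<in> S then {\<sigma> x} else F)"
    have \<sigma>': "\<sigma> \<in> Aut F"
      using R \<sigma> by blast
    have "openin (product_topology (\<lambda>_. discrete_topology F) F) W"
      unfolding W_def
      by (rule openin_PiE_gen[THEN iffD2])
        (use S(1) Gal_hom(7)[OF \<sigma>'] in \<open>auto intro: rev_finite_subset[OF S(1)]\<close>)
    then have "openin (krull F) (W \<inter> Aut F)"
      by (auto simp: krull_def openin_subtopology)
    moreover have "\<sigma> \<in> W"
      using Gal_hom(7,11)[OF \<sigma>'] by (auto simp: W_def PiE_def)
    moreover have "W \<inter> Aut F \<subseteq> U"
    proof
      fix \<tau> assume \<tau>: "\<tau> \<in> W \<inter> Aut F"
      then have "\<forall>s\<in>S. \<tau> s = \<sigma> s"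
        using S(2) by (force simp: W_def PiE_def Pi_def)
      then show "\<tau> \<in> U"
        using S(3) \<tau> by blast
    qed
    ultimately show "\<exists>T. openin (krull F) T \<and> \<sigma> \<in> T \<and> T \<subseteq> U"
      using \<sigma>' by blast
  qed
qed

lemma locally_constant_krull:
  "locally_constant (krull F) f \<longleftrightarrow>
    (\<forall>\<sigma>\<in>Aut F. \<exists>S. finite S \<and> S \<subseteq> F \<and>
      (\<forall>\<tau>\<in>Aut F. (\<forall>s\<in>S. \<tau> s = \<sigma> s) \<longrightarrow> f \<tau> = f \<sigma>))" (is "?L \<longleftrightarrow> ?R")
proof
  assume f: ?L
  show ?R
  proof
    fix \<sigma> assume \<sigma>: "\<sigma> \<in> Aut F"
    then obtain U where U: "openin (krull F) U" "\<sigma> \<in> U" "\<forall>y\<in>U. f y = f \<sigma>"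
      using f unfolding locally_constant_iff by auto
    then show "\<exists>S. finite S \<and> S \<subseteq> F \<and> (\<forall>\<tau>\<in>Aut F. (\<forall>s\<in>S. \<tau> s = \<sigma> s) \<longrightarrow> f \<tau> = f \<sigma>)"
      unfolding openin_krull_iff by meson
  qed
next
  assume R: ?R
  show ?L
    unfolding locally_constant_iff topspace_krull
  proof
    fix \<sigma> assume \<sigma>: "\<sigma> \<in> Aut F"
    have "openin (krull F) {\<tau> \<in> Aut F. f \<tau> = f \<sigma>}"
      unfolding openin_krull_iff
    proof (intro conjI ballI)
      fix \<tau> assume \<tau>: "\<tau> \<in> {\<tau> \<in> Aut F. f \<tau> = f \<sigma>}"
      then have \<tau>': "\<tau> \<in> Aut F" "f \<tau> = f \<sigma>"
        by auto
      from R[rule_format, OF \<tau>'(1)] obtain S where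
        "finite S" "S \<subseteq> F" "\<forall>\<eta>\<in>Aut F. (\<forall>s\<in>S. \<eta> s = \<tau> s) \<longrightarrow> f \<eta> = f \<tau>"
        by (elim exE conjE)
      then show "\<exists>S. finite S \<and> S \<subseteq> F \<and> (\<forall>\<eta>\<in>Aut F. (\<forall>s\<in>S. \<eta> s = \<tau> s) \<longrightarrow>
          \<eta> \<in> {\<tau> \<in> Aut F. f \<tau> = f \<sigma>})"
        using \<tau>' by (intro exI[of _ S]) auto
    qed auto
    then show "\<exists>U. openin (krull F) U \<and> \<sigma> \<in> U \<and> (\<forall>y\<in>U. f y = f \<sigma>)"
      using \<sigma> by (intro exI[of _ "{\<tau> \<in> Aut F. f \<tau> = f \<sigma>}"]) auto
  qed
qed

lemma locally_constant_eval:
  assumes "x \<in> F"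
  shows "locally_constant (krull F) (\<lambda>\<sigma>. \<sigma> x)"
  unfolding locally_constant_krull using assms by (intro ballI exI[of _ "{x}"]) auto

lemma continuous_map_into_krull:
  assumes "\<And>z. z \<in> topspace Y \<Longrightarrow> f z \<in> Aut F"
    and "\<And>x. x \<in> F \<Longrightarrow> locally_constant Y (\<lambda>z. f z x)"
  shows "continuous_map Y (krull F) f"
proof -
  have "continuous_map Y (discrete_topology F) (\<lambda>z. f z x)" if "x \<in> F" for x
    using assms(2)[OF that] assms(1) Gal_hom(7)[OF _ that]
    unfolding continuous_map_def by (auto simp: Pi_def)
  moreover have "f ` topspace Y \<subseteq> extensional F"
    using assms(1) Gal_hom(11) by blast
  ultimately show ?thesis
    unfolding krull_def continuous_map_in_subtopology continuous_map_componentwise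
    using assms(1) by auto
qed

lemma continuous_map_Gal_mult:
  "continuous_map (prod_topology (krull F) (krull F)) (krull F) (\<lambda>(\<sigma>, \<tau>). \<sigma> \<otimes>\<^bsub>Gal F\<^esub> \<tau>)"
proof (rule continuous_map_into_krull)
  fix x assume x: "x \<in> F"
  show "locally_constant (prod_topology (krull F) (krull F))
     (\<lambda>z. (case z of (\<sigma>, \<tau>) \<Rightarrow> \<sigma> \<otimes>\<^bsub>Gal F\<^esub> \<tau>) x)"
    unfolding locally_constant_iff
  proof (safe, goal_cases)
    case (1 \<sigma> \<tau>)
    then have st: "\<sigma> \<in> Aut F" "\<tau> \<in> Aut F"
      by auto
    have "openin (krull F) {\<eta> \<in> topspace (krull F). \<eta> y \<in> {c}}" if "y \<in> F" for y c
      using locally_constant_eval[OF that] by (rule openin_continuous_map_preimage) simp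
    note op = this[simplified]
    \<comment> \<open>To freeze \<open>\<sigma> (\<tau> x)\<close> it suffices to freeze \<tau> at x
      and \<sigma> at the point \<open>\<tau> x\<close>.\<close>
    let ?U = "{\<eta> \<in> Aut F. \<eta> (\<tau> x) = \<sigma> (\<tau> x)} \<times> {\<eta> \<in> Aut F. \<eta> x = \<tau> x}"
    have "openin (prod_topology (krull F) (krull F)) ?U"
      unfolding openin_prod_Times_iff using op x Gal_hom(7)[OF st(2) x] by blast
    then show ?case
      using st x by (intro exI[of _ ?U]) (auto simp: Gal_mult_apply)
  qed
qed auto

abbreviation fixing where
  "fixing K \<equiv> {\<sigma> \<in> Aut F. \<forall>x\<in>K. \<sigma> x = x}"

lemma closedin_fixing:
  assumes "K \<subseteq> F"
  shows "closedin (krull F) (fixing K)"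
proof -
  have "closedin (krull F) {\<sigma> \<in> topspace (krull F). \<sigma> x \<in> {x}}" if "x \<in> F" for x
    using locally_constant_eval[OF that] by (rule closedin_continuous_map_preimage) simp
  then have "closedin (krull F) (Aut F \<inter> (\<Inter>x\<in>K. {\<sigma> \<in> Aut F. \<sigma> x = x}))" if "K \<noteq> {}"
    using that assms closedin_topspace[of "krull F"] by (intro closedin_Int closedin_Inter) auto
  moreover have "Aut F \<inter> (\<Inter>x\<in>K. {\<sigma> \<in> Aut F. \<sigma> x = x}) =
      (fixing K)"
    by auto
  ultimately show ?thesis
    using closedin_topspace[of "krull F"] by (cases "K = {}") auto
qed

lemma subgroup_fixing:
  assumes "K \<subseteq> F"
  shows "subgroup (fixing K) (Gal F)"
proof (rule G.subgroupI)
  show "fixing K \<noteq> {}"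
    using assms G.one_closed Gal_one_apply by blast
next
  fix \<sigma> assume \<sigma>: "\<sigma> \<in> fixing K"
  then have "(inv\<^bsub>Gal F\<^esub> \<sigma>) x = x" if "x \<in> K" for x
    using that Gal_inv_apply(1)[of \<sigma> x] assms by auto
  then show "inv\<^bsub>Gal F\<^esub> \<sigma> \<in> fixing K"
    using \<sigma> by simp
qed (use assms in \<open>auto simp: Gal_mult_apply subset_iff\<close>)

lemma commutator_closed:
  "\<sigma> \<in> Aut F \<Longrightarrow> \<tau> \<in> Aut F \<Longrightarrow> commutator (Gal F) \<sigma> \<tau> \<in> Aut F"
  by (simp add: commutator_def)

lemma commutator_apply:
  "\<sigma> \<in> Aut F \<Longrightarrow> \<tau> \<in> Aut F \<Longrightarrow> x \<in> F \<Longrightarrow>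
    commutator (Gal F) \<sigma> \<tau> x = \<sigma> (\<tau> ((inv\<^bsub>Gal F\<^esub> \<sigma>) ((inv\<^bsub>Gal F\<^esub> \<tau>) x)))"
  by (simp add: commutator_def Gal_mult_apply Gal_hom(7))

text \<open>Evaluating at \<open>\<tau> (\<sigma> x)\<close> cancels the inverses, so that the
  commutator compares the two orders of composition directly.\<close>

lemma commutator_apply_swap:
  assumes "\<sigma> \<in> Aut F" "\<tau> \<in> Aut F" "x \<in> F"
  shows "commutator (Gal F) \<sigma> \<tau> (\<tau> (\<sigma> x)) = \<sigma> (\<tau> x)"
  using assms by (simp add: commutator_apply Gal_hom(7) Gal_inv_apply)

end

section \<open>Topologically generated subgroups\<close>

locale topological_group = group G for G :: "('a, 'b) monoid_scheme" (structure) and T :: "'a topology" +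
  assumes topspace_T: "topspace T = carrier G"
    and continuous_mult: "continuous_map (prod_topology T T) T (\<lambda>(\<sigma>, \<tau>). \<sigma> \<otimes> \<tau>)"
begin

lemma top_generate:
  assumes "S \<subseteq> carrier G"
  shows "S \<subseteq> top_generate G T S" "subgroup (top_generate G T S) G" "closedin T (top_generate G T S)"
proof -
  show "S \<subseteq> top_generate G T S"
    unfolding top_generate_def by (rule hull_subset)
  let ?A = "{t. (subgroup t G \<and> closedin T t) \<and> S \<subseteq> t}"
  have "carrier G \<in> ?A"
    using assms subgroup_self closedin_topspace[of T] by (simp add: topspace_T)
  then have "?A \<noteq> {}"
    by blast
  then show "subgroup (top_generate G T S) G" "closedin T (top_generate G T S)"
    unfolding top_generate_def hull_def by (auto intro!: subgroups_Inter closedin_Inter)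
qed

lemma top_generate_minimal:
  "S \<subseteq> H \<Longrightarrow> subgroup H G \<Longrightarrow> closedin T H \<Longrightarrow> top_generate G T S \<subseteq> H"
  unfolding top_generate_def by (rule hull_minimal) auto

lemma continuous_conj:
  assumes "g \<in> carrier G"
  shows "continuous_map T T (\<lambda>h. g \<otimes> h \<otimes> inv g)"
proof -
  have "continuous_map T T (\<lambda>h. (\<lambda>(\<sigma>, \<tau>). \<sigma> \<otimes> \<tau>) (g, h))"
    using assms topspace_T
    by (intro continuous_map_compose[OF _ continuous_mult, unfolded comp_def] continuous_map_pairedI) auto
  then have "continuous_map T T (\<lambda>h. (\<lambda>(\<sigma>, \<tau>). \<sigma> \<otimes> \<tau>) (g \<otimes> h, inv g))"
    using assms topspace_T
    by (intro continuous_map_compose[OF _ continuous_mult, unfolded comp_def] continuous_map_pairedI) auto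
  then show ?thesis
    by simp
qed

lemma conj_mult:
  assumes "g \<in> carrier G" "a \<in> carrier G" "b \<in> carrier G"
  shows "g \<otimes> (a \<otimes> b) \<otimes> inv g = (g \<otimes> a \<otimes> inv g) \<otimes> (g \<otimes> b \<otimes> inv g)"
proof -
  have "inv g \<otimes> (g \<otimes> (b \<otimes> inv g)) = b \<otimes> inv g"
    using assms by (simp add: m_assoc[symmetric])
  then show ?thesis
    using assms by (simp add: m_assoc)
qed

text \<open>For fixed g, the elements whose conjugate by g lies in the generated subgroup form a
  closed subgroup, as conjugation is continuous. It contains S, hence all that S generates.\<close>

lemma top_generate_normal:
  assumes S: "S \<subseteq> carrier G" and conj: "\<And>g s. g \<in> carrier G \<Longrightarrow> s \<in> S \<Longrightarrow> g \<otimes> s \<otimes> inv g \<in> S"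
  shows "top_generate G T S \<lhd> G"
  unfolding normal_inv_iff
proof (intro conjI ballI)
  let ?N = "top_generate G T S"
  show N: "subgroup ?N G"
    by (rule top_generate[OF S])
  fix g h assume g: "g \<in> carrier G" and h: "h \<in> ?N"
  let ?H = "{h \<in> topspace T. g \<otimes> h \<otimes> inv g \<in> ?N}"
  have "?N \<subseteq> ?H"
  proof (rule top_generate_minimal)
    show "S \<subseteq> ?H"
      using S conj[OF g] top_generate(1)[OF S] topspace_T by blast
    show "closedin T ?H"
      by (rule closedin_continuous_map_preimage[OF continuous_conj[OF g] top_generate(3)[OF S]])
    show "subgroup ?H G"
    proof (rule subgroupI)
      show "?H \<noteq> {}"
        using subgroup.one_closed[OF N] g topspace_T by (auto intro!: exI[of _ \<one>])
    next
      fix a assume a: "a \<in> ?H"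
      then have "inv (g \<otimes> a \<otimes> inv g) \<in> ?N"
        using subgroup.m_inv_closed[OF N] by blast
      then show "inv a \<in> ?H"
        using a g topspace_T by (auto simp: inv_mult_group m_assoc)
    next
      fix a b assume ab: "a \<in> ?H" "b \<in> ?H"
      then have "(g \<otimes> a \<otimes> inv g) \<otimes> (g \<otimes> b \<otimes> inv g) \<in> ?N"
        using subgroup.m_closed[OF N] by blast
      moreover have "(g \<otimes> a \<otimes> inv g) \<otimes> (g \<otimes> b \<otimes> inv g) = g \<otimes> (a \<otimes> b) \<otimes> inv g"
        using ab g topspace_T by (simp add: conj_mult)
      ultimately show "a \<otimes> b \<in> ?H"
        using ab topspace_T by simp
    qed (auto simp: topspace_T)
  qed
  then show "g \<otimes> h \<otimes> inv g \<in> ?N"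
    using h by blast
qed

lemma conj_inv:
  assumes "g \<in> carrier G" "a \<in> carrier G"
  shows "g \<otimes> inv a \<otimes> inv g = inv (g \<otimes> a \<otimes> inv g)"
  using assms by (simp add: inv_mult_group m_assoc)

lemma conj_commutator:
  assumes "g \<in> carrier G" "a \<in> carrier G" "b \<in> carrier G"
  shows "g \<otimes> commutator G a b \<otimes> inv g = commutator G (g \<otimes> a \<otimes> inv g) (g \<otimes> b \<otimes> inv g)"
proof -
  have "g \<otimes> (a \<otimes> b \<otimes> inv a \<otimes> inv b) \<otimes> inv g = (g \<otimes> (a \<otimes> b \<otimes> inv a) \<otimes> inv g) \<otimes> (g \<otimes> inv b \<otimes> inv g)"
    "g \<otimes> (a \<otimes> b \<otimes> inv a) \<otimes> inv g = (g \<otimes> (a \<otimes> b) \<otimes> inv g) \<otimes> (g \<otimes> inv a \<otimes> inv g)"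
    "g \<otimes> (a \<otimes> b) \<otimes> inv g = (g \<otimes> a \<otimes> inv g) \<otimes> (g \<otimes> b \<otimes> inv g)"
    using assms by (simp_all only: conj_mult[OF assms(1)] m_closed inv_closed)
  then show ?thesis
    unfolding commutator_def conj_inv[OF assms(1,2), symmetric] conj_inv[OF assms(1,3), symmetric] by simp
qed

abbreviation eps_gens where
  "eps_gens \<equiv> {commutator G \<sigma> \<tau> [^] (2::nat) | \<sigma> \<tau>. \<sigma> \<in> carrier G \<and> \<tau> \<in> carrier G} \<union>
      {commutator G \<sigma> (commutator G \<tau> \<eta>) | \<sigma> \<tau> \<eta>. \<sigma> \<in> carrier G \<and> \<tau> \<in> carrier G \<and> \<eta> \<in> carrier G}"

text \<open>Conjugation is a homomorphism, so it maps each kind of generator to a generator of the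
  same kind.\<close>

lemma eps_subgroup_normal: "eps_subgroup G T \<lhd> G"
  unfolding eps_subgroup_def
proof (rule top_generate_normal)
  fix g s assume g: "g \<in> carrier G" and s: "s \<in> eps_gens"
  have cl: "commutator G a b \<in> carrier G" if "a \<in> carrier G" "b \<in> carrier G" for a b
    using that by (simp add: commutator_def)
  have pow: "g \<otimes> a [^] (2::nat) \<otimes> inv g = (g \<otimes> a \<otimes> inv g) [^] (2::nat)" if "a \<in> carrier G" for a
    using that g by (simp add: numeral_2_eq_2 conj_mult)
  let ?c = "\<lambda>a. g \<otimes> a \<otimes> inv g"
  from s consider (1) \<sigma> \<tau> where "\<sigma> \<in> carrier G" "\<tau> \<in> carrier G" "s = commutator G \<sigma> \<tau> [^] (2::nat)"
    | (2) \<sigma> \<tau> \<eta> where "\<sigma> \<in> carrier G" "\<tau> \<in> carrier G" "\<eta> \<in> carrier G" "s = commutator G \<sigma> (commutator G \<tau> \<eta>)"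
    by blast
  then show "?c s \<in> eps_gens"
  proof cases
    case 1
    then have "?c s = commutator G (?c \<sigma>) (?c \<tau>) [^] (2::nat)" "?c \<sigma> \<in> carrier G" "?c \<tau> \<in> carrier G"
      using g by (simp_all add: pow cl conj_commutator)
    then show ?thesis
      by blast
  next
    case 2
    then have "?c s = commutator G (?c \<sigma>) (commutator G (?c \<tau>) (?c \<eta>))"
      "?c \<sigma> \<in> carrier G" "?c \<tau> \<in> carrier G" "?c \<eta> \<in> carrier G"
      using g by (simp_all add: cl conj_commutator)
    then show ?thesis
      by blast
  qed
qed (auto simp: commutator_def)

lemma comm_subgroup_props:
  "subgroup (comm_subgroup G T) G" "closedin T (comm_subgroup G T)"
  "\<sigma> \<in> carrier G \<Longrightarrow> \<tau> \<in> carrier G \<Longrightarrow> commutator G \<sigma> \<tau> \<in> comm_subgroup G T"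
proof -
  let ?S = "{commutator G \<sigma> \<tau> | \<sigma> \<tau>. \<sigma> \<in> carrier G \<and> \<tau> \<in> carrier G}"
  have S: "?S \<subseteq> carrier G"
    by (auto simp: commutator_def)
  show "subgroup (comm_subgroup G T) G" "closedin T (comm_subgroup G T)"
    unfolding comm_subgroup_def by (rule top_generate[OF S])+
  show "\<sigma> \<in> carrier G \<Longrightarrow> \<tau> \<in> carrier G \<Longrightarrow> commutator G \<sigma> \<tau> \<in> comm_subgroup G T"
    unfolding comm_subgroup_def using top_generate(1)[OF S] by blast
qed

lemma eps_subset_comm: "eps_subgroup G T \<subseteq> comm_subgroup G T"
  unfolding eps_subgroup_def
proof (rule top_generate_minimal)
  note sub = comm_subgroup_props(1)
  have "commutator G \<sigma> \<tau> [^] (2::nat) \<in> comm_subgroup G T" if "\<sigma> \<in> carrier G" "\<tau> \<in> carrier G" for \<sigma> \<tau>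
    using that comm_subgroup_props(3) subgroup.m_closed[OF sub] by (simp add: numeral_2_eq_2 commutator_def)
  moreover have "commutator G \<sigma> (commutator G \<tau> \<eta>) \<in> comm_subgroup G T"
    if "\<sigma> \<in> carrier G" "\<tau> \<in> carrier G" "\<eta> \<in> carrier G" for \<sigma> \<tau> \<eta>
    using that by (intro comm_subgroup_props(3)) (simp_all add: commutator_def)
  ultimately show "eps_gens \<subseteq> comm_subgroup G T"
    by blast
qed (rule comm_subgroup_props)+

end

context number_field
begin

sublocale TG: topological_group "Gal F" "krull F"
  by unfold_locales (simp_all add: continuous_map_Gal_mult)

end

section \<open>The maximal abelian extension\<close>

lemma (in galois_field) restrict_commutator:
  assumes "\<sigma> \<in> carrier GQ" "\<tau> \<in> carrier GQ"
  shows "restrict (commutator GQ \<sigma> \<tau>) F = commutator (Gal F) (restrict \<sigma> F) (restrict \<tau> F)"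
  using assms by (simp add: commutator_def restrict_mult restrict_inv)

text \<open>The fixed field of all commutators: the explicit candidate for the largest abelian
  extension, confirmed by \<open>Qab_eq\<close>.\<close>

definition comm_field :: "complex set" where
  "comm_field = {x \<in> Qbar. \<forall>\<sigma>\<in>carrier GQ. \<forall>\<tau>\<in>carrier GQ. commutator GQ \<sigma> \<tau> x = x}"

text \<open>The conjugate of a commutator by the inverse of \<rho> is again a commutator and
  therefore fixes x; transporting back by \<rho> gives the claim.\<close>

lemma comm_field_conj:
  assumes \<rho>: "\<rho> \<in> carrier GQ" and x: "x \<in> comm_field"
  shows "\<rho> x \<in> comm_field"
proof -
  have xQ: "x \<in> Qbar"
    using x by (simp add: comm_field_def)
  have "commutator GQ \<sigma> \<tau> (\<rho> x) = \<rho> x" if st: "\<sigma> \<in> carrier GQ" "\<tau> \<in> carrier GQ" for \<sigma> \<tau>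
  proof -
    let ?c = "\<lambda>a. inv\<^bsub>GQ\<^esub> \<rho> \<otimes>\<^bsub>GQ\<^esub> a \<otimes>\<^bsub>GQ\<^esub> inv\<^bsub>GQ\<^esub> (inv\<^bsub>GQ\<^esub> \<rho>)"
    have "?c (commutator GQ \<sigma> \<tau>) x = x"
      using x \<rho> st unfolding Qb.TG.conj_commutator[OF Qb.G.inv_closed[OF \<rho>] st]
      by (simp add: comm_field_def)
    then have "(inv\<^bsub>GQ\<^esub> \<rho>) (commutator GQ \<sigma> \<tau> (\<rho> x)) = x"
      using \<rho> st xQ by (simp add: Gal_mult_apply Qb.commutator_closed Qb.Gal_hom(7))
    then have "\<rho> ((inv\<^bsub>GQ\<^esub> \<rho>) (commutator GQ \<sigma> \<tau> (\<rho> x))) = \<rho> x"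
      by simp
    then show ?thesis
      using Qb.Gal_inv_apply(2)[OF \<rho>] Qb.Gal_hom(7)[OF Qb.commutator_closed[OF st]]
        Qb.Gal_hom(7)[OF \<rho> xQ] by simp
  qed
  then show ?thesis
    using Qb.Gal_hom(7)[OF \<rho> xQ] by (simp add: comm_field_def)
qed

lemma galois_comm_field: "galois_extension comm_field"
  unfolding galois_extension_def
proof (intro conjI allI impI)
  show "subfield comm_field complex_ring"
    by (rule subfield_complexI)
      (auto simp: comm_field_def Qb.sf_simps Qb.Gal_hom Qb.commutator_closed)
  show "comm_field \<subseteq> Qbar"
    by (auto simp: comm_field_def)
next
  fix p :: "rat poly"
  assume p: "irreducible p \<and> (\<exists>x\<in>comm_field. poly (map_poly of_rat p) x = 0)"
  then obtain x where x: "x \<in> comm_field" "poly (map_poly of_rat p) x = 0"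
    by blast
  show "{x. poly (map_poly of_rat p) x = 0} \<subseteq> comm_field"
  proof safe
    fix y assume y: "poly (map_poly of_rat p) y = (0 :: complex)"
    obtain \<rho> where "\<rho> \<in> carrier GQ" "\<rho> x = y"
      using ex_conjugating[OF conjunct1[OF p] x(2) y] by blast
    then show "y \<in> comm_field"
      using comm_field_conj x(1) by blast
  qed
qed

text \<open>Two automorphisms of the fixed field lift to \<open>Qbar\<close>. The commutator of the
  lifts fixes the field pointwise, so both orders of composition agree there.\<close>

lemma abelian_comm_field: "abelian_extension comm_field"
proof -
  interpret K: galois_field comm_field
    by (rule galois_field.intro) (rule galois_comm_field)
  have "\<sigma> \<otimes>\<^bsub>Gal comm_field\<^esub> \<tau> = \<tau> \<otimes>\<^bsub>Gal comm_field\<^esub> \<sigma>"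
    if st: "\<sigma> \<in> carrier (Gal comm_field)" "\<tau> \<in> carrier (Gal comm_field)" for \<sigma> \<tau>
  proof -
    obtain s where s: "s \<in> carrier GQ" "restrict s comm_field = \<sigma>"
      using K.ex_extension[OF st(1)] by blast
    obtain t where t: "t \<in> carrier GQ" "restrict t comm_field = \<tau>"
      using K.ex_extension[OF st(2)] by blast
    have "s (t x) = t (s x)" if "x \<in> comm_field" for x
    proof -
      have "t (s x) \<in> comm_field"
        using comm_field_conj s t that by blast
      then have "commutator GQ s t (t (s x)) = t (s x)"
        using s t by (simp add: comm_field_def)
      moreover have "commutator GQ s t (t (s x)) = s (t x)"
        using Qb.commutator_apply_swap[OF s(1) t(1)] that K.sub_Qbar by blast
      ultimately show ?thesis
        by simp
    qed
    moreover have "restrict (s \<otimes>\<^bsub>GQ\<^esub> t) comm_field x = s (t x)"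
      "restrict (t \<otimes>\<^bsub>GQ\<^esub> s) comm_field x = t (s x)" if "x \<in> comm_field" for x
      using that s(1) t(1) K.sub_Qbar by (auto simp: Gal_mult_apply)
    ultimately have "restrict (s \<otimes>\<^bsub>GQ\<^esub> t) comm_field = restrict (t \<otimes>\<^bsub>GQ\<^esub> s) comm_field"
      using s(1) t(1) by (intro K.Gal_eqI K.restrict_Gal Qb.G.m_closed) simp_all
    then show ?thesis
      using s t by (simp add: K.restrict_mult)
  qed
  then show ?thesis
    using galois_comm_field unfolding abelian_extension_def
    by (blast intro: K.G.group_comm_groupI)
qed

text \<open>In an abelian extension every commutator of \<open>GQ\<close> restricts to a trivial
  commutator, so the extension lies in the fixed field. Hence a greatest abelian extension exists
  and \<open>GREATEST\<close> denotes it.\<close>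

lemma Qab_eq: "Qab = comm_field"
  unfolding Qab_def
proof (rule Greatest_equality)
  show "abelian_extension comm_field"
    by (rule abelian_comm_field)
next
  fix F assume F: "abelian_extension F"
  interpret galois_field F
    using F by (intro galois_field.intro) (simp add: abelian_extension_def)
  interpret comm_group "Gal F"
    using F by (simp add: abelian_extension_def)
  show "F \<le> comm_field"
  proof
    fix x assume x: "x \<in> F"
    have "commutator GQ \<sigma> \<tau> x = x" if st: "\<sigma> \<in> carrier GQ" "\<tau> \<in> carrier GQ" for \<sigma> \<tau>
    proof -
      have "commutator (Gal F) a b = \<one>\<^bsub>Gal F\<^esub>" if ab: "a \<in> Aut F" "b \<in> Aut F" for a b
      proof -
        have "commutator (Gal F) a b = b \<otimes>\<^bsub>Gal F\<^esub> a \<otimes>\<^bsub>Gal F\<^esub> inv\<^bsub>Gal F\<^esub> a \<otimes>\<^bsub>Gal F\<^esub> inv\<^bsub>Gal F\<^esub> b"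
          by (simp add: commutator_def m_comm[OF ab])
        also have "b \<otimes>\<^bsub>Gal F\<^esub> a \<otimes>\<^bsub>Gal F\<^esub> inv\<^bsub>Gal F\<^esub> a = b"
          using ab by (simp add: G.m_assoc)
        finally show ?thesis
          using ab by simp
      qed
      then have "restrict (commutator GQ \<sigma> \<tau>) F = \<one>\<^bsub>Gal F\<^esub>"
        using st by (simp add: restrict_commutator restrict_Gal)
      then have "restrict (commutator GQ \<sigma> \<tau>) F x = x"
        using x by (simp add: Gal_one_apply)
      then show ?thesis
        using x by simp
    qed
    then show "x \<in> comm_field"
      using x sub_Qbar by (auto simp: comm_field_def)
  qed
qed

interpretation Ab: galois_field Qab
  by (rule galois_field.intro) (simp add: Qab_eq galois_comm_field)

interpretation Ab: comm_group Gab
  using abelian_comm_field by (simp add: abelian_extension_def Qab_eq)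

section \<open>Fixed fields of closed subgroups, [G,G] and [G,G]^eps\<close>

lemma pair_poly_prod:
  assumes R: "pair_ring R" and "\<And>b. b \<in> B \<Longrightarrow> pair_poly R (f b) (g b)"
  shows "pair_poly R (prod f B) (prod g B)"
proof -
  have "pair_poly R 1 1"
    using pair_poly_const[OF R pair_ringD(1)[OF R]] by (simp add: one_pCons)
  then show ?thesis
    using assms(2) by (induction B rule: infinite_finite_induct) (simp_all add: pair_poly_mult[OF R])
qed

text \<open>The one inclusion of the Galois correspondence for closed subgroups: if an automorphism fixes
  the fixed field of \<open>H\<close>, then it maps a separating element \<open>\<beta>\<close> to a root of the polynomial whose
  roots are the \<open>H\<close>-conjugates of \<open>\<beta>\<close>, so it agrees with an element of \<open>H\<close> on a given finite set.\<close>

lemma closed_subgroup_eq_fixing: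
  assumes H: "subgroup H GQ" "closedin (krull Qbar) H"
    and \<rho>: "\<rho> \<in> carrier GQ" "\<And>x. x \<in> Qbar \<Longrightarrow> (\<And>h. h \<in> H \<Longrightarrow> h x = x) \<Longrightarrow> \<rho> x = x"
  shows "\<rho> \<in> H"
proof (rule ccontr)
  assume "\<rho> \<notin> H"
  have HG: "h \<in> carrier GQ" if "h \<in> H" for h
    using H(1) that by (rule subgroup.mem_carrier)
  have "openin (krull Qbar) (carrier GQ - H)"
    using H(2) unfolding closedin_def by simp
  then obtain S where S: "finite S" "S \<subseteq> Qbar"
    "\<And>\<tau>. \<tau> \<in> carrier GQ \<Longrightarrow> (\<forall>s\<in>S. \<tau> s = \<rho> s) \<Longrightarrow> \<tau> \<in> carrier GQ - H"
    unfolding Qb.openin_krull_iff using \<rho>(1) \<open>\<rho> \<notin> H\<close> by (metis DiffI)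
  obtain \<beta> where \<beta>: "\<beta> \<in> Qbar"
    "\<And>g h. g \<in> carrier GQ \<Longrightarrow> h \<in> carrier GQ \<Longrightarrow> g \<beta> = h \<beta> \<Longrightarrow> \<forall>s\<in>S. g s = h s"
    using ex_separating[OF S(1,2)] by blast
  define B where "B = (\<lambda>h. h \<beta>) ` H"
  have finB: "finite B"
    using finite_conjugates[OF \<beta>(1)] HG finite_subset unfolding B_def by (metis image_subset_iff)
  define p where "p = (\<Prod>b\<in>B. [:- b, 1:])"
  have BQ: "B \<subseteq> Qbar"
    using Qb.Gal_hom(7) HG \<beta>(1) by (auto simp: B_def)
  have one: "\<one>\<^bsub>GQ\<^esub> \<in> H"
    by (rule subgroup.one_closed[OF H(1)])
  have coeffs: "coeff p i \<in> Qbar \<and> h (coeff p i) = coeff p i" if h: "h \<in> H" for h i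
  proof -
    \<comment> \<open>With the graph of h as pair ring, the partner of p is p with h applied to its
      coefficients. As h permutes the finite set \<open>B\<close>, this partner is p again.\<close>
    let ?R = "{(x, h x) | x. x \<in> Qbar}"
    have R: "pair_ring ?R"
      by (rule Qb.pair_ring_graph[OF HG[OF h]])
    have "pair_poly ?R [:- b, 1:] [:- h b, 1:]" if "b \<in> B" for b
      using that BQ Qb.sf_simps Qb.Gal_hom[OF HG[OF h]]
      by (auto simp: pair_poly_def coeff_pCons split: nat.split)
    then have "pair_poly ?R p (\<Prod>b\<in>B. [:- h b, 1:])"
      unfolding p_def by (rule pair_poly_prod[OF R])
    moreover have "(\<Prod>b\<in>B. [:- h b, 1:]) = p"
    proof -
      have inj: "inj_on h B"
        using Qb.Gal_hom(8)[OF HG[OF h]] BQ by (auto simp: inj_on_def)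
      have "h ` B \<subseteq> B"
      proof safe
        fix b assume "b \<in> B"
        then obtain k where k: "k \<in> H" "b = k \<beta>"
          by (auto simp: B_def)
        then have "h b = (h \<otimes>\<^bsub>GQ\<^esub> k) \<beta>"
          using HG h \<beta>(1) by (simp add: Gal_mult_apply)
        then show "h b \<in> B"
          using subgroup.m_closed[OF H(1) h k(1)] by (auto simp: B_def)
      qed
      then have "h ` B = B"
        using inj finB by (simp add: endo_inj_surj)
      then show ?thesis
        using prod.reindex[OF inj, of "\<lambda>b. [:- b, 1:]"] by (simp add: p_def)
    qed
    ultimately show ?thesis
      by (auto simp: pair_poly_def)
  qed
  have "\<rho> (poly p \<beta>) = poly p (\<rho> \<beta>)"
    using coeffs one \<rho> \<beta>(1) by (intro Qb.Gal_poly) blast+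
  moreover have "poly p \<beta> = 0"
  proof -
    have "\<beta> \<in> B"
      unfolding B_def by (rule image_eqI[OF _ one]) (simp add: Gal_one_apply \<beta>(1))
    then show ?thesis
      using finB by (auto simp: p_def poly_prod prod_zero_iff)
  qed
  ultimately have "poly p (\<rho> \<beta>) = 0"
    by (simp add: Qb.Gal_hom[OF \<rho>(1)])
  then have "\<rho> \<beta> \<in> B"
    using finB by (auto simp: p_def poly_prod prod_zero_iff)
  then obtain h where h: "h \<in> H" "\<rho> \<beta> = h \<beta>"
    by (auto simp: B_def)
  then have "\<forall>s\<in>S. h s = \<rho> s"
    using \<beta>(2)[OF HG[OF h(1)] \<rho>(1)] by simp
  then show False
    using S(3) HG h(1) by blast
qed

text \<open>Identifies [G,G] with the Galois group of \<open>Qbar\<close> over \<open>Qab\<close>: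
  it is closed, and what its commutators fix is exactly \<open>Qab\<close>.\<close>

lemma GQ_comm_eq: "GQ_comm = {\<rho> \<in> carrier GQ. \<forall>x\<in>Qab. \<rho> x = x}"
proof
  show "GQ_comm \<subseteq> {\<rho> \<in> carrier GQ. \<forall>x\<in>Qab. \<rho> x = x}"
    unfolding GQ_comm_def comm_subgroup_def
  proof (rule Qb.TG.top_generate_minimal)
    show "{commutator GQ \<sigma> \<tau> | \<sigma> \<tau>. \<sigma> \<in> carrier GQ \<and> \<tau> \<in> carrier GQ}
        \<subseteq> {\<rho> \<in> carrier GQ. \<forall>x\<in>Qab. \<rho> x = x}"
      by (auto simp: Qab_eq comm_field_def Qb.commutator_closed)
  qed (intro Qb.subgroup_fixing Qb.closedin_fixing Ab.sub_Qbar)+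
next
  show "{\<rho> \<in> carrier GQ. \<forall>x\<in>Qab. \<rho> x = x} \<subseteq> GQ_comm"
  proof safe
    fix \<rho> assume \<rho>: "\<rho> \<in> carrier GQ" "\<forall>x\<in>Qab. \<rho> x = x"
    show "\<rho> \<in> GQ_comm"
      unfolding GQ_comm_def
    proof (rule closed_subgroup_eq_fixing[OF Qb.TG.comm_subgroup_props(1,2) \<rho>(1)])
      fix x assume "x \<in> Qbar" "\<And>h. h \<in> comm_subgroup GQ (krull Qbar) \<Longrightarrow> h x = x"
      then have "x \<in> Qab"
        using Qb.TG.comm_subgroup_props(3) by (auto simp: Qab_eq comm_field_def)
      then show "\<rho> x = x"
        using \<rho>(2) by blast
    qed
  qed
qed

text \<open>Every automorphism acts on x by a sign, and signs commute.\<close>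

lemma quadratic_in_Qab:
  assumes "x\<^sup>2 \<in> \<rat>"
  shows "x \<in> Qab"
proof -
  have xQ: "x \<in> Qbar"
  proof -
    have "\<forall>i. coeff [:- (x\<^sup>2), 0, 1:] i \<in> \<rat>"
      using assms by (auto simp: coeff_pCons split: nat.split)
    then show ?thesis
      unfolding Qbar_def by (auto intro!: algebraicI'[of "[:- (x\<^sup>2), 0, 1:]"] simp: power2_eq_square)
  qed
  have pm: "\<rho> x = x \<or> \<rho> x = - x" if "\<rho> \<in> carrier GQ" for \<rho>
  proof -
    have "(\<rho> x)\<^sup>2 = x\<^sup>2"
      using Qb.Gal_hom(14)[OF that xQ, of 2] Qb.Gal_hom(15)[OF that assms] by simp
    then show ?thesis
      by (simp add: power2_eq_iff)
  qed
  have "commutator GQ \<sigma> \<tau> x = x" if st: "\<sigma> \<in> carrier GQ" "\<tau> \<in> carrier GQ" for \<sigma> \<tau>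
  proof -
    have "commutator GQ \<sigma> \<tau> (\<tau> (\<sigma> x)) = \<sigma> (\<tau> x)"
      by (rule Qb.commutator_apply_swap[OF st xQ])
    then show ?thesis
      using pm[OF st(1)] pm[OF st(2)] xQ Qb.sf_simps(6)[OF xQ]
      by (auto simp: Qb.Gal_hom(5)[OF st(1)] Qb.Gal_hom(5)[OF st(2)] Qb.Gal_hom(5)[OF Qb.commutator_closed[OF st]])
  qed
  then show ?thesis
    using xQ by (simp add: Qab_eq comm_field_def)
qed

text \<open>[G,G] acts on r by signs, so squares of its elements fix r. An element g of [G,G] also
  fixes \<sigma> r / r, so g and \<sigma> commute on r, which settles the iterated commutators. The
  stabiliser of r is a closed subgroup and thus contains \<open>GQ_eps\<close>.\<close>

lemma GQ_eps_fixes: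
  assumes r: "r \<in> Qbar" "r \<noteq> 0" "r\<^sup>2 \<in> Qab" and ratio: "\<And>\<sigma>. \<sigma> \<in> carrier GQ \<Longrightarrow> \<sigma> r / r \<in> Qab"
    and \<rho>: "\<rho> \<in> GQ_eps"
  shows "\<rho> r = r"
proof -
  have pm: "g r = r \<or> g r = - r" if "g \<in> GQ_comm" for g
  proof -
    have "(g r)\<^sup>2 = r\<^sup>2"
      using that r Qb.Gal_hom(14)[of g r 2] by (auto simp: GQ_comm_eq)
    then show ?thesis
      by (simp add: power2_eq_iff)
  qed
  have com: "commutator GQ \<sigma> \<tau> \<in> GQ_comm" if "\<sigma> \<in> carrier GQ" "\<tau> \<in> carrier GQ" for \<sigma> \<tau>
    unfolding GQ_comm_def using that by (rule Qb.TG.comm_subgroup_props(3))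
  have G: "g \<in> carrier GQ" if "g \<in> GQ_comm" for g
    using that by (simp add: GQ_comm_eq)
  have sq: "(g [^]\<^bsub>GQ\<^esub> (2::nat)) r = r" if "g \<in> GQ_comm" for g
    using pm[OF that] G[OF that] r(1)
    by (auto simp: numeral_2_eq_2 Gal_mult_apply Qb.Gal_hom(5) Gal_one_apply)
  have tw: "commutator GQ \<sigma> g r = r" if \<sigma>: "\<sigma> \<in> carrier GQ" and g: "g \<in> GQ_comm" for \<sigma> g
  proof -
    have rr: "\<sigma> r = (\<sigma> r / r) * r"
      using r(2) by simp
    have "\<sigma> r / r \<in> Qab"
      by (rule ratio[OF \<sigma>])
    then have g1: "g (\<sigma> r / r) = \<sigma> r / r" "\<sigma> r / r \<in> Qbar"
      using g Ab.sub_Qbar by (auto simp: GQ_comm_eq)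
    have "g (\<sigma> r) = g ((\<sigma> r / r) * r)"
      using rr by simp
    also have "\<dots> = \<sigma> r / r * g r"
      using g1 r(1) by (simp add: Qb.Gal_hom(2)[OF G[OF g]] del: times_divide_eq_left)
    finally have "g (\<sigma> r) = \<sigma> r / r * g r" .
    then have "g (\<sigma> r) = \<sigma> (g r)"
      using pm[OF g] r by (auto simp: Qb.Gal_hom(5)[OF \<sigma>])
    moreover have "commutator GQ \<sigma> g (g (\<sigma> r)) = \<sigma> (g r)"
      by (rule Qb.commutator_apply_swap[OF \<sigma> G[OF g] r(1)])
    ultimately have c: "commutator GQ \<sigma> g y = y" if "y = \<sigma> (g r)" for y
      using that by simp
    have "commutator GQ \<sigma> g \<in> GQ_comm"
      using \<sigma> G[OF g] by (rule com)
    note cG = G[OF this] and this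
    have s: "\<sigma> (g r) = (\<sigma> (g r) / r) * r" and sq: "\<sigma> (g r) / r \<in> Qab"
      using r(2) ratio[OF Qb.G.m_closed[OF \<sigma> G[OF g]]] r(1) by (auto simp: Gal_mult_apply \<sigma> G[OF g])
    have fix_quot: "commutator GQ \<sigma> g (\<sigma> (g r) / r) = \<sigma> (g r) / r"
      using sq \<open>commutator GQ \<sigma> g \<in> GQ_comm\<close> by (simp add: GQ_comm_eq)
    \<comment> \<open>The commutator is known to fix \<open>\<sigma> (g r)\<close>. This is r times
      an element of \<open>Qab\<close>, which the commutator also fixes; dividing shows that r
      itself is fixed.\<close>
    have "commutator GQ \<sigma> g (\<sigma> (g r)) =
        commutator GQ \<sigma> g (\<sigma> (g r) / r) * commutator GQ \<sigma> g r"
      using s Qb.Gal_hom(2)[OF cG, of "\<sigma> (g r) / r" r] sq r(1) Ab.sub_Qbar by auto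
    then have "\<sigma> (g r) / r * commutator GQ \<sigma> g r = \<sigma> (g r) / r * r"
      using c[OF refl] s fix_quot by metis
    moreover have "\<sigma> (g r) \<noteq> 0"
      using r by (simp add: Qb.Gal_hom(7,9) \<sigma> G[OF g])
    ultimately show ?thesis
      using r(2) by (metis divide_eq_0_iff mult_left_cancel)
  qed
  have "GQ_eps \<subseteq> {\<rho> \<in> carrier GQ. \<forall>x\<in>{r}. \<rho> x = x}"
    unfolding GQ_eps_def eps_subgroup_def
    using sq tw com G r(1)
    by (intro Qb.TG.top_generate_minimal Qb.subgroup_fixing Qb.closedin_fixing)
      (auto simp: Qb.commutator_closed)
  then show ?thesis
    using \<rho> by blast
qed

lemma GQ_eps_props: "GQ_eps \<lhd> GQ" "GQ_eps \<subseteq> GQ_comm" "subgroup GQ_comm GQ" "subgroup GQ_eps GQ"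
  unfolding GQ_eps_def GQ_comm_def
  using Qb.TG.eps_subgroup_normal
  by (auto simp: Qb.TG.eps_subset_comm Qb.TG.comm_subgroup_props(1) normal_imp_subgroup)

section \<open>The cup product and the exterior square\<close>

declare add_bit_eq_xor [simp del] mult_bit_eq_and [simp del]

lemma bit_add_self: "x + x = (0 :: bit)" "x + (x + y) = (y :: bit)"
  by (cases x; cases y; simp)+

lemma bit_diff: "x - y = x + (y :: bit)" "- x = (x :: bit)"
  by (cases x; cases y; simp)+

lemmas bit_simps = bit_add_self bit_diff add.assoc add.commute[of "_ :: bit"] add.left_commute[of "_ :: bit"]
  distrib_left[of "_ :: bit"] distrib_right[of "_ :: bit"] mult.assoc mult.commute[of "_ :: bit"] mult.left_commute[of "_ :: bit"]

lemma bit_eq_iff_add: "x = y \<longleftrightarrow> x + y = (0 :: bit)"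
  by (cases x; cases y; simp)

locale topological_comm_group = topological_group G T + comm_group G
  for G :: "('a, 'b) monoid_scheme" (structure) and T :: "'a topology"
begin

section \<open>Cocycles, coboundaries and the quotient by abelian extensions\<close>

abbreviation "Z2 \<equiv> cocycles2 G T"
abbreviation "B2 \<equiv> coboundaries2 G T"

lemma continuous_fst_snd:
  assumes "continuous_map T D g"
  shows "continuous_map (prod_topology T T) D (\<lambda>(\<sigma>, \<tau>). g \<sigma>)"
    and "continuous_map (prod_topology T T) D (\<lambda>(\<sigma>, \<tau>). g \<tau>)"
    and "continuous_map (prod_topology T T) D (\<lambda>(\<sigma>, \<tau>). g (\<sigma> \<otimes> \<tau>))"
  using continuous_map_compose[OF continuous_map_fst assms, of T]
    continuous_map_compose[OF continuous_map_snd assms, of T]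
    continuous_map_compose[OF continuous_mult assms]
  by (simp_all add: comp_def case_prod_unfold)

definition coboundary :: "('a \<Rightarrow> bit) \<Rightarrow> 'a \<times> 'a \<Rightarrow> bit" where
  "coboundary g = (\<lambda>(\<sigma>, \<tau>)\<in>carrier G \<times> carrier G. g \<tau> - g (\<sigma> \<otimes> \<tau>) + g \<sigma>)"

lemma Z2_iff:
  "f \<in> carrier Z2 \<longleftrightarrow> f \<in> extensional (carrier G \<times> carrier G) \<and>
     locally_constant (prod_topology T T) f \<and>
     (\<forall>\<sigma>\<in>carrier G. \<forall>\<tau>\<in>carrier G. \<forall>\<eta>\<in>carrier G.
        f (\<tau>, \<eta>) + f (\<sigma>, \<tau> \<otimes> \<eta>) = f (\<sigma> \<otimes> \<tau>, \<eta>) + f (\<sigma>, \<tau>))"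
proof -
  have "a - b + c - d = 0 \<longleftrightarrow> a + c = b + d" for a b c d :: bit
    by (cases a; cases b; cases c; cases d; simp)
  then show ?thesis
    by (simp add: cocycles2_def)
qed

lemma Z2_simps:
  "f \<otimes>\<^bsub>Z2\<^esub> g = (\<lambda>x\<in>carrier G \<times> carrier G. f x + g x)"
  "\<one>\<^bsub>Z2\<^esub> = (\<lambda>x\<in>carrier G \<times> carrier G. 0)"
  by (simp_all add: cocycles2_def)

lemma Z2_add:
  assumes "f \<in> carrier Z2" "g \<in> carrier Z2"
  shows "(\<lambda>x\<in>carrier G \<times> carrier G. f x + g x) \<in> carrier Z2"
  unfolding Z2_iff
proof (intro conjI ballI)
  show "locally_constant (prod_topology T T) (\<lambda>x\<in>carrier G \<times> carrier G. f x + g x)"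
    by (rule locally_constant_combine[of _ f g]) (use assms in \<open>auto simp: Z2_iff topspace_T\<close>)
next
  fix \<sigma> \<tau> \<eta> assume *: "\<sigma> \<in> carrier G" "\<tau> \<in> carrier G" "\<eta> \<in> carrier G"
  have "f (\<tau>, \<eta>) + f (\<sigma>, \<tau> \<otimes> \<eta>) = f (\<sigma> \<otimes> \<tau>, \<eta>) + f (\<sigma>, \<tau>)" "g (\<tau>, \<eta>) + g (\<sigma>, \<tau> \<otimes> \<eta>) = g (\<sigma> \<otimes> \<tau>, \<eta>) + g (\<sigma>, \<tau>)"
    using assms * by (auto simp: Z2_iff)
  then have "(f (\<tau>, \<eta>) + f (\<sigma>, \<tau> \<otimes> \<eta>)) + (g (\<tau>, \<eta>) + g (\<sigma>, \<tau> \<otimes> \<eta>)) =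
      (f (\<sigma> \<otimes> \<tau>, \<eta>) + f (\<sigma>, \<tau>)) + (g (\<sigma> \<otimes> \<tau>, \<eta>) + g (\<sigma>, \<tau>))"
    by simp
  then show "(\<lambda>x\<in>carrier G \<times> carrier G. f x + g x) (\<tau>, \<eta>) + (\<lambda>x\<in>carrier G \<times> carrier G. f x + g x) (\<sigma>, \<tau> \<otimes> \<eta>) =
      (\<lambda>x\<in>carrier G \<times> carrier G. f x + g x) (\<sigma> \<otimes> \<tau>, \<eta>) + (\<lambda>x\<in>carrier G \<times> carrier G. f x + g x) (\<sigma>, \<tau>)"
    using * by (simp add: ac_simps)
qed auto

lemma comm_group_Z2: "comm_group Z2"
proof (rule comm_groupI)
  show "\<one>\<^bsub>Z2\<^esub> \<in> carrier Z2"
    by (auto simp: Z2_iff Z2_simps topspace_T intro: continuous_map_eq[of _ _ "\<lambda>_. 0"])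
next
  fix f assume f: "f \<in> carrier Z2"
  then show "\<one>\<^bsub>Z2\<^esub> \<otimes>\<^bsub>Z2\<^esub> f = f"
    by (auto simp: Z2_simps Z2_iff extensional_def fun_eq_iff)
  have "f \<otimes>\<^bsub>Z2\<^esub> f = \<one>\<^bsub>Z2\<^esub>"
    by (auto simp: Z2_simps bit_simps)
  then show "\<exists>g\<in>carrier Z2. g \<otimes>\<^bsub>Z2\<^esub> f = \<one>\<^bsub>Z2\<^esub>"
    using f by blast
qed (auto simp: Z2_simps(1) Z2_add ac_simps fun_eq_iff)

sublocale Z2: comm_group Z2
  by (rule comm_group_Z2)

lemma Z2_inv:
  assumes "f \<in> carrier Z2"
  shows "inv\<^bsub>Z2\<^esub> f = f"
proof (rule Z2.inv_equality)
  show "f \<otimes>\<^bsub>Z2\<^esub> f = \<one>\<^bsub>Z2\<^esub>"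
    by (auto simp: Z2_simps bit_simps)
qed (rule assms)+

lemma coboundaries2_eq: "B2 = coboundary ` {g. locally_constant T g}"
  by (auto simp: coboundaries2_def coboundary_def)

lemma coboundary_in_Z2:
  assumes "locally_constant T g"
  shows "coboundary g \<in> carrier Z2"
  unfolding Z2_iff
proof (intro conjI ballI)
  note c = continuous_fst_snd[OF assms]
  have "locally_constant (prod_topology T T) (\<lambda>(\<sigma>, \<tau>). (g \<sigma>, g \<tau>))"
    by (rule locally_constant_combine[OF c(1,2)]) auto
  then show "locally_constant (prod_topology T T) (coboundary g)"
    by (rule locally_constant_combine[OF _ c(3)]) (auto simp: coboundary_def topspace_T)
qed (auto simp: coboundary_def m_assoc bit_simps)

lemma subgroup_B2: "subgroup B2 Z2"
proof (rule Z2.subgroupI)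
  show "B2 \<subseteq> carrier Z2"
    using coboundary_in_Z2 by (auto simp: coboundaries2_eq)
  show "B2 \<noteq> {}"
    by (auto simp: coboundaries2_eq intro!: exI[of _ "\<lambda>_. 0"])
next
  fix f assume f: "f \<in> B2"
  then have "f \<in> carrier Z2"
    using coboundary_in_Z2 by (auto simp: coboundaries2_eq)
  then show "inv\<^bsub>Z2\<^esub> f \<in> B2"
    using f by (simp add: Z2_inv)
next
  fix f f' assume "f \<in> B2" "f' \<in> B2"
  then obtain g g' where g: "locally_constant T g" "f = coboundary g"
    "locally_constant T g'" "f' = coboundary g'"
    by (auto simp: coboundaries2_eq)
  have "locally_constant T (\<lambda>\<sigma>. g \<sigma> + g' \<sigma>)"
    by (rule locally_constant_combine[OF g(1,3)]) simp
  moreover have "f \<otimes>\<^bsub>Z2\<^esub> f' = coboundary (\<lambda>\<sigma>. g \<sigma> + g' \<sigma>)"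
    unfolding g(2,4) by (rule ext) (auto simp: Z2_simps coboundary_def bit_simps)
  ultimately show "f \<otimes>\<^bsub>Z2\<^esub> f' \<in> B2"
    by (auto simp: coboundaries2_eq)
qed

lemma normal_B2: "B2 \<lhd> Z2"
  by (rule Z2.subgroup_imp_normal[OF subgroup_B2])

lemma comm_group_H2: "comm_group (H2 G T)"
  unfolding H2_def using Z2.abelian_FactGroup[OF subgroup_B2] .

sublocale H2: comm_group "H2 G T"
  by (rule comm_group_H2)

lemma class2_closed: "f \<in> carrier Z2 \<Longrightarrow> class2 G T f \<in> carrier (H2 G T)"
  by (auto simp: class2_def H2_def carrier_FactGroup)

lemma class2_mult:
  "f \<in> carrier Z2 \<Longrightarrow> g \<in> carrier Z2 \<Longrightarrow> class2 G T f \<otimes>\<^bsub>H2 G T\<^esub> class2 G T g = class2 G T (f \<otimes>\<^bsub>Z2\<^esub> g)"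
  by (simp add: class2_def H2_def normal.rcos_sum[OF normal_B2])

lemma class2_inv:
  assumes "f \<in> carrier Z2"
  shows "inv\<^bsub>H2 G T\<^esub> (class2 G T f) = class2 G T f"
proof (rule H2.inv_equality)
  have "class2 G T f \<otimes>\<^bsub>H2 G T\<^esub> class2 G T f = class2 G T \<one>\<^bsub>Z2\<^esub>"
    using assms Z2.l_inv[OF assms] by (simp add: class2_mult Z2_inv)
  then show "class2 G T f \<otimes>\<^bsub>H2 G T\<^esub> class2 G T f = \<one>\<^bsub>H2 G T\<^esub>"
    using subgroup.subset[OF subgroup_B2] by (simp add: class2_def H2_def)
qed (simp_all add: class2_closed assms)

definition symmetric :: "('a \<times> 'a \<Rightarrow> bit) \<Rightarrow> bool" where
  "symmetric f \<longleftrightarrow> (\<forall>\<sigma>\<in>carrier G. \<forall>\<tau>\<in>carrier G. f (\<sigma>, \<tau>) = f (\<tau>, \<sigma>))"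

text \<open>The products of (0, \<sigma>) and (0, \<tau>) in the two orders differ exactly by the
  two values of f. Conversely, the cocycle identity supplies associativity and symmetry supplies
  commutativity.\<close>

lemma comm_group_ext_group_iff:
  assumes f: "f \<in> carrier Z2"
  shows "comm_group (ext_group G f) \<longleftrightarrow> symmetric f"
proof
  assume "comm_group (ext_group G f)"
  then interpret E: comm_group "ext_group G f" .
  show "symmetric f"
    unfolding symmetric_def
  proof (intro ballI)
    fix \<sigma> \<tau> assume "\<sigma> \<in> carrier G" "\<tau> \<in> carrier G"
    then have "(0, \<sigma>) \<otimes>\<^bsub>ext_group G f\<^esub> (0, \<tau>) = (0, \<tau>) \<otimes>\<^bsub>ext_group G f\<^esub> (0, \<sigma>)"
      by (intro E.m_comm) (simp_all add: ext_group_def)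
    then show "f (\<sigma>, \<tau>) = f (\<tau>, \<sigma>)"
      by (simp add: ext_group_def)
  qed
next
  assume sym: "symmetric f"
  have coc: "f (\<tau>, \<eta>) + f (\<sigma>, \<tau> \<otimes> \<eta>) = f (\<sigma> \<otimes> \<tau>, \<eta>) + f (\<sigma>, \<tau>)"
    if "\<sigma> \<in> carrier G" "\<tau> \<in> carrier G" "\<eta> \<in> carrier G" for \<sigma> \<tau> \<eta>
    using f that by (simp add: Z2_iff)
  \<comment> \<open>The cocycle identity at the triple with two unit entries; it makes the unit of
    the extension correct without normalising f.\<close>
  have unit: "f (\<one>, \<tau>) = f (\<one>, \<one>)" if "\<tau> \<in> carrier G" for \<tau>
    using coc[of \<one> \<one> \<tau>] that bit_eq_iff_add[of "f (\<one>, \<tau>)" "f (\<one>, \<one>)"] by (simp add: bit_simps)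
  let ?E = "ext_group G f"
  have mult: "(a, \<sigma>) \<otimes>\<^bsub>?E\<^esub> (b, \<tau>) = (a + b + f (\<sigma>, \<tau>), \<sigma> \<otimes> \<tau>)" for a b \<sigma> \<tau>
    by (simp add: ext_group_def)
  have car: "(a, \<sigma>) \<in> carrier ?E \<longleftrightarrow> \<sigma> \<in> carrier G" for a \<sigma>
    by (simp add: ext_group_def)
  have one: "\<one>\<^bsub>?E\<^esub> = (f (\<one>, \<one>), \<one>)"
    by (simp add: ext_group_def bit_diff)
  show "comm_group ?E"
  proof (rule comm_groupI; (simp only: split_paired_all car one)?)
    fix a \<sigma> b \<tau> c \<eta> assume *: "\<sigma> \<in> carrier G" "\<tau> \<in> carrier G" "\<eta> \<in> carrier G"
    have "a + b + f (\<sigma>, \<tau>) + c + f (\<sigma> \<otimes> \<tau>, \<eta>) = a + b + c + (f (\<sigma> \<otimes> \<tau>, \<eta>) + f (\<sigma>, \<tau>))"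
      by (simp add: ac_simps)
    also have "\<dots> = a + (b + c + f (\<tau>, \<eta>)) + f (\<sigma>, \<tau> \<otimes> \<eta>)"
      unfolding coc[OF *, symmetric] by (simp add: ac_simps)
    finally show "(a, \<sigma>) \<otimes>\<^bsub>?E\<^esub> (b, \<tau>) \<otimes>\<^bsub>?E\<^esub> (c, \<eta>) = (a, \<sigma>) \<otimes>\<^bsub>?E\<^esub> ((b, \<tau>) \<otimes>\<^bsub>?E\<^esub> (c, \<eta>))"
      using * by (simp add: mult m_assoc)
  next
    fix a \<sigma> b \<tau> assume "\<sigma> \<in> carrier G" "\<tau> \<in> carrier G"
    then show "(a, \<sigma>) \<otimes>\<^bsub>?E\<^esub> (b, \<tau>) = (b, \<tau>) \<otimes>\<^bsub>?E\<^esub> (a, \<sigma>)"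
      using sym by (simp add: mult m_comm symmetric_def add.commute)
  next
    fix a \<sigma> assume \<sigma>: "\<sigma> \<in> carrier G"
    then show "(f (\<one>, \<one>), \<one>) \<otimes>\<^bsub>?E\<^esub> (a, \<sigma>) = (a, \<sigma>)"
      using unit[OF \<sigma>] by (simp add: mult bit_simps)
    \<comment> \<open>The two correction terms cancel the cocycle value of the product and leave the
      first component of the non-normalised unit.\<close>
    have "(a + f (inv \<sigma>, \<sigma>) + f (\<one>, \<one>), inv \<sigma>) \<otimes>\<^bsub>?E\<^esub> (a, \<sigma>) = (f (\<one>, \<one>), \<one>)"
      using \<sigma> by (simp add: mult bit_simps)
    then show "\<exists>y\<in>carrier ?E. y \<otimes>\<^bsub>?E\<^esub> (a, \<sigma>) = (f (\<one>, \<one>), \<one>)"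
      using \<sigma> by (intro bexI) (auto simp: car)
  qed (auto simp: mult car)
qed

lemma symmetric_add:
  "symmetric f \<Longrightarrow> symmetric g \<Longrightarrow> symmetric (f \<otimes>\<^bsub>Z2\<^esub> g)"
  by (simp add: symmetric_def Z2_simps)

lemma symmetric_coboundary: "f \<in> B2 \<Longrightarrow> symmetric f"
  by (auto simp: coboundaries2_eq symmetric_def coboundary_def m_comm bit_simps)

text \<open>On a commutative group coboundaries are symmetric, so symmetry depends only on the
  class, and any representative decides whether the middle group is abelian.\<close>

lemma class2_mem_abelian_iff:
  assumes f: "f \<in> carrier Z2"
  shows "class2 G T f \<in> abelian_classes G T \<longleftrightarrow> symmetric f"
proof
  assume "class2 G T f \<in> abelian_classes G T"
  then obtain f' where f': "f' \<in> class2 G T f" "comm_group (ext_group G f')"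
    by (auto simp: abelian_classes_def)
  then obtain b where b: "b \<in> B2" "f' = b \<otimes>\<^bsub>Z2\<^esub> f"
    by (auto simp: class2_def r_coset_def)
  have bZ: "b \<in> carrier Z2"
    using b subgroup.mem_carrier[OF subgroup_B2] by blast
  have "symmetric f'"
    using f' comm_group_ext_group_iff[of f'] b bZ f by auto
  then have "symmetric (b \<otimes>\<^bsub>Z2\<^esub> f')"
    using symmetric_coboundary[OF b(1)] by (rule symmetric_add[rotated])
  moreover have "b \<otimes>\<^bsub>Z2\<^esub> f' = f"
    using Z2.inv_solve_left[OF f bZ, of f'] b bZ f by (simp add: Z2_inv)
  ultimately show "symmetric f"
    by simp
next
  assume "symmetric f"
  moreover have "f \<in> class2 G T f"
    unfolding class2_def by (rule Z2.rcos_self[OF f subgroup_B2])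
  ultimately show "class2 G T f \<in> abelian_classes G T"
    using f comm_group_ext_group_iff[OF f] class2_closed[OF f] by (auto simp: abelian_classes_def)
qed

lemma H2_cases:
  assumes "A \<in> carrier (H2 G T)"
  obtains f where "f \<in> carrier Z2" "A = class2 G T f"
  using assms by (auto simp: H2_def carrier_FactGroup class2_def)

lemma subgroup_abelian_classes: "subgroup (abelian_classes G T) (H2 G T)"
proof (rule H2.subgroupI)
  show sub: "abelian_classes G T \<subseteq> carrier (H2 G T)"
    by (auto simp: abelian_classes_def)
  have "symmetric \<one>\<^bsub>Z2\<^esub>"
    by (simp add: symmetric_def Z2_simps)
  then have "class2 G T \<one>\<^bsub>Z2\<^esub> \<in> abelian_classes G T"
    by (simp add: class2_mem_abelian_iff)
  then show "abelian_classes G T \<noteq> {}"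
    by blast
  fix A assume A: "A \<in> abelian_classes G T"
  then obtain f where f: "f \<in> carrier Z2" "A = class2 G T f"
    using sub H2_cases by blast
  then show "inv\<^bsub>H2 G T\<^esub> A \<in> abelian_classes G T"
    using A by (simp add: class2_inv)
  fix B assume B: "B \<in> abelian_classes G T"
  then obtain g where g: "g \<in> carrier Z2" "B = class2 G T g"
    using sub H2_cases by blast
  show "A \<otimes>\<^bsub>H2 G T\<^esub> B \<in> abelian_classes G T"
    using A B f g by (simp add: class2_mult class2_mem_abelian_iff symmetric_add)
qed

lemma normal_abelian_classes: "abelian_classes G T \<lhd> H2 G T"
  by (rule H2.subgroup_imp_normal[OF subgroup_abelian_classes])

lemma comm_group_H2minus: "comm_group (H2minus G T)"
  unfolding H2minus_def using H2.abelian_FactGroup[OF subgroup_abelian_classes] .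

sublocale H2m: comm_group "H2minus G T"
  by (rule comm_group_H2minus)

lemma class2minus_closed: "f \<in> carrier Z2 \<Longrightarrow> class2minus G T f \<in> carrier (H2minus G T)"
  using class2_closed by (auto simp: class2minus_def H2minus_def carrier_FactGroup)

lemma class2minus_mult:
  "f \<in> carrier Z2 \<Longrightarrow> g \<in> carrier Z2 \<Longrightarrow>
    class2minus G T f \<otimes>\<^bsub>H2minus G T\<^esub> class2minus G T g = class2minus G T (f \<otimes>\<^bsub>Z2\<^esub> g)"
  by (simp add: class2minus_def H2minus_def normal.rcos_sum[OF normal_abelian_classes] class2_closed class2_mult)

text \<open>The working criterion for equality modulo abelian extensions; in characteristic 2 the
  difference of two cocycles is their sum.\<close>

lemma class2minus_eq_iff:
  assumes f: "f \<in> carrier Z2" and g: "g \<in> carrier Z2"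
  shows "class2minus G T f = class2minus G T g \<longleftrightarrow> symmetric (f \<otimes>\<^bsub>Z2\<^esub> g)"
proof -
  let ?A = "abelian_classes G T"
  note sub = subgroup_abelian_classes
  have "class2minus G T f = class2minus G T g \<longleftrightarrow> class2 G T f \<in> ?A #>\<^bsub>H2 G T\<^esub> class2 G T g"
    unfolding class2minus_def
    using H2.repr_independence[OF _ class2_closed[OF g] sub] H2.rcos_self[OF class2_closed[OF f] sub] by blast
  also have "\<dots> \<longleftrightarrow> class2 G T f \<otimes>\<^bsub>H2 G T\<^esub> inv\<^bsub>H2 G T\<^esub> (class2 G T g) \<in> ?A"
    by (rule subgroup.rcos_module[OF sub H2.group_axioms class2_closed[OF g] class2_closed[OF f]])
  also have "\<dots> \<longleftrightarrow> symmetric (f \<otimes>\<^bsub>Z2\<^esub> g)"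
    using f g by (simp add: class2_inv class2_mult class2_mem_abelian_iff)
  finally show ?thesis .
qed

section \<open>Continuous characters and their cup products\<close>

abbreviation "V \<equiv> H1 G T"

lemma H1_iff:
  "h \<in> carrier V \<longleftrightarrow> h \<in> extensional (carrier G) \<and> locally_constant T h \<and>
     (\<forall>\<sigma>\<in>carrier G. \<forall>\<tau>\<in>carrier G. h (\<sigma> \<otimes> \<tau>) = h \<sigma> + h \<tau>)"
  by (simp add: H1_def)

lemma H1_simps:
  "h \<otimes>\<^bsub>V\<^esub> k = (\<lambda>\<sigma>\<in>carrier G. h \<sigma> + k \<sigma>)" "\<one>\<^bsub>V\<^esub> = (\<lambda>\<sigma>\<in>carrier G. 0)"
  by (simp_all add: H1_def)

lemma H1_eqI:
  "h \<in> carrier V \<Longrightarrow> k \<in> carrier V \<Longrightarrow> (\<And>\<sigma>. \<sigma> \<in> carrier G \<Longrightarrow> h \<sigma> = k \<sigma>) \<Longrightarrow> h = k"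
  unfolding H1_iff by (blast intro: extensionalityI)

lemma H1_closed:
  assumes "h \<in> carrier V" "k \<in> carrier V"
  shows "h \<otimes>\<^bsub>V\<^esub> k \<in> carrier V"
  unfolding H1_iff H1_simps
proof (intro conjI)
  show "locally_constant T (\<lambda>\<sigma>\<in>carrier G. h \<sigma> + k \<sigma>)"
    by (rule locally_constant_combine[of _ h k]) (use assms in \<open>auto simp: H1_iff topspace_T\<close>)
qed (use assms in \<open>auto simp: H1_iff ac_simps\<close>)

lemma H1_one_closed: "\<one>\<^bsub>V\<^esub> \<in> carrier V"
  by (auto simp: H1_iff H1_simps topspace_T intro: continuous_map_eq[of _ _ "\<lambda>_. 0"])

lemma cup_in_Z2:
  assumes "h \<in> carrier V" "k \<in> carrier V"
  shows "cup G h k \<in> carrier Z2"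
  unfolding Z2_iff
proof (intro conjI ballI)
  have c: "locally_constant T h" "locally_constant T k"
    using assms by (auto simp: H1_iff)
  show "locally_constant (prod_topology T T) (cup G h k)"
    by (rule locally_constant_combine[OF continuous_fst_snd(1)[OF c(1)] continuous_fst_snd(2)[OF c(2)]])
      (auto simp: cup_def topspace_T)
qed (use assms in \<open>auto simp: cup_def H1_iff bit_simps\<close>)

subsection \<open>The exterior square\<close>

abbreviation "F2 \<equiv> free2 V"
abbreviation "Rel \<equiv> ext2_relations V"
abbreviation "E2 \<equiv> ext2 V"

lemma bit_poly_mapping: "s + s = 0" "s - t = s + t" for s t :: "'c \<Rightarrow>\<^sub>0 bit"
  by (rule poly_mapping_eqI; simp add: lookup_add lookup_minus bit_simps)+

lemma free2_simps [simp]: "mult F2 = (+)" "\<one>\<^bsub>F2\<^esub> = 0"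
  by (simp_all add: free2_def)

lemma free2_iff: "s \<in> carrier F2 \<longleftrightarrow> Poly_Mapping.keys s \<subseteq> carrier V \<times> carrier V"
  by (simp add: free2_def)

lemma free2_add: "s \<in> carrier F2 \<Longrightarrow> t \<in> carrier F2 \<Longrightarrow> s + t \<in> carrier F2"
  using keys_add[of s t] by (auto simp: free2_iff)

lemma comm_group_F2: "comm_group F2"
proof (rule comm_groupI)
  fix s assume "s \<in> carrier F2"
  then show "\<exists>t\<in>carrier F2. t \<otimes>\<^bsub>F2\<^esub> s = \<one>\<^bsub>F2\<^esub>"
    by (intro bexI[of _ s]) (simp_all add: bit_poly_mapping)
next
  show "\<one>\<^bsub>F2\<^esub> \<in> carrier F2"
    by (simp add: free2_iff)
qed (simp_all add: free2_add ac_simps)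

sublocale F2: comm_group F2
  by (rule comm_group_F2)

lemma pair_closed: "h \<in> carrier V \<Longrightarrow> k \<in> carrier V \<Longrightarrow> pair h k \<in> carrier F2"
  by (auto simp: free2_iff)

abbreviation Gen where
  "Gen \<equiv> {pair (a \<otimes>\<^bsub>V\<^esub> b) c - pair a c - pair b c | a b c. a \<in> carrier V \<and> b \<in> carrier V \<and> c \<in> carrier V} \<union>
      {pair a (b \<otimes>\<^bsub>V\<^esub> c) - pair a b - pair a c | a b c. a \<in> carrier V \<and> b \<in> carrier V \<and> c \<in> carrier V} \<union>
      {pair a a | a. a \<in> carrier V}"

lemma Gen_closed: "Gen \<subseteq> carrier F2"
  by (auto simp: bit_poly_mapping intro!: free2_add pair_closed H1_closed)

lemma subgroup_Rel: "subgroup Rel F2"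
  unfolding ext2_relations_def by (rule F2.generate_is_subgroup[OF Gen_closed])

lemma Gen_Rel: "Gen \<subseteq> Rel"
  unfolding ext2_relations_def by (auto intro: generate.incl)

lemma normal_Rel: "Rel \<lhd> F2"
  by (rule F2.subgroup_imp_normal[OF subgroup_Rel])

lemma comm_group_E2: "comm_group E2"
  unfolding ext2_def using F2.abelian_FactGroup[OF subgroup_Rel] .

sublocale E2: comm_group E2
  by (rule comm_group_E2)

definition cls :: "(('a \<Rightarrow> bit) \<times> ('a \<Rightarrow> bit) \<Rightarrow>\<^sub>0 bit) \<Rightarrow> (('a \<Rightarrow> bit) \<times> ('a \<Rightarrow> bit) \<Rightarrow>\<^sub>0 bit) set" where
  "cls s = Rel #>\<^bsub>F2\<^esub> s"

lemma wedge_cls: "wedge V h k = cls (pair h k)"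
  by (simp add: wedge_def cls_def)

lemma cls_closed: "s \<in> carrier F2 \<Longrightarrow> cls s \<in> carrier E2"
  by (auto simp: cls_def ext2_def carrier_FactGroup)

lemma cls_mult: "s \<in> carrier F2 \<Longrightarrow> t \<in> carrier F2 \<Longrightarrow> cls s \<otimes>\<^bsub>E2\<^esub> cls t = cls (s + t)"
  using normal.rcos_sum[OF normal_Rel] by (simp add: cls_def ext2_def)

lemma cls_eq_iff:
  assumes s: "s \<in> carrier F2" and t: "t \<in> carrier F2"
  shows "cls s = cls t \<longleftrightarrow> s + t \<in> Rel"
proof -
  have "cls s = cls t \<longleftrightarrow> s \<in> Rel #>\<^bsub>F2\<^esub> t"
    unfolding cls_def
    using F2.repr_independence[OF _ t subgroup_Rel] F2.rcos_self[OF s subgroup_Rel] by blast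
  also have "\<dots> \<longleftrightarrow> s \<otimes>\<^bsub>F2\<^esub> inv\<^bsub>F2\<^esub> t \<in> Rel"
    by (rule subgroup.rcos_module[OF subgroup_Rel F2.group_axioms t s])
  also have "inv\<^bsub>F2\<^esub> t = t"
    using t by (intro F2.inv_equality) (simp_all add: bit_poly_mapping)
  finally show ?thesis
    by simp
qed

lemma cls_0: "cls 0 = \<one>\<^bsub>E2\<^esub>"
  using F2.coset_join2[OF _ subgroup_Rel, of 0] subgroup.one_closed[OF subgroup_Rel] F2.one_closed
  by (simp add: cls_def ext2_def)

lemma E2_self:
  assumes "x \<in> carrier E2"
  shows "x \<otimes>\<^bsub>E2\<^esub> x = \<one>\<^bsub>E2\<^esub>"
proof -
  obtain s where "s \<in> carrier F2" "x = cls s"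
    using assms by (auto simp: ext2_def carrier_FactGroup cls_def)
  then show ?thesis
    by (simp add: cls_mult bit_poly_mapping cls_0)
qed

lemma wedge_closed: "h \<in> carrier V \<Longrightarrow> k \<in> carrier V \<Longrightarrow> wedge V h k \<in> carrier E2"
  by (simp add: wedge_cls cls_closed pair_closed)

lemma wedge_add_left:
  assumes "a \<in> carrier V" "b \<in> carrier V" "c \<in> carrier V"
  shows "wedge V (a \<otimes>\<^bsub>V\<^esub> b) c = wedge V a c \<otimes>\<^bsub>E2\<^esub> wedge V b c"
proof -
  have "pair (a \<otimes>\<^bsub>V\<^esub> b) c - pair a c - pair b c \<in> Rel"
    using assms Gen_Rel by blast
  then have "pair (a \<otimes>\<^bsub>V\<^esub> b) c + (pair a c + pair b c) \<in> Rel"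
    by (simp add: bit_poly_mapping add.assoc)
  then show ?thesis
    using assms by (simp add: wedge_cls cls_mult pair_closed cls_eq_iff free2_add H1_closed)
qed

lemma wedge_add_right:
  assumes "a \<in> carrier V" "b \<in> carrier V" "c \<in> carrier V"
  shows "wedge V a (b \<otimes>\<^bsub>V\<^esub> c) = wedge V a b \<otimes>\<^bsub>E2\<^esub> wedge V a c"
proof -
  have "pair a (b \<otimes>\<^bsub>V\<^esub> c) - pair a b - pair a c \<in> Rel"
    using assms Gen_Rel by blast
  then have "pair a (b \<otimes>\<^bsub>V\<^esub> c) + (pair a b + pair a c) \<in> Rel"
    by (simp add: bit_poly_mapping add.assoc)
  then show ?thesis
    using assms by (simp add: wedge_cls cls_mult pair_closed cls_eq_iff free2_add H1_closed)
qed

lemma wedge_self: "a \<in> carrier V \<Longrightarrow> wedge V a a = \<one>\<^bsub>E2\<^esub>"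
proof -
  assume a: "a \<in> carrier V"
  then have "pair a a \<in> Rel"
    using Gen_Rel by blast
  then show ?thesis
    using a F2.one_closed by (simp add: wedge_cls cls_0[symmetric] cls_eq_iff pair_closed)
qed

end

lemma bit_exchange: "a + b = c + d \<Longrightarrow> a + c = b + (d :: bit)"
  by (cases a; cases b; cases c; cases d; simp)

lemma bit_solve: "x + y + z = 0 \<Longrightarrow> y = z + (x :: bit)"
  by (cases x; cases y; cases z; simp)

section \<open>Cup products of tensors and the injectivity on the exterior square\<close>

context topological_comm_group
begin

text \<open>The linear extension of the cup product to the free space, on the level of cocycles.
  Over Z/2 a vector is determined by its keys, so no coefficients appear.\<close>

definition cup_sum :: "(('a \<Rightarrow> bit) \<times> ('a \<Rightarrow> bit) \<Rightarrow>\<^sub>0 bit) \<Rightarrow> 'a \<times> 'a \<Rightarrow> bit" where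
  "cup_sum s = (\<lambda>(\<sigma>, \<tau>)\<in>carrier G \<times> carrier G. \<Sum>p\<in>Poly_Mapping.keys s. fst p \<sigma> * snd p \<tau>)"

lemma cup_sum_add: "cup_sum (s + t) = cup_sum s \<otimes>\<^bsub>Z2\<^esub> cup_sum t"
proof
  fix x
  let ?A = "Poly_Mapping.keys s \<union> Poly_Mapping.keys t"
  \<comment> \<open>Reinstating the coefficients lets all sums run over one index set, so that keys
    common to s and t may cancel.\<close>
  have key_sum: "(\<Sum>p\<in>Poly_Mapping.keys u. \<phi> p) = (\<Sum>p\<in>?A. Poly_Mapping.lookup u p * \<phi> p)"
    if "Poly_Mapping.keys u \<subseteq> ?A" for u and \<phi> :: "_ \<Rightarrow> bit"
  proof -
    have "(\<Sum>p\<in>Poly_Mapping.keys u. \<phi> p) = (\<Sum>p\<in>Poly_Mapping.keys u. Poly_Mapping.lookup u p * \<phi> p)"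
      by (rule sum.cong) (simp_all add: in_keys_iff)
    also have "\<dots> = (\<Sum>p\<in>?A. Poly_Mapping.lookup u p * \<phi> p)"
      using that by (intro sum.mono_neutral_left) (auto simp: in_keys_iff)
    finally show ?thesis .
  qed
  show "cup_sum (s + t) x = (cup_sum s \<otimes>\<^bsub>Z2\<^esub> cup_sum t) x"
    using keys_add[of s t]
    by (auto simp: cup_sum_def Z2_simps key_sum lookup_add distrib_right sum.distrib split: prod.splits)
qed

lemma cup_sum_single: "cup_sum (Poly_Mapping.single p 1) = cup G (fst p) (snd p)"
  by (auto simp: cup_sum_def cup_def fun_eq_iff)

lemma cup_sum_pair: "cup_sum (pair h k) = cup G h k"
  by (simp add: cup_sum_single)

lemma cup_sum_0: "cup_sum 0 = \<one>\<^bsub>Z2\<^esub>"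
  by (auto simp: cup_sum_def Z2_simps fun_eq_iff)

text \<open>In characteristic 2, adding a basis pair that occurs in s deletes it from the support;
  the induction removes one key at a time.\<close>

lemma free2_induct [consumes 1, case_names zero step]:
  assumes "s \<in> carrier F2" and "P 0"
    and step: "\<And>h k s. h \<in> carrier V \<Longrightarrow> k \<in> carrier V \<Longrightarrow> s \<in> carrier F2 \<Longrightarrow> P s \<Longrightarrow> P (pair h k + s)"
  shows "P s"
  using finite_keys[of s] assms(1)
proof (induction "Poly_Mapping.keys s" arbitrary: s rule: finite_induct)
  case empty
  then have "s = 0"
    by (metis empty_iff in_keys_iff lookup_zero poly_mapping_eqI)
  then show ?case
    using assms(2) by simp
next
  case (insert p A)
  obtain h k where p: "p = (h, k)"
    by (cases p)
  let ?t = "pair h k + s"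
  have ks: "Poly_Mapping.keys s = insert p A"
    using insert.hyps(4) by simp
  have "q \<in> Poly_Mapping.keys ?t \<longleftrightarrow> q \<in> A" for q
    using insert.hyps(2) ks in_keys_iff[of q s]
    by (cases "q = p") (auto simp: in_keys_iff lookup_add lookup_single p bit_simps)
  then have keys: "A = Poly_Mapping.keys ?t"
    by blast
  have hk: "h \<in> carrier V" "k \<in> carrier V"
    using ks insert.prems p by (auto simp: free2_iff)
  then have t: "?t \<in> carrier F2"
    using insert.prems by (simp add: free2_add pair_closed)
  have "P ?t"
    by (rule insert.hyps(3)[OF keys t])
  then have "P (pair h k + ?t)"
    by (rule step[OF hk t])
  then show ?case
    by (simp add: add.assoc[symmetric] bit_poly_mapping)
qed

lemma cup_sum_in_Z2: "s \<in> carrier F2 \<Longrightarrow> cup_sum s \<in> carrier Z2"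
  by (induction s rule: free2_induct) (simp_all add: cup_sum_0 cup_sum_add cup_sum_pair cup_in_Z2)

text \<open>Biadditivity relations give the zero cocycle, and \<open>pair a a\<close> gives the cup
  product of a with itself, which is symmetric. Symmetry passes to the generated subgroup.\<close>

lemma symmetric_cup_sum:
  assumes "r \<in> Rel"
  shows "symmetric (cup_sum r)"
proof -
  have "subgroup {r \<in> carrier F2. symmetric (cup_sum r)} F2"
  proof (rule F2.subgroupI)
    show "{r \<in> carrier F2. symmetric (cup_sum r)} \<noteq> {}"
      using F2.one_closed by (auto simp: cup_sum_0 symmetric_def Z2_simps intro!: exI[of _ 0])
  next
    fix r assume r: "r \<in> {r \<in> carrier F2. symmetric (cup_sum r)}"
    then have "inv\<^bsub>F2\<^esub> r = r"
      by (intro F2.inv_equality) (simp_all add: bit_poly_mapping)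
    then show "inv\<^bsub>F2\<^esub> r \<in> {r \<in> carrier F2. symmetric (cup_sum r)}"
      using r by simp
  qed (auto simp: cup_sum_add symmetric_add free2_add)
  moreover have "Gen \<subseteq> {r \<in> carrier F2. symmetric (cup_sum r)}"
  proof
    fix g assume g: "g \<in> Gen"
    have "symmetric (cup_sum g)"
      using g by (auto simp: bit_poly_mapping cup_sum_add cup_sum_pair symmetric_def Z2_simps cup_def H1_simps bit_simps)
    then show "g \<in> {r \<in> carrier F2. symmetric (cup_sum r)}"
      using g Gen_closed by blast
  qed
  ultimately have "generate F2 Gen \<subseteq> {r \<in> carrier F2. symmetric (cup_sum r)}"
    by (intro F2.generate_subgroup_incl)
  then show ?thesis
    using assms unfolding ext2_relations_def by blast
qed

abbreviation H1_pairs where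
  "H1_pairs l \<equiv> set l \<subseteq> carrier V \<times> carrier V"

primrec list_sum :: "(('a \<Rightarrow> bit) \<times> ('a \<Rightarrow> bit)) list \<Rightarrow> (('a \<Rightarrow> bit) \<times> ('a \<Rightarrow> bit) \<Rightarrow>\<^sub>0 bit)" where
  "list_sum [] = 0"
| "list_sum (p # l) = pair (fst p) (snd p) + list_sum l"

primrec list_wedge :: "(('a \<Rightarrow> bit) \<times> ('a \<Rightarrow> bit)) list \<Rightarrow> (('a \<Rightarrow> bit) \<times> ('a \<Rightarrow> bit) \<Rightarrow>\<^sub>0 bit) set" where
  "list_wedge [] = \<one>\<^bsub>E2\<^esub>"
| "list_wedge (p # l) = wedge V (fst p) (snd p) \<otimes>\<^bsub>E2\<^esub> list_wedge l"

text \<open>The failure of the cup product of the list to be symmetric: the alternating form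
  attached to the sum of the h_i \<and> k_i.\<close>

primrec alt_form :: "(('a \<Rightarrow> bit) \<times> ('a \<Rightarrow> bit)) list \<Rightarrow> 'a \<Rightarrow> 'a \<Rightarrow> bit" where
  "alt_form [] \<sigma> \<tau> = 0"
| "alt_form (p # l) \<sigma> \<tau> = fst p \<sigma> * snd p \<tau> + fst p \<tau> * snd p \<sigma> + alt_form l \<sigma> \<tau>"

lemma alt_form_commute: "alt_form l \<sigma> \<tau> = alt_form l \<tau> \<sigma>"
  by (induction l) (simp_all add: ac_simps)

lemma list_sum_closed: "H1_pairs l \<Longrightarrow> list_sum l \<in> carrier F2"
  using F2.one_closed by (induction l) (auto simp: free2_add pair_closed)

lemma list_wedge_closed: "H1_pairs l \<Longrightarrow> list_wedge l \<in> carrier E2"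
  by (induction l) (auto simp: wedge_closed)

lemma cls_list_sum: "H1_pairs l \<Longrightarrow> cls (list_sum l) = list_wedge l"
  by (induction l) (auto simp: cls_0 cls_mult[symmetric] pair_closed list_sum_closed wedge_cls)

lemma alt_form_cup_sum:
  "\<sigma> \<in> carrier G \<Longrightarrow> \<tau> \<in> carrier G \<Longrightarrow>
    alt_form l \<sigma> \<tau> = cup_sum (list_sum l) (\<sigma>, \<tau>) + cup_sum (list_sum l) (\<tau>, \<sigma>)"
  by (induction l) (simp_all add: cup_sum_0 cup_sum_add cup_sum_single Z2_simps cup_def ac_simps)

lemma ex_list_sum:
  assumes "s \<in> carrier F2"
  shows "\<exists>l. H1_pairs l \<and> s = list_sum l"
  using assms
proof (induction s rule: free2_induct)
  case zero
  show ?case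
    by (intro exI[of _ "[]"]) simp
next
  case (step h k s)
  then obtain l where "H1_pairs l" "s = list_sum l"
    by blast
  then show ?case
    using step by (intro exI[of _ "(h, k) # l"]) simp
qed

text \<open>Relations have symmetric cup products, so the alternating form depends only on the
  element of the exterior square and a list may be exchanged for an equivalent one.\<close>

lemma alt_form_cong:
  assumes l: "H1_pairs l" and l': "H1_pairs l'"
    and eq: "list_wedge l = list_wedge l'" and st: "\<sigma> \<in> carrier G" "\<tau> \<in> carrier G"
  shows "alt_form l \<sigma> \<tau> = alt_form l' \<sigma> \<tau>"
proof -
  have "list_sum l + list_sum l' \<in> Rel"
    using eq l l' by (simp add: cls_list_sum[symmetric] cls_eq_iff list_sum_closed)
  then have "symmetric (cup_sum (list_sum l + list_sum l'))"
    by (rule symmetric_cup_sum)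
  then have "cup_sum (list_sum l) (\<sigma>, \<tau>) + cup_sum (list_sum l') (\<sigma>, \<tau>) =
      cup_sum (list_sum l) (\<tau>, \<sigma>) + cup_sum (list_sum l') (\<tau>, \<sigma>)"
    using st by (simp add: symmetric_def cup_sum_add Z2_simps)
  from bit_exchange[OF this] show ?thesis
    by (simp only: alt_form_cup_sum[OF st])
qed

definition scale :: "bit \<Rightarrow> ('a \<Rightarrow> bit) \<Rightarrow> 'a \<Rightarrow> bit" where
  "scale a h = (if a = 1 then h else \<one>\<^bsub>V\<^esub>)"

lemma scale_simps: "scale 0 h = \<one>\<^bsub>V\<^esub>" "scale 1 h = h"
  by (simp_all add: scale_def)

lemma scale_closed: "h \<in> carrier V \<Longrightarrow> scale a h \<in> carrier V"
  by (simp add: scale_def H1_one_closed)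

lemma scale_apply: "\<sigma> \<in> carrier G \<Longrightarrow> scale a h \<sigma> = a * h \<sigma>"
  by (cases a) (simp_all add: scale_def H1_simps)

lemma H1_one: "h \<in> carrier V \<Longrightarrow> h \<otimes>\<^bsub>V\<^esub> \<one>\<^bsub>V\<^esub> = h"
  by (rule H1_eqI) (simp_all add: H1_closed H1_one_closed, simp add: H1_simps)

lemma wedge_one:
  assumes "h \<in> carrier V"
  shows "wedge V h \<one>\<^bsub>V\<^esub> = \<one>\<^bsub>E2\<^esub>" "wedge V \<one>\<^bsub>V\<^esub> h = \<one>\<^bsub>E2\<^esub>"
proof -
  show "wedge V h \<one>\<^bsub>V\<^esub> = \<one>\<^bsub>E2\<^esub>"
    using wedge_add_right[OF assms H1_one_closed H1_one_closed] E2_self[OF wedge_closed[OF assms H1_one_closed]]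
    by (simp add: H1_one[OF H1_one_closed])
  show "wedge V \<one>\<^bsub>V\<^esub> h = \<one>\<^bsub>E2\<^esub>"
    using wedge_add_left[OF H1_one_closed H1_one_closed assms] E2_self[OF wedge_closed[OF H1_one_closed assms]]
    by (simp add: H1_one[OF H1_one_closed])
qed

lemma wedge_commute:
  assumes "h \<in> carrier V" "k \<in> carrier V"
  shows "wedge V h k = wedge V k h"
proof -
  have hk: "h \<otimes>\<^bsub>V\<^esub> k \<in> carrier V"
    using assms by (rule H1_closed)
  have "\<one>\<^bsub>E2\<^esub> = wedge V (h \<otimes>\<^bsub>V\<^esub> k) (h \<otimes>\<^bsub>V\<^esub> k)"
    using hk by (simp add: wedge_self)
  also have "\<dots> = wedge V h k \<otimes>\<^bsub>E2\<^esub> wedge V k h"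
    unfolding wedge_add_left[OF assms hk] wedge_add_right[OF assms(1) assms] wedge_add_right[OF assms(2) assms]
    using assms by (simp add: wedge_self wedge_closed)
  finally have "wedge V h k \<otimes>\<^bsub>E2\<^esub> wedge V k h = wedge V k h \<otimes>\<^bsub>E2\<^esub> wedge V k h"
    using E2_self[OF wedge_closed[OF assms(2,1)]] by simp
  then show ?thesis
    using assms by (simp add: wedge_closed)
qed

text \<open>The alternating form with its first argument fixed at \<tau>, as an element of
  \<open>V\<close>.\<close>

primrec contraction :: "'a \<Rightarrow> (('a \<Rightarrow> bit) \<times> ('a \<Rightarrow> bit)) list \<Rightarrow> 'a \<Rightarrow> bit" where
  "contraction \<tau> [] = \<one>\<^bsub>V\<^esub>"
| "contraction \<tau> (p # l) = (scale (fst p \<tau>) (snd p) \<otimes>\<^bsub>V\<^esub> scale (snd p \<tau>) (fst p)) \<otimes>\<^bsub>V\<^esub> contraction \<tau> l"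

text \<open>The map v \<mapsto> v + v(\<tau>) h applied to both factors. If h(\<tau>) = 1, it
  projects onto the characters vanishing at \<tau>.\<close>

definition shear :: "('a \<Rightarrow> bit) \<Rightarrow> 'a \<Rightarrow> ('a \<Rightarrow> bit) \<times> ('a \<Rightarrow> bit) \<Rightarrow> ('a \<Rightarrow> bit) \<times> ('a \<Rightarrow> bit)" where
  "shear h \<tau> p = (fst p \<otimes>\<^bsub>V\<^esub> scale (fst p \<tau>) h, snd p \<otimes>\<^bsub>V\<^esub> scale (snd p \<tau>) h)"

lemma contraction_closed: "H1_pairs l \<Longrightarrow> contraction \<tau> l \<in> carrier V"
  by (induction l) (auto simp: H1_one_closed H1_closed scale_closed)

lemma contraction_apply:
  "\<sigma> \<in> carrier G \<Longrightarrow> contraction \<tau> l \<sigma> = alt_form l \<tau> \<sigma>"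
  by (induction l) (simp_all add: H1_simps scale_apply ac_simps)

lemma shear_closed:
  "h \<in> carrier V \<Longrightarrow> p \<in> carrier V \<times> carrier V \<Longrightarrow> shear h \<tau> p \<in> carrier V \<times> carrier V"
  by (auto simp: shear_def H1_closed scale_closed)

text \<open>Expanding (u + a h) \<and> (v + b h) gives u \<and> v plus h \<and> (a v + b u), since h
  \<and> h vanishes and signs do not matter over Z/2.\<close>

lemma wedge_shear:
  assumes h: "h \<in> carrier V" and uv: "u \<in> carrier V" "v \<in> carrier V"
  shows "wedge V h (scale a v \<otimes>\<^bsub>V\<^esub> scale b u) \<otimes>\<^bsub>E2\<^esub> wedge V u v =
    wedge V (u \<otimes>\<^bsub>V\<^esub> scale a h) (v \<otimes>\<^bsub>V\<^esub> scale b h)"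
proof -
  note facts = wedge_add_left wedge_add_right wedge_closed wedge_self wedge_one H1_closed H1_one_closed
    scale_simps H1_one h uv wedge_commute[OF h uv(1)]
  show ?thesis
    by (cases a; cases b; simp add: facts E2.m_ac)
qed

lemma list_wedge_shear:
  assumes h: "h \<in> carrier V" and "H1_pairs l"
  shows "wedge V h (contraction \<tau> l) \<otimes>\<^bsub>E2\<^esub> list_wedge l = list_wedge (map (shear h \<tau>) l)"
  using assms(2)
proof (induction l)
  case Nil
  then show ?case
    using h by (simp add: wedge_one)
next
  case (Cons p l)
  obtain u v where p: "p = (u, v)"
    by (cases p)
  have uv: "u \<in> carrier V" "v \<in> carrier V" and l: "H1_pairs l"
    using Cons.prems p by auto
  let ?w = "scale (u \<tau>) v \<otimes>\<^bsub>V\<^esub> scale (v \<tau>) u"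
  have w: "?w \<in> carrier V"
    using uv by (simp add: H1_closed scale_closed)
  have "wedge V h (contraction \<tau> (p # l)) \<otimes>\<^bsub>E2\<^esub> list_wedge (p # l) =
      (wedge V h ?w \<otimes>\<^bsub>E2\<^esub> wedge V u v) \<otimes>\<^bsub>E2\<^esub> (wedge V h (contraction \<tau> l) \<otimes>\<^bsub>E2\<^esub> list_wedge l)"
    using h uv w l by (simp add: p wedge_add_right contraction_closed wedge_closed list_wedge_closed E2.m_ac)
  also have "\<dots> = list_wedge (map (shear h \<tau>) (p # l))"
    unfolding Cons.IH[OF l] wedge_shear[OF h uv] by (simp add: p shear_def)
  finally show ?case .
qed

text \<open>A tensor \<open>\<Sum> h_i \<and> k_i\<close> with vanishing alternating form can be shortened: choosing \<open>\<tau>\<close> with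
  \<open>h_1(\<tau>) = 1\<close>, the vanishing expresses \<open>k_1\<close> through the other \<open>h_i, k_i\<close>, and the first summand is
  absorbed by shearing the others along \<open>h_1\<close>.\<close>

lemma list_wedge_eq_one:
  assumes "H1_pairs l"
    and "\<And>\<sigma> \<tau>. \<sigma> \<in> carrier G \<Longrightarrow> \<tau> \<in> carrier G \<Longrightarrow> alt_form l \<sigma> \<tau> = 0"
  shows "list_wedge l = \<one>\<^bsub>E2\<^esub>"
  using assms
proof (induction "length l" arbitrary: l)
  case 0
  then show ?case
    by simp
next
  case (Suc n)
  then obtain p l' where pl: "l = p # l'" "n = length l'"
    by (cases l) auto
  obtain h k where p: "p = (h, k)"
    by (cases p)
  have hk: "h \<in> carrier V" "k \<in> carrier V" and l': "H1_pairs l'"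
    using Suc.prems(1) pl p by auto
  show ?case
  proof (cases "\<exists>\<tau>\<in>carrier G. h \<tau> = 1")
    case False
    then have h0: "h \<sigma> = 0" if "\<sigma> \<in> carrier G" for \<sigma>
      using that by auto
    have h1: "h = \<one>\<^bsub>V\<^esub>"
      by (rule H1_eqI[OF hk(1) H1_one_closed]) (simp add: h0 H1_simps)
    have "alt_form l' \<sigma> \<tau> = 0" if "\<sigma> \<in> carrier G" "\<tau> \<in> carrier G" for \<sigma> \<tau>
      using Suc.prems(2)[OF that] that by (simp add: pl p h0)
    then have "list_wedge l' = \<one>\<^bsub>E2\<^esub>"
      using Suc.hyps(1)[OF pl(2) l'] by blast
    then show ?thesis
      using hk by (simp add: pl p h1 wedge_one)
  next
    case True
    then obtain \<tau> where \<tau>: "\<tau> \<in> carrier G" "h \<tau> = 1"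
      by blast
    let ?c = "contraction \<tau> l'"
    have c: "?c \<in> carrier V"
      by (rule contraction_closed[OF l'])
    have k: "k = ?c \<otimes>\<^bsub>V\<^esub> scale (k \<tau>) h"
    proof (rule H1_eqI[OF hk(2) H1_closed[OF c scale_closed[OF hk(1)]]])
      fix \<sigma> assume \<sigma>: "\<sigma> \<in> carrier G"
      have "h \<sigma> * k \<tau> + k \<sigma> + alt_form l' \<sigma> \<tau> = 0"
        using Suc.prems(2)[OF \<sigma> \<tau>(1)] \<tau>(2) by (simp add: pl p)
      from bit_solve[OF this] show "k \<sigma> = (?c \<otimes>\<^bsub>V\<^esub> scale (k \<tau>) h) \<sigma>"
        using \<sigma> by (simp add: H1_simps contraction_apply scale_apply alt_form_commute[of l' \<sigma>] mult.commute)
    qed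
    have "wedge V h (scale (k \<tau>) h) = \<one>\<^bsub>E2\<^esub>"
      by (cases "k \<tau>") (simp_all add: scale_simps wedge_one wedge_self hk)
    then have "wedge V h k = wedge V h ?c"
      using wedge_add_right[OF hk(1) c scale_closed[OF hk(1), of "k \<tau>"]] wedge_closed[OF hk(1) c]
      by (simp add: k[symmetric])
    then have eq: "list_wedge l = list_wedge (map (shear h \<tau>) l')"
      using list_wedge_shear[OF hk(1) l', of \<tau>] by (simp add: pl p)
    have sh: "set (map (shear h \<tau>) l') \<subseteq> carrier V \<times> carrier V"
      unfolding set_map by (intro image_subsetI shear_closed[OF hk(1)] subsetD[OF l'])
    \<comment> \<open>The sheared list represents the same element of the exterior square, so its
      form vanishes too, and it is one entry shorter.\<close>
    have "alt_form (map (shear h \<tau>) l') \<sigma> \<eta> = 0" if "\<sigma> \<in> carrier G" "\<eta> \<in> carrier G" for \<sigma> \<eta>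
      using alt_form_cong[OF Suc.prems(1) sh eq that] Suc.prems(2)[OF that] by simp
    then have "list_wedge (map (shear h \<tau>) l') = \<one>\<^bsub>E2\<^esub>"
      using sh pl(2) by (intro Suc.hyps(1)) simp_all
    then show ?thesis
      using eq by simp
  qed
qed

text \<open>Injectivity of the exterior square into \<open>H2minus\<close>, stated on the free
  space: a symmetric cup product means a vanishing alternating form.\<close>

lemma Rel_iff:
  assumes s: "s \<in> carrier F2"
  shows "s \<in> Rel \<longleftrightarrow> symmetric (cup_sum s)"
proof
  assume sym: "symmetric (cup_sum s)"
  obtain l where l: "H1_pairs l" "s = list_sum l"
    using ex_list_sum[OF s] by blast
  have "alt_form l \<sigma> \<tau> = 0" if "\<sigma> \<in> carrier G" "\<tau> \<in> carrier G" for \<sigma> \<tau>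
    using sym that by (simp add: alt_form_cup_sum l(2)[symmetric] symmetric_def bit_simps)
  then have "cls s = cls 0"
    using list_wedge_eq_one[OF l(1)] cls_list_sum[OF l(1)] by (simp add: l(2) cls_0)
  then show "s \<in> Rel"
    using s F2.one_closed by (simp add: cls_eq_iff)
qed (rule symmetric_cup_sum)

section \<open>The cup product homomorphism and its inverse on wedges\<close>

lemma E2_cases:
  assumes "x \<in> carrier E2"
  obtains s where "s \<in> carrier F2" "x = cls s"
  using assms by (auto simp: ext2_def carrier_FactGroup cls_def)

definition cup_hom :: "(('a \<Rightarrow> bit) \<times> ('a \<Rightarrow> bit) \<Rightarrow>\<^sub>0 bit) set \<Rightarrow> ('a \<times> 'a \<Rightarrow> bit) set set" where
  "cup_hom = (\<lambda>x\<in>carrier E2. class2minus G T (cup_sum (SOME s. s \<in> carrier F2 \<and> x = cls s)))"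

text \<open>Read from right to left it makes \<open>cup_hom\<close> well defined, from left to right
  injective.\<close>

lemma class2minus_cup_sum_eq_iff:
  assumes "s \<in> carrier F2" "t \<in> carrier F2"
  shows "class2minus G T (cup_sum s) = class2minus G T (cup_sum t) \<longleftrightarrow> cls s = cls t"
  using assms
  by (simp add: class2minus_eq_iff cup_sum_in_Z2 cup_sum_add[symmetric] Rel_iff[symmetric] cls_eq_iff free2_add)

lemma cup_hom_cls:
  assumes s: "s \<in> carrier F2"
  shows "cup_hom (cls s) = class2minus G T (cup_sum s)"
proof -
  let ?t = "SOME t. t \<in> carrier F2 \<and> cls s = cls t"
  have "?t \<in> carrier F2 \<and> cls s = cls ?t"
    by (rule someI[of _ s]) (simp add: s)
  then show ?thesis
    using s by (simp add: cup_hom_def cls_closed class2minus_cup_sum_eq_iff)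
qed

lemma cup_hom_hom: "cup_hom \<in> hom E2 (H2minus G T)"
proof (rule homI)
  fix x assume "x \<in> carrier E2"
  then obtain s where s: "s \<in> carrier F2" "x = cls s"
    by (rule E2_cases)
  then show "cup_hom x \<in> carrier (H2minus G T)"
    by (simp add: cup_hom_cls class2minus_closed cup_sum_in_Z2)
  fix y assume "y \<in> carrier E2"
  then obtain t where t: "t \<in> carrier F2" "y = cls t"
    by (rule E2_cases)
  show "cup_hom (x \<otimes>\<^bsub>E2\<^esub> y) = cup_hom x \<otimes>\<^bsub>H2minus G T\<^esub> cup_hom y"
    using s t by (simp add: cls_mult cup_hom_cls free2_add class2minus_mult cup_sum_in_Z2 cup_sum_add)
qed

lemma cup_hom_wedge:
  "h \<in> carrier V \<Longrightarrow> k \<in> carrier V \<Longrightarrow> cup_hom (wedge V h k) = class2minus G T (cup G h k)"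
  by (simp add: wedge_cls cup_hom_cls pair_closed cup_sum_pair)

lemma inj_on_cup_hom: "inj_on cup_hom (carrier E2)"
proof (rule inj_onI)
  fix x y assume x: "x \<in> carrier E2" and y: "y \<in> carrier E2" and eq: "cup_hom x = cup_hom y"
  obtain s where s: "s \<in> carrier F2" "x = cls s"
    using x by (rule E2_cases)
  obtain t where t: "t \<in> carrier F2" "y = cls t"
    using y by (rule E2_cases)
  show "x = y"
    using eq s t by (simp add: cup_hom_cls class2minus_cup_sum_eq_iff)
qed

text \<open>Wedges generate the exterior square, so a homomorphism with the prescribed values on
  them is unique, and the description operator yields \<open>cup_hom\<close>.\<close>

lemma cup_map_eq: "cup_map G T = cup_hom"
  unfolding cup_map_def
proof (rule the_equality)
  show "cup_hom \<in> hom E2 (H2minus G T) \<and> cup_hom \<in> extensional (carrier E2) \<and>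
     (\<forall>h\<in>carrier V. \<forall>k\<in>carrier V. cup_hom (wedge V h k) = class2minus G T (cup G h k))"
    using cup_hom_hom cup_hom_wedge by (simp add: cup_hom_def)
next
  fix \<Phi> assume \<Phi>: "\<Phi> \<in> hom E2 (H2minus G T) \<and> \<Phi> \<in> extensional (carrier E2) \<and>
     (\<forall>h\<in>carrier V. \<forall>k\<in>carrier V. \<Phi> (wedge V h k) = class2minus G T (cup G h k))"
  interpret \<Phi>: group_hom E2 "H2minus G T" \<Phi>
    by unfold_locales (use \<Phi> in blast)
  interpret c: group_hom E2 "H2minus G T" cup_hom
    by unfold_locales (rule cup_hom_hom)
  have "\<Phi> (cls s) = cup_hom (cls s)" if "s \<in> carrier F2" for s
    using that
  proof (induction s rule: free2_induct)
    case zero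
    then show ?case
      by (simp add: cls_0)
  next
    case (step h k s)
    have "cls (pair h k + s) = wedge V h k \<otimes>\<^bsub>E2\<^esub> cls s"
      using step by (simp add: cls_mult wedge_cls pair_closed)
    then show ?case
      using step \<Phi> by (simp add: wedge_closed cls_closed cup_hom_wedge)
  qed
  then have "\<Phi> x = cup_hom x" if "x \<in> carrier E2" for x
    using that E2_cases by metis
  then show "\<Phi> = cup_hom"
    using \<Phi> extensionalityI[of \<Phi> "carrier E2" cup_hom] by (simp add: cup_hom_def)
qed

lemma inv_into_cup_map:
  assumes "h \<in> carrier V" "k \<in> carrier V"
  shows "inv_into (carrier E2) (cup_map G T) (class2minus G T (cup G h k)) = wedge V h k"
  using assms inv_into_f_f[OF inj_on_cup_hom wedge_closed[OF assms]]
  by (simp add: cup_map_eq cup_hom_wedge)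

end

section \<open>A continuous section\<close>

text \<open>An enumeration turns sets of algebraic values into sets of indices, which have least
  elements; lexicographic choices become possible.\<close>

lemma countable_Qbar: "countable Qbar"
proof -
  let ?f = "\<lambda>cs :: int list. {x :: complex. Poly (map of_int cs) \<noteq> (0 :: complex poly) \<and> poly (Poly (map of_int cs)) x = 0}"
  have "countable (\<Union>cs. ?f cs)"
  proof (rule countable_UN)
    fix cs :: "int list"
    show "countable (?f cs)"
      by (cases "Poly (map of_int cs) = (0 :: complex poly)") (auto intro: countable_finite poly_roots_finite)
  qed auto
  moreover have "Qbar \<subseteq> (\<Union>cs. ?f cs)"
  proof
    fix x assume "x \<in> Qbar"
    then obtain p where p: "\<And>i. coeff p i \<in> \<int>" "p \<noteq> 0" "poly p x = 0"
      using Qbar_int_poly by blast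
    have "set (coeffs p) \<subseteq> range of_int"
      using p(1) by (auto simp: coeffs_def Ints_def)
    then have "coeffs p \<in> lists (range of_int)"
      by auto
    then obtain cs where "coeffs p = map of_int (cs :: int list)"
      by (auto simp: lists_image)
    then have "Poly (map of_int cs) = p"
      by (metis Poly_coeffs)
    then show "x \<in> (\<Union>cs. ?f cs)"
      using p by (intro UN_I[of cs]) auto
  qed
  ultimately show ?thesis
    by (rule countable_subset[rotated])
qed

definition Qidx :: "complex \<Rightarrow> nat" where
  "Qidx = to_nat_on Qbar"

definition Qenum :: "nat \<Rightarrow> complex" where
  "Qenum = from_nat_into Qbar"

lemma Qenum_in: "Qenum n \<in> Qbar"
  using Qb.sf_simps(1) by (auto simp: Qenum_def intro: from_nat_into)

lemma Qenum_Qidx: "x \<in> Qbar \<Longrightarrow> Qenum (Qidx x) = x"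
  by (simp add: Qenum_def Qidx_def countable_Qbar)

lemma Qidx_inj: "x \<in> Qbar \<Longrightarrow> y \<in> Qbar \<Longrightarrow> Qidx x = Qidx y \<Longrightarrow> x = y"
  by (metis Qenum_Qidx)

context galois_field
begin

text \<open>The extensions of \<open>\<sigma>\<close> to \<open>Qbar\<close> whose values on the first \<open>n\<close> algebraic numbers are
  lexicographically least.\<close>

primrec least_exts :: "(complex \<Rightarrow> complex) \<Rightarrow> nat \<Rightarrow> (complex \<Rightarrow> complex) set" where
  "least_exts \<sigma> 0 = {\<rho> \<in> carrier GQ. restrict \<rho> F = \<sigma>}"
| "least_exts \<sigma> (Suc n) = {\<rho> \<in> least_exts \<sigma> n.
     Qidx (\<rho> (Qenum n)) = (LEAST k. \<exists>\<rho>'\<in>least_exts \<sigma> n. Qidx (\<rho>' (Qenum n)) = k)}"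

lemma least_exts_nonempty:
  assumes "\<sigma> \<in> Aut F"
  shows "\<exists>\<rho>. \<rho> \<in> least_exts \<sigma> n"
proof (induction n)
  case 0
  then show ?case
    using ex_extension[OF assms] by auto
next
  case (Suc n)
  then have "\<exists>k. \<exists>\<rho>'\<in>least_exts \<sigma> n. Qidx (\<rho>' (Qenum n)) = k"
    by blast
  from LeastI_ex[OF this] show ?case
    by auto
qed

lemma least_exts_mono: "m \<le> n \<Longrightarrow> least_exts \<sigma> n \<subseteq> least_exts \<sigma> m"
  by (induction n rule: dec_induct) auto

lemma least_exts_sub:
  assumes "\<rho> \<in> least_exts \<sigma> n"
  shows "\<rho> \<in> carrier GQ" "restrict \<rho> F = \<sigma>"
  using assms least_exts_mono[of 0 n \<sigma>] by auto

text \<open>Stage \<open>Suc (Qidx x)\<close> prescribes the index of the value at x, and the index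
  determines the value.\<close>

lemma least_exts_agree:
  assumes \<rho>: "\<rho> \<in> least_exts \<sigma> m" "\<rho>' \<in> least_exts \<sigma> n"
    and x: "x \<in> Qbar" "Qidx x < m" "Qidx x < n"
  shows "\<rho> x = \<rho>' x"
proof -
  have "\<rho> \<in> least_exts \<sigma> (Suc (Qidx x))" "\<rho>' \<in> least_exts \<sigma> (Suc (Qidx x))"
    using \<rho> x(2,3) least_exts_mono[of "Suc (Qidx x)" m \<sigma>] least_exts_mono[of "Suc (Qidx x)" n \<sigma>]
    by (auto simp del: least_exts.simps)
  then have "Qidx (\<rho> x) = Qidx (\<rho>' x)"
    by (simp add: Qenum_Qidx[OF x(1)])
  then show ?thesis
    using Qidx_inj Qb.Gal_hom(7)[OF least_exts_sub(1) x(1)] \<rho> by blast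
qed

text \<open>The pointwise limit of the decreasing sets \<open>least_exts\<close>. The value at x is
  settled one stage past the index of x.\<close>

definition least_ext :: "(complex \<Rightarrow> complex) \<Rightarrow> complex \<Rightarrow> complex" where
  "least_ext \<sigma> = (\<lambda>x\<in>Qbar. (SOME \<rho>. \<rho> \<in> least_exts \<sigma> (Suc (Qidx x))) x)"

lemma least_ext_eq:
  assumes "\<sigma> \<in> Aut F" "\<rho> \<in> least_exts \<sigma> n" "x \<in> Qbar" "Qidx x < n"
  shows "least_ext \<sigma> x = \<rho> x"
  using someI_ex[OF least_exts_nonempty[OF assms(1), of "Suc (Qidx x)"]]
    least_exts_agree[OF _ assms(2,3) _ assms(4)] assms(3)
  by (simp add: least_ext_def del: least_exts.simps)

text \<open>A stage beyond all indices occurring in S contains a genuine automorphism that agrees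
  with the limit on S; identities for the limit can thus be checked on finite sets.\<close>

lemma least_ext_finite:
  assumes \<sigma>: "\<sigma> \<in> Aut F" and S: "finite S" "S \<subseteq> Qbar"
  shows "\<exists>\<rho>\<in>carrier GQ. restrict \<rho> F = \<sigma> \<and> (\<forall>x\<in>S. least_ext \<sigma> x = \<rho> x)"
proof -
  let ?n = "Suc (Max (Qidx ` S))"
  obtain \<rho> where \<rho>: "\<rho> \<in> least_exts \<sigma> ?n"
    using least_exts_nonempty[OF \<sigma>] by blast
  have "least_ext \<sigma> x = \<rho> x" if "x \<in> S" for x
    using that S by (intro least_ext_eq[OF \<sigma> \<rho>]) (auto intro: le_imp_less_Suc)
  then show ?thesis
    using least_exts_sub[OF \<rho>] by blast
qed

lemma least_ext_Gal:
  assumes \<sigma>: "\<sigma> \<in> Aut F"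
  shows "least_ext \<sigma> \<in> carrier GQ" "restrict (least_ext \<sigma>) F = \<sigma>"
proof -
  let ?s = "least_ext \<sigma>"
  note fin = least_ext_finite[OF \<sigma>]
  have in_Q: "?s x \<in> Qbar" if "x \<in> Qbar" for x
    using fin[of "{x}"] that by (auto simp: Qb.Gal_hom(7))
  have "?s 1 = 1"
    using fin[of "{1}"] Qb.sf_simps(2) by (auto simp: Qb.Gal_hom(3))
  moreover have "?s (x + y) = ?s x + ?s y" "?s (x * y) = ?s x * ?s y" if xy: "x \<in> Qbar" "y \<in> Qbar" for x y
    using fin[of "{x, y, x + y, x * y}"] xy by (auto simp: Qb.Gal_hom(1,2) Qb.sf_simps)
  moreover have "inj_on ?s Qbar"
  proof (rule inj_onI)
    fix x y assume "x \<in> Qbar" "y \<in> Qbar" "?s x = ?s y"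
    then show "x = y"
      using fin[of "{x, y}"] by (auto simp: Qb.Gal_hom(8))
  qed
  moreover have "y \<in> ?s ` Qbar" if y: "y \<in> Qbar" for y
  proof -
    \<comment> \<open>Surjectivity becomes a finite condition because the preimage of y under any
      automorphism is among finitely many conjugates of y.\<close>
    obtain C where C: "finite C" "C \<subseteq> Qbar" "\<forall>\<rho>\<in>carrier GQ. \<rho> y \<in> C"
      using finite_conjugates[OF y] by blast
    obtain \<rho> where \<rho>: "\<rho> \<in> carrier GQ" "\<forall>x\<in>C. ?s x = \<rho> x"
      using fin[OF C(1,2)] by blast
    have "(inv\<^bsub>GQ\<^esub> \<rho>) y \<in> C"
      using C(3) \<rho>(1) by simp
    moreover have "\<rho> ((inv\<^bsub>GQ\<^esub> \<rho>) y) = y"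
      by (rule Qb.Gal_inv_apply(2)[OF \<rho>(1) y])
    ultimately show ?thesis
      using C(2) \<rho>(2) by (metis imageI subsetD)
  qed
  ultimately show "?s \<in> carrier GQ"
    unfolding Gal_iff[OF subfield_Qbar] using in_Q
    by (auto simp: bij_betw_def least_ext_def)
  have "?s x = \<sigma> x" if x: "x \<in> F" for x
  proof -
    obtain \<rho> where \<rho>: "restrict \<rho> F = \<sigma>" "?s x = \<rho> x"
      using fin[of "{x}"] sub_Qbar x by blast
    have "restrict \<rho> F x = \<sigma> x"
      by (simp only: \<rho>(1))
    then show ?thesis
      using \<rho>(2) x by simp
  qed
  then show "restrict ?s F = \<sigma>"
    using Gal_hom(11)[OF \<sigma>] by (auto simp: fun_eq_iff extensional_def)
qed

text \<open>If \<eta> fixes all conjugates of the first n numbers, composing with \<eta> changes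
  none of the values being compared, so least extensions go to least extensions.\<close>

lemma least_exts_translate:
  assumes \<eta>: "\<eta> \<in> carrier GQ" and \<sigma>: "\<sigma> \<in> Aut F"
    and fixing: "\<And>j \<rho>. j < n \<Longrightarrow> \<rho> \<in> carrier GQ \<Longrightarrow> \<eta> (\<rho> (Qenum j)) = \<rho> (Qenum j)"
  shows "least_exts (restrict \<eta> F \<otimes>\<^bsub>Gal F\<^esub> \<sigma>) n = (\<lambda>\<rho>. \<eta> \<otimes>\<^bsub>GQ\<^esub> \<rho>) ` least_exts \<sigma> n"
  using fixing
proof (induction n)
  case 0
  have "\<rho> \<in> (\<lambda>\<rho>. \<eta> \<otimes>\<^bsub>GQ\<^esub> \<rho>) ` {\<rho> \<in> carrier GQ. restrict \<rho> F = \<sigma>}"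
    if \<rho>: "\<rho> \<in> carrier GQ" "restrict \<rho> F = restrict \<eta> F \<otimes>\<^bsub>Gal F\<^esub> \<sigma>" for \<rho>
  proof (rule image_eqI)
    show "\<rho> = \<eta> \<otimes>\<^bsub>GQ\<^esub> (inv\<^bsub>GQ\<^esub> \<eta> \<otimes>\<^bsub>GQ\<^esub> \<rho>)"
      using \<eta> \<rho> by (simp add: Qb.G.m_assoc[symmetric])
    show "inv\<^bsub>GQ\<^esub> \<eta> \<otimes>\<^bsub>GQ\<^esub> \<rho> \<in> {\<rho> \<in> carrier GQ. restrict \<rho> F = \<sigma>}"
      using \<eta> \<rho> \<sigma> restrict_Gal[OF \<eta>]
      by (simp add: restrict_mult restrict_inv G.m_assoc[symmetric])
  qed
  moreover have "\<eta> \<otimes>\<^bsub>GQ\<^esub> \<rho> \<in> least_exts (restrict \<eta> F \<otimes>\<^bsub>Gal F\<^esub> \<sigma>) 0"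
    if "\<rho> \<in> carrier GQ" "restrict \<rho> F = \<sigma>" for \<rho>
    using \<eta> that(1) unfolding that(2)[symmetric] by (simp add: restrict_mult del: restrict_apply)
  ultimately show ?case
    unfolding least_exts.simps by blast
next
  case (Suc n)
  have IH: "least_exts (restrict \<eta> F \<otimes>\<^bsub>Gal F\<^esub> \<sigma>) n = (\<lambda>\<rho>. \<eta> \<otimes>\<^bsub>GQ\<^esub> \<rho>) ` least_exts \<sigma> n"
    by (rule Suc.IH) (rule Suc.prems, simp_all)
  have val: "(\<eta> \<otimes>\<^bsub>GQ\<^esub> \<rho>) (Qenum n) = \<rho> (Qenum n)" if "\<rho> \<in> least_exts \<sigma> n" for \<rho>
    using least_exts_sub(1)[OF that] \<eta> Suc.prems[of n \<rho>] by (simp add: Gal_mult_apply Qenum_in)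
  then have least: "(\<exists>\<rho>'\<in>least_exts (restrict \<eta> F \<otimes>\<^bsub>Gal F\<^esub> \<sigma>) n. Qidx (\<rho>' (Qenum n)) = k) \<longleftrightarrow>
      (\<exists>\<rho>'\<in>least_exts \<sigma> n. Qidx (\<rho>' (Qenum n)) = k)" for k
    unfolding IH by auto
  show ?case
    unfolding least_exts.simps least unfolding IH using val by auto
qed

text \<open>If \<sigma> agrees with \<sigma>0 on a suitable finite set, their quotient lifts to an
  \<eta> fixing all conjugates of the numbers up to the index of x. Translation by \<eta> then
  identifies the two least extensions at x.\<close>

lemma continuous_least_ext: "continuous_map (krull F) (krull Qbar) least_ext"
proof (rule Qb.continuous_map_into_krull)
  show "least_ext \<sigma> \<in> carrier GQ" if "\<sigma> \<in> topspace (krull F)" for \<sigma>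
    using that by (simp add: least_ext_Gal)
next
  fix x assume x: "x \<in> Qbar"
  let ?n = "Suc (Qidx x)"
  have "\<exists>C. finite C \<and> C \<subseteq> Qbar \<and> (\<forall>\<rho>\<in>carrier GQ. \<rho> (Qenum j) \<in> C)" for j
    using finite_conjugates[OF Qenum_in] .
  then obtain C where C: "\<And>j. finite (C j)" "\<And>j. C j \<subseteq> Qbar" "\<And>j \<rho>. \<rho> \<in> carrier GQ \<Longrightarrow> \<rho> (Qenum j) \<in> C j"
    by metis
  define B where "B = (\<Union>j<?n. C j)"
  have "finite B" "B \<subseteq> Qbar"
    using C by (auto simp: B_def)
  then obtain \<beta> where \<beta>: "\<beta> \<in> Qbar"
    "\<And>g h. g \<in> carrier GQ \<Longrightarrow> h \<in> carrier GQ \<Longrightarrow> g \<beta> = h \<beta> \<Longrightarrow> \<forall>b\<in>B. g b = h b"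
    using ex_separating by metis
  obtain S where S: "finite S" "S \<subseteq> F"
    "\<And>\<sigma>. \<sigma> \<in> Aut F \<Longrightarrow> (\<forall>s\<in>S. \<sigma> s = s) \<Longrightarrow> \<exists>\<rho>\<in>carrier GQ. restrict \<rho> F = \<sigma> \<and> \<rho> \<beta> = \<beta>"
    using ex_extension_fixing[OF \<beta>(1)] by metis
  show "locally_constant (krull F) (\<lambda>\<sigma>. least_ext \<sigma> x)"
    unfolding locally_constant_krull
  proof
    fix \<sigma>0 assume \<sigma>0: "\<sigma>0 \<in> Aut F"
    \<comment> \<open>Agreement of \<sigma> and \<sigma>0 on these preimages says that \<sigma>
      composed with the inverse of \<sigma>0 fixes S pointwise.\<close>
    let ?S = "(inv\<^bsub>Gal F\<^esub> \<sigma>0) ` S"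
    have "least_ext \<sigma> x = least_ext \<sigma>0 x"
      if \<sigma>: "\<sigma> \<in> Aut F" "\<forall>s\<in>?S. \<sigma> s = \<sigma>0 s" for \<sigma>
    proof -
      let ?\<tau> = "\<sigma> \<otimes>\<^bsub>Gal F\<^esub> inv\<^bsub>Gal F\<^esub> \<sigma>0"
      have \<tau>: "?\<tau> \<in> Aut F"
        using \<sigma> \<sigma>0 by simp
      have "\<forall>s\<in>S. ?\<tau> s = s"
      proof
        fix s assume s: "s \<in> S"
        then have sF: "s \<in> F"
          using S(2) by blast
        then have "?\<tau> s = \<sigma> ((inv\<^bsub>Gal F\<^esub> \<sigma>0) s)"
          using \<sigma> \<sigma>0 by (simp add: Gal_mult_apply)
        also have "\<dots> = \<sigma>0 ((inv\<^bsub>Gal F\<^esub> \<sigma>0) s)"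
          using \<sigma>(2) s by blast
        also have "\<dots> = s"
          by (rule Gal_inv_apply(2)[OF \<sigma>0 sF])
        finally show "?\<tau> s = s" .
      qed
      then obtain \<eta> where \<eta>: "\<eta> \<in> carrier GQ" "restrict \<eta> F = ?\<tau>" "\<eta> \<beta> = \<beta>"
        using S(3)[OF \<tau>] by blast
      have "\<forall>b\<in>B. \<eta> b = \<one>\<^bsub>GQ\<^esub> b"
        using \<beta>(1) \<eta> by (intro \<beta>(2)) (simp_all add: Gal_one_apply)
      then have fixB: "\<eta> b = b" if "b \<in> B" for b
        using that \<open>B \<subseteq> Qbar\<close> by (auto simp: Gal_one_apply)
      have fix_enum: "\<eta> (\<rho> (Qenum j)) = \<rho> (Qenum j)" if "j < ?n" "\<rho> \<in> carrier GQ" for j \<rho>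
        using C(3)[OF that(2), of j] that(1) by (intro fixB) (auto simp: B_def)
      have tr: "least_exts (restrict \<eta> F \<otimes>\<^bsub>Gal F\<^esub> \<sigma>0) ?n = (\<lambda>\<rho>. \<eta> \<otimes>\<^bsub>GQ\<^esub> \<rho>) ` least_exts \<sigma>0 ?n"
        by (rule least_exts_translate[OF \<eta>(1) \<sigma>0]) (rule fix_enum)
      have eq: "restrict \<eta> F \<otimes>\<^bsub>Gal F\<^esub> \<sigma>0 = \<sigma>"
        using \<sigma> \<sigma>0 by (simp add: \<eta>(2) G.m_assoc)
      obtain \<rho> where \<rho>: "\<rho> \<in> least_exts \<sigma>0 ?n"
        using least_exts_nonempty[OF \<sigma>0] by blast
      then have "\<eta> \<otimes>\<^bsub>GQ\<^esub> \<rho> \<in> least_exts \<sigma> ?n"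
        using tr eq by auto
      then have "least_ext \<sigma> x = (\<eta> \<otimes>\<^bsub>GQ\<^esub> \<rho>) x"
        by (rule least_ext_eq[OF \<sigma>(1) _ x]) simp
      also have "\<dots> = \<eta> (\<rho> (Qenum (Qidx x)))"
        using \<eta>(1) least_exts_sub(1)[OF \<rho>] x by (simp add: Gal_mult_apply Qenum_Qidx)
      also have "\<dots> = \<rho> (Qenum (Qidx x))"
        using C(3)[OF least_exts_sub(1)[OF \<rho>], of "Qidx x"] by (intro fixB) (auto simp: B_def)
      also have "\<dots> = least_ext \<sigma>0 x"
        using least_ext_eq[OF \<sigma>0 \<rho> x] by (simp add: Qenum_Qidx[OF x])
      finally show ?thesis .
    qed
    moreover have "finite ?S" "?S \<subseteq> F"
      using S(1,2) Gal_hom(7)[OF G.inv_closed[OF \<sigma>0]] by auto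
    ultimately show "\<exists>S. finite S \<and> S \<subseteq> F \<and> (\<forall>\<sigma>\<in>Aut F. (\<forall>s\<in>S. \<sigma> s = \<sigma>0 s) \<longrightarrow>
        least_ext \<sigma> x = least_ext \<sigma>0 x)"
      by (intro exI[of _ ?S]) blast
  qed
qed

end

section \<open>The section into the quotient by [G,G]^eps\<close>

lemma topspace_Tabeps: "topspace Tabeps = carrier Gabeps"
proof -
  have "topspace (krull Qbar) = carrier GQ"
    by simp
  note op = openin_quot_topology[OF this, of GQ_eps, folded Tabeps_def]
  show ?thesis
  proof
    show "topspace Tabeps \<subseteq> carrier Gabeps"
      using op[of "topspace Tabeps"] by (simp add: Gabeps_def)
    have "{\<sigma> \<in> topspace (krull Qbar). GQ_eps #>\<^bsub>GQ\<^esub> \<sigma> \<in> carrier (GQ Mod GQ_eps)} = topspace (krull Qbar)"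
      by (auto simp: carrier_FactGroup)
    then have "openin Tabeps (carrier (GQ Mod GQ_eps))"
      unfolding op using openin_topspace[of "krull Qbar"] by simp
    then show "carrier Gabeps \<subseteq> topspace Tabeps"
      unfolding Gabeps_def by (rule openin_subset)
  qed
qed

text \<open>The least extension is projected modulo \<open>GQ_eps\<close>. All members of the
  resulting coset have the same restriction, because \<open>GQ_eps\<close> fixes
  \<open>Qab\<close>.\<close>

lemma sections_nonempty: "sections \<noteq> {}"
proof -
  let ?\<theta> = "\<lambda>\<sigma>. GQ_eps #>\<^bsub>GQ\<^esub> Ab.least_ext \<sigma>"
  have "topspace (krull Qbar) = carrier GQ"
    by simp
  note op = openin_quot_topology[OF this, of GQ_eps, folded Tabeps_def]
  have "continuous_map (krull Qbar) Tabeps (\<lambda>\<rho>. GQ_eps #>\<^bsub>GQ\<^esub> \<rho>)"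
    unfolding continuous_map_def topspace_Tabeps op by (auto simp: Gabeps_def carrier_FactGroup)
  then have "continuous_map Tab Tabeps ?\<theta>"
    using continuous_map_compose[OF Ab.continuous_least_ext] by (simp add: comp_def)
  moreover have "restrict \<rho> Qab = \<sigma>" if \<sigma>: "\<sigma> \<in> carrier Gab" and \<rho>: "\<rho> \<in> ?\<theta> \<sigma>" for \<sigma> \<rho>
  proof -
    obtain n where n: "n \<in> GQ_eps" "\<rho> = n \<otimes>\<^bsub>GQ\<^esub> Ab.least_ext \<sigma>"
      using \<rho> by (auto simp: r_coset_def)
    have nG: "n \<in> carrier GQ" "\<And>x. x \<in> Qab \<Longrightarrow> n x = x"
      using n(1) GQ_eps_props(2) by (auto simp: GQ_comm_eq)
    have "restrict n Qab = \<one>\<^bsub>Gab\<^esub>"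
      using nG(2) by (auto simp: Gal_simps)
    then show ?thesis
      using \<sigma> nG(1) Ab.least_ext_Gal[OF \<sigma>] by (simp add: n(2) Ab.restrict_mult)
  qed
  ultimately have "?\<theta> \<in> sections"
    by (simp add: sections_def)
  then show ?thesis
    by blast
qed

section \<open>Quadratic characters and the Kummer character\<close>

interpretation Coh: topological_comm_group Gab Tab
  by (intro topological_comm_group.intro Ab.TG.topological_group_axioms Ab.comm_group_axioms)

abbreviation Gab_mult (infixl "\<odot>" 70) where
  "\<sigma> \<odot> \<tau> \<equiv> \<sigma> \<otimes>\<^bsub>Gab\<^esub> \<tau>"

abbreviation eps_coset where
  "eps_coset g \<equiv> GQ_eps #>\<^bsub>GQ\<^esub> g"

lemma sgn_of_simps:
  "sgn_of 0 = 1" "sgn_of 1 = - 1" "sgn_of (a + b) = sgn_of a * sgn_of b" "sgn_of a * sgn_of a = 1"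
  "sgn_of a = sgn_of b \<longleftrightarrow> a = b" "sgn_of a \<noteq> 0" "sgn_of a \<in> \<rat>"
  by (cases a; cases b; simp add: sgn_of_def bit_simps)+

lemma sgn_of_mult: "sgn_of (a * b) = (if a = 1 then sgn_of b else 1)"
  by (cases a) (simp_all add: sgn_of_simps)

text \<open>Explicit form of the character described by \<open>e_char\<close>, to be used for s =
  \<i> and s = \<surd>\<ell>.\<close>

definition quad_char :: "complex \<Rightarrow> (complex \<Rightarrow> complex) \<Rightarrow> bit" where
  "quad_char s = (\<lambda>\<sigma>\<in>carrier Gab. if \<sigma> s = s then 0 else 1)"

locale quadratic =
  fixes s :: complex
  assumes s_sq: "s\<^sup>2 \<in> \<rat>" and s_nz: "s \<noteq> 0"
begin

lemma s_Qab: "s \<in> Qab"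
  using s_sq by (rule quadratic_in_Qab)

lemma char_apply:
  assumes \<sigma>: "\<sigma> \<in> carrier Gab"
  shows "\<sigma> s = sgn_of (quad_char s \<sigma>) * s"
proof -
  have "(\<sigma> s)\<^sup>2 = s\<^sup>2"
    using Ab.Gal_hom(14)[OF \<sigma> s_Qab, of 2] Ab.Gal_hom(15)[OF \<sigma> s_sq] by simp
  then have "\<sigma> s = s \<or> \<sigma> s = - s"
    by (simp add: power2_eq_iff)
  then show ?thesis
    using \<sigma> by (auto simp: quad_char_def sgn_of_simps)
qed

lemma char_eqI: "\<sigma> \<in> carrier Gab \<Longrightarrow> \<sigma> s = sgn_of a * s \<Longrightarrow> quad_char s \<sigma> = a"
  using char_apply[of \<sigma>] s_nz by (simp add: sgn_of_simps)

lemma char_H1: "quad_char s \<in> carrier (H1 Gab Tab)"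
  unfolding Coh.H1_iff
proof (intro conjI ballI)
  show "locally_constant Tab (quad_char s)"
    by (rule locally_constant_combine[OF Ab.locally_constant_eval[OF s_Qab] Ab.locally_constant_eval[OF s_Qab]])
      (simp add: quad_char_def)
  fix \<sigma> \<tau> assume st: "\<sigma> \<in> carrier Gab" "\<tau> \<in> carrier Gab"
  have "(\<sigma> \<odot> \<tau>) s = \<sigma> (\<tau> s)"
    by (rule Gal_mult_apply[OF st s_Qab])
  also have "\<dots> = sgn_of (quad_char s \<tau>) * \<sigma> s"
    using st Ab.Gal_hom(2)[OF st(1), of "sgn_of (quad_char s \<tau>)" s] s_Qab
      subfield_Rats[OF Ab.sf] sgn_of_simps(7) Ab.Gal_hom(15)[OF st(1)]
    by (simp add: char_apply[OF st(2)] subset_iff)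
  also have "\<dots> = sgn_of (quad_char s \<sigma> + quad_char s \<tau>) * s"
    by (simp add: char_apply[OF st(1)] sgn_of_simps(3))
  finally show "quad_char s (\<sigma> \<odot> \<tau>) = quad_char s \<sigma> + quad_char s \<tau>"
    using st by (intro char_eqI Ab.G.m_closed)
qed (simp add: quad_char_def)

lemma the_char:
  "(THE h. h \<in> carrier (H1 Gab Tab) \<and> (\<forall>\<sigma>\<in>carrier Gab. \<sigma> s = sgn_of (h \<sigma>) * s)) = quad_char s"
proof (rule the_equality)
  fix h assume "h \<in> carrier (H1 Gab Tab) \<and> (\<forall>\<sigma>\<in>carrier Gab. \<sigma> s = sgn_of (h \<sigma>) * s)"
  then show "h = quad_char s"
    by (intro Coh.H1_eqI[OF _ char_H1]) (auto intro: char_eqI[symmetric])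
qed (simp add: char_H1 char_apply)

definition r :: complex where
  "r = csqrt s"

lemma r_sq: "r\<^sup>2 = s" "r * r = s"
  by (simp_all add: r_def power2_eq_square[symmetric])

lemma r_nz: "r \<noteq> 0"
  using s_nz by (simp add: r_def)

lemma r_Qbar: "r \<in> Qbar"
  using s_Qab Ab.sub_Qbar by (auto simp: r_def Qbar_def)

text \<open>The square of \<rho> r is \<rho> s, which is s up to sign. So \<rho> r / r is a fourth
  root of unity, and \<open>ratio_Qab\<close> follows since its square is rational.\<close>

lemma ratio_sq:
  assumes \<rho>: "\<rho> \<in> carrier GQ"
  shows "(\<rho> r / r)\<^sup>2 = sgn_of (quad_char s (restrict \<rho> Qab))"
proof -
  have "(\<rho> r)\<^sup>2 = \<rho> s"
    using Qb.Gal_hom(14)[OF \<rho> r_Qbar, of 2] by (simp add: r_sq)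
  also have "\<dots> = restrict \<rho> Qab s"
    using s_Qab by simp
  also have "\<dots> = sgn_of (quad_char s (restrict \<rho> Qab)) * s"
    by (rule char_apply[OF Ab.restrict_Gal[OF \<rho>]])
  finally show ?thesis
    using s_nz by (simp add: power_divide r_sq)
qed

lemma ratio_Qab: "\<rho> \<in> carrier GQ \<Longrightarrow> \<rho> r / r \<in> Qab"
  by (rule quadratic_in_Qab) (simp add: ratio_sq sgn_of_simps)

lemma eps_fixes_r: "\<rho> \<in> GQ_eps \<Longrightarrow> \<rho> r = r"
  by (rule GQ_eps_fixes[OF r_Qbar r_nz]) (simp_all add: r_sq s_Qab ratio_Qab)

text \<open>An element of \<open>GQ_eps\<close> fixes r and the element g r / r of
  \<open>Qab\<close>, hence g r. Cosets therefore act on r, and values read off from r do not depend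
  on the representative.\<close>

lemma coset_apply:
  assumes g: "g \<in> carrier GQ" and \<rho>: "\<rho> \<in> eps_coset g"
  shows "\<rho> r = g r"
proof -
  obtain n where n: "n \<in> GQ_eps" "\<rho> = n \<otimes>\<^bsub>GQ\<^esub> g"
    using \<rho> by (auto simp: r_coset_def)
  have nG: "n \<in> carrier GQ" "\<And>x. x \<in> Qab \<Longrightarrow> n x = x"
    using n(1) GQ_eps_props(2) by (auto simp: GQ_comm_eq)
  have "n (g r) = n (g r / r * r)"
    using r_nz by simp
  also have "\<dots> = g r / r * n r"
    using nG ratio_Qab[OF g] Qb.Gal_hom(2)[OF nG(1), of "g r / r" r] r_Qbar Ab.sub_Qbar by auto
  also have "\<dots> = g r"
    using eps_fixes_r[OF n(1)] r_nz by simp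
  finally show ?thesis
    using nG(1) g r_Qbar by (simp add: n(2) Gal_mult_apply)
qed

definition kummer_char :: "(complex \<Rightarrow> complex) set \<Rightarrow> bit" where
  "kummer_char = (\<lambda>A\<in>carrier Geps. if \<forall>\<sigma>\<in>A. \<sigma> r = r then 0 else 1)"

lemma carrier_Geps: "carrier Geps = (\<lambda>h. eps_coset h) ` GQ_comm"
  by (simp add: Geps_def carrier_FactGroup)

lemma comm_Gal: "h \<in> GQ_comm \<Longrightarrow> h \<in> carrier GQ"
  by (simp add: GQ_comm_eq)

lemma self_coset: "g \<in> carrier GQ \<Longrightarrow> g \<in> eps_coset g"
  by (rule Qb.G.rcos_self[OF _ GQ_eps_props(4)])

lemma kummer_char_apply:
  assumes h: "h \<in> GQ_comm"
  shows "h r = sgn_of (kummer_char (eps_coset h)) * r"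
proof -
  have "(h r)\<^sup>2 = h s"
    using Qb.Gal_hom(14)[OF comm_Gal[OF h] r_Qbar, of 2] by (simp add: r_sq)
  then have "(h r)\<^sup>2 = r\<^sup>2"
    using h s_Qab by (simp add: GQ_comm_eq r_sq)
  then have "h r = r \<or> h r = - r"
    by (simp add: power2_eq_iff)
  moreover have "(\<forall>\<sigma>\<in>eps_coset h. \<sigma> r = r) \<longleftrightarrow> h r = r"
  proof
    assume "h r = r"
    then show "\<forall>\<sigma>\<in>eps_coset h. \<sigma> r = r"
      using coset_apply[OF comm_Gal[OF h]] by metis
  next
    assume "\<forall>\<sigma>\<in>eps_coset h. \<sigma> r = r"
    then show "h r = r"
      using self_coset[OF comm_Gal[OF h]] by (rule bspec)
  qed
  then have "kummer_char (eps_coset h) = (if h r = r then 0 else 1)"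
    using h by (simp add: kummer_char_def carrier_Geps)
  ultimately show ?thesis
    by (cases "h r = r") (simp_all add: sgn_of_simps)
qed

lemma kummer_char_eqI: "h \<in> GQ_comm \<Longrightarrow> h r = sgn_of a * r \<Longrightarrow> kummer_char (eps_coset h) = a"
  using kummer_char_apply[of h] r_nz by (simp add: sgn_of_simps)

end

section \<open>Functions on topological quotients and the Kummer character of a square class\<close>

lemma continuous_map_from_quot_topology:
  assumes T: "topspace T = carrier G" and f: "locally_constant T (\<lambda>\<sigma>. f (N #>\<^bsub>G\<^esub> \<sigma>))"
  shows "locally_constant (quot_topology G T N) f"
  unfolding continuous_map_def
proof (intro conjI allI impI)
  note op = openin_quot_topology[OF T, of N]
  have sub: "topspace (quot_topology G T N) \<subseteq> carrier (G Mod N)"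
    using op[of "topspace (quot_topology G T N)"] by simp
  have "{\<sigma> \<in> topspace T. N #>\<^bsub>G\<^esub> \<sigma> \<in> carrier (G Mod N)} = topspace T"
    by (auto simp: carrier_FactGroup T)
  then have "openin (quot_topology G T N) (carrier (G Mod N))"
    unfolding op using openin_topspace[of T] by simp
  then have top: "topspace (quot_topology G T N) = carrier (G Mod N)"
    using sub openin_subset by blast
  fix U
  have "{\<sigma> \<in> topspace T. N #>\<^bsub>G\<^esub> \<sigma> \<in> {x \<in> carrier (G Mod N). f x \<in> U}} = {\<sigma> \<in> topspace T. f (N #>\<^bsub>G\<^esub> \<sigma>) \<in> U}"
    by (auto simp: carrier_FactGroup T)
  moreover have "openin T {\<sigma> \<in> topspace T. f (N #>\<^bsub>G\<^esub> \<sigma>) \<in> U}"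
    using f by (rule openin_continuous_map_preimage) simp
  ultimately show "openin (quot_topology G T N) {x \<in> topspace (quot_topology G T N). f x \<in> U}"
    unfolding top op by auto
qed simp

lemma Qab_units_simps:
  "carrier Qab_units = Qab - {0}" "mult Qab_units = (*)" "\<one>\<^bsub>Qab_units\<^esub> = 1"
  using subfield.subfield_Units[OF Ab.sf] by (simp_all add: Qab_units_def units_of_def)

lemma Qab_squares_eq: "Qab_squares = {x * x | x. x \<in> Qab - {0}}"
proof -
  have "x [^]\<^bsub>Qab_units\<^esub> (2::nat) = x * x" for x
    by (simp add: nat_pow_def numeral_2_eq_2 Qab_units_simps)
  then show ?thesis
    by (simp add: Qab_squares_def Qab_units_simps)
qed

lemma sqclass_eq: "sqclass u = {x * x * u | x. x \<in> Qab - {0}}"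
  by (auto simp: sqclass_def r_coset_def Qab_squares_eq Qab_units_simps)

context quadratic
begin

text \<open>Continuity reduces to evaluation at r, which is locally constant. Additivity holds
  because the signs are rational and hence fixed by every automorphism.\<close>

lemma kummer_char_H1: "kummer_char \<in> carrier (H1 Geps Teps)"
proof -
  have "topspace (subtopology (krull Qbar) GQ_comm) = carrier (GQ\<lparr>carrier := GQ_comm\<rparr>)"
    using comm_Gal by auto
  moreover have "locally_constant (subtopology (krull Qbar) GQ_comm)
      (\<lambda>\<sigma>. kummer_char (GQ_eps #>\<^bsub>GQ\<lparr>carrier := GQ_comm\<rparr>\<^esub> \<sigma>))"
  proof -
    note ev = continuous_map_from_subtopology[OF Qb.locally_constant_eval[OF r_Qbar], of GQ_comm]
    show ?thesis
    proof (rule locally_constant_combine[OF ev ev])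
      fix g h assume "g \<in> topspace (subtopology (krull Qbar) GQ_comm)" "h \<in> topspace (subtopology (krull Qbar) GQ_comm)" "g r = h r"
      then show "kummer_char (GQ_eps #>\<^bsub>GQ\<lparr>carrier := GQ_comm\<rparr>\<^esub> g) = kummer_char (GQ_eps #>\<^bsub>GQ\<lparr>carrier := GQ_comm\<rparr>\<^esub> h)"
        using kummer_char_apply[of h] by (simp add: kummer_char_eqI)
    qed
  qed
  ultimately have cont: "locally_constant Teps kummer_char"
    unfolding Teps_def by (rule continuous_map_from_quot_topology)
  have "kummer_char (A \<otimes>\<^bsub>Geps\<^esub> B) = kummer_char A + kummer_char B"
    if AB: "A \<in> carrier Geps" "B \<in> carrier Geps" for A B
  proof -
    obtain g h where gh: "g \<in> GQ_comm" "h \<in> GQ_comm" "A = eps_coset g" "B = eps_coset h"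
      using AB by (auto simp: carrier_Geps)
    note ghG = comm_Gal[OF gh(1)] comm_Gal[OF gh(2)]
    have "A \<otimes>\<^bsub>Geps\<^esub> B = A <#>\<^bsub>GQ\<^esub> B"
      by (simp add: Geps_def set_mult_def)
    then have AB': "A \<otimes>\<^bsub>Geps\<^esub> B = eps_coset (g \<otimes>\<^bsub>GQ\<^esub> h)"
      using normal.rcos_sum[OF GQ_eps_props(1) ghG] gh by simp
    have "g (h r) = sgn_of (kummer_char B) * g r"
      using Qb.Gal_hom(2)[OF ghG(1), of "sgn_of (kummer_char B)" r] Qb.Gal_hom(15)[OF ghG(1) sgn_of_simps(7)]
        subsetD[OF subfield_Rats[OF subfield_Qbar] sgn_of_simps(7)] r_Qbar
      by (simp add: kummer_char_apply[OF gh(2)] gh(4))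
    then have "(g \<otimes>\<^bsub>GQ\<^esub> h) r = sgn_of (kummer_char A + kummer_char B) * r"
      using ghG r_Qbar by (simp add: Gal_mult_apply kummer_char_apply[OF gh(1)] gh(3) sgn_of_simps)
    then show ?thesis
      unfolding AB' using subgroup.m_closed[OF GQ_eps_props(3) gh(1,2)] by (intro kummer_char_eqI)
  qed
  then show ?thesis
    using cont by (simp add: H1_def kummer_char_def)
qed

lemma s_mem_sqclass: "s \<in> sqclass s"
  using Ab.sf_simps(2) by (auto simp: sqclass_eq intro!: exI[of _ 1])

text \<open>Any square root of any member of the class is r times an element of \<open>Qab\<close>,
  on which [G,G] acts trivially, so all of them define the same character. Uniqueness is seen on r
  itself.\<close>

lemma kummer_eq: "kummer (sqclass s) = kummer_char"
  unfolding kummer_def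
proof (rule the_equality)
  show "kummer_char \<in> carrier (H1 Geps Teps) \<and> (\<forall>u\<in>sqclass s. \<forall>\<rho>. \<rho>\<^sup>2 = u \<longrightarrow>
    (\<forall>A\<in>carrier Geps. \<forall>\<sigma>\<in>A. \<sigma> \<rho> = sgn_of (kummer_char A) * \<rho>))"
  proof (intro conjI ballI allI impI)
    fix u \<rho> A \<sigma> assume u: "u \<in> sqclass s" "\<rho>\<^sup>2 = u" and A: "A \<in> carrier Geps" and \<sigma>: "\<sigma> \<in> A"
    obtain x where x: "x \<in> Qab" "u = x * x * s"
      using u(1) by (auto simp: sqclass_eq)
    have "\<rho>\<^sup>2 = (x * r)\<^sup>2"
      using u(2) x(2) by (simp add: power_mult_distrib r_sq power2_eq_square)
    then have "\<rho> = x * r \<or> \<rho> = (- x) * r"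
      by (simp add: power2_eq_iff)
    then obtain y where y: "y \<in> Qab" "\<rho> = y * r"
      using x(1) Ab.sf_simps(6) by blast
    obtain h where h: "h \<in> GQ_comm" "A = eps_coset h"
      using A by (auto simp: carrier_Geps)
    have "\<sigma> \<in> GQ_comm"
      using \<sigma> h GQ_eps_props(2) subgroup.m_closed[OF GQ_eps_props(3)] by (auto simp: r_coset_def)
    then have "\<sigma> \<rho> = y * \<sigma> r"
      using Qb.Gal_hom(2)[of \<sigma> y r] y r_Qbar Ab.sub_Qbar by (auto simp: GQ_comm_eq)
    also have "\<sigma> r = sgn_of (kummer_char A) * r"
      using coset_apply[OF comm_Gal[OF h(1)], of \<sigma>] \<sigma> kummer_char_apply[OF h(1)] h(2) by simp
    finally show "\<sigma> \<rho> = sgn_of (kummer_char A) * \<rho>"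
      by (simp add: y(2))
  qed (rule kummer_char_H1)
next
  fix c assume c: "c \<in> carrier (H1 Geps Teps) \<and> (\<forall>u\<in>sqclass s. \<forall>\<rho>. \<rho>\<^sup>2 = u \<longrightarrow>
    (\<forall>A\<in>carrier Geps. \<forall>\<sigma>\<in>A. \<sigma> \<rho> = sgn_of (c A) * \<rho>))"
  have "kummer_char A = c A" if A: "A \<in> carrier Geps" for A
  proof -
    obtain h where h: "h \<in> GQ_comm" "A = eps_coset h"
      using A by (auto simp: carrier_Geps)
    have "h r = sgn_of (c A) * r"
      using c s_mem_sqclass r_sq(1) A self_coset[OF comm_Gal[OF h(1)]] h(2) by blast
    then show ?thesis
      unfolding h(2) by (rule kummer_char_eqI[OF h(1)])
  qed
  then show "c = kummer_char"
    using c kummer_char_H1 extensionalityI[of c "carrier Geps" kummer_char] by (simp add: H1_def)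
qed

text \<open>\<sigma> changes s at most by a sign, and -1 is the square of \<i>, which lies in
  \<open>Qab\<close>.\<close>

lemma sqclass_H0: "sqclass s \<in> H0"
proof -
  have "sqclass s \<in> carrier (Qab_units Mod Qab_squares)"
    using s_Qab s_nz by (auto simp: carrier_FactGroup sqclass_def Qab_units_simps)
  moreover have sub: "\<sigma> ` sqclass s \<subseteq> sqclass s" if \<sigma>: "\<sigma> \<in> carrier Gab" for \<sigma>
  proof safe
    fix u assume "u \<in> sqclass s"
    then obtain x where x: "x \<in> Qab" "x \<noteq> 0" "u = x * x * s"
      by (auto simp: sqclass_eq)
    have \<sigma>x: "\<sigma> x \<in> Qab" "\<sigma> x \<noteq> 0"
      using x by (simp_all add: Ab.Gal_hom[OF \<sigma>])
    have i: "\<i> \<in> Qab"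
      by (rule quadratic_in_Qab) simp
    have "\<sigma> u = \<sigma> x * \<sigma> x * (sgn_of (quad_char s \<sigma>) * s)"
      using x s_Qab by (simp add: Ab.Gal_hom[OF \<sigma>] Ab.sf_simps char_apply[OF \<sigma>])
    then have "\<sigma> u = \<sigma> x * \<sigma> x * s \<or> \<sigma> u = (\<i> * \<sigma> x) * (\<i> * \<sigma> x) * s"
      by (auto simp: sgn_of_def)
    then show "\<sigma> u \<in> sqclass s"
      using \<sigma>x i Ab.sf_simps(5)[OF i \<sigma>x(1)] unfolding sqclass_eq by force
  qed
  moreover have "sqclass s \<subseteq> \<sigma> ` sqclass s" if \<sigma>: "\<sigma> \<in> carrier Gab" for \<sigma>
  proof
    fix u assume u: "u \<in> sqclass s"
    then have uQ: "u \<in> Qab"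
      using s_Qab Ab.sf_simps by (auto simp: sqclass_eq)
    have "(inv\<^bsub>Gab\<^esub> \<sigma>) u \<in> sqclass s"
      using sub[OF Ab.G.inv_closed[OF \<sigma>]] u by blast
    then show "u \<in> \<sigma> ` sqclass s"
      using Ab.Gal_inv_apply(2)[OF \<sigma> uQ] by (metis imageI)
  qed
  ultimately have "\<forall>\<sigma>\<in>carrier Gab. \<sigma> ` sqclass s = sqclass s"
    by (blast intro: equalityI)
  then show ?thesis
    using \<open>sqclass s \<in> carrier _\<close> by (simp add: H0_def)
qed

end

section \<open>The class of the pushed-out extension\<close>

interpretation i: quadratic "\<i>"
  by unfold_locales simp_all

lemma square_pm1_cases:
  fixes y :: complex
  assumes "y\<^sup>2 = sgn_of a"
  shows "a = 0 \<and> (y = 1 \<or> y = - 1) \<or> a = 1 \<and> (y = \<i> \<or> y = - \<i>)"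
proof (cases a)
  case zero
  then show ?thesis
    using assms by (auto simp: sgn_of_simps power2_eq_1_iff)
next
  case one
  then have "y\<^sup>2 = \<i>\<^sup>2"
    using assms by (simp add: sgn_of_simps)
  then have "y = \<i> \<or> y = - \<i>"
    by (simp only: power2_eq_iff)
  then show ?thesis
    using one by simp
qed

locale quadratic_section = quadratic +
  fixes \<theta> :: "(complex \<Rightarrow> complex) \<Rightarrow> (complex \<Rightarrow> complex) set"
  assumes \<theta>: "\<theta> \<in> sections"
begin

definition rep :: "(complex \<Rightarrow> complex) \<Rightarrow> complex \<Rightarrow> complex" where
  "rep \<sigma> = (SOME \<rho>. \<rho> \<in> \<theta> \<sigma>)"

definition m :: "(complex \<Rightarrow> complex) \<Rightarrow> complex" where
  "m \<sigma> = rep \<sigma> r / r"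

lemma rep_props:
  assumes \<sigma>: "\<sigma> \<in> carrier Gab"
  shows "rep \<sigma> \<in> carrier GQ" "\<theta> \<sigma> = eps_coset (rep \<sigma>)" "restrict (rep \<sigma>) Qab = \<sigma>"
proof -
  have "\<theta> \<sigma> \<in> carrier Gabeps"
    using \<theta> \<sigma> topspace_Tabeps by (auto simp: sections_def continuous_map_def Pi_def)
  then obtain g where g: "g \<in> carrier GQ" "\<theta> \<sigma> = eps_coset g"
    by (auto simp: Gabeps_def carrier_FactGroup)
  then have rep: "rep \<sigma> \<in> \<theta> \<sigma>"
    unfolding rep_def using someI[of "\<lambda>\<rho>. \<rho> \<in> \<theta> \<sigma>" g] self_coset by simp
  then show "restrict (rep \<sigma>) Qab = \<sigma>"
    using \<theta> \<sigma> by (simp add: sections_def)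
  show "rep \<sigma> \<in> carrier GQ"
    using rep g subgroup.elemrcos_carrier[OF GQ_eps_props(4) Qb.G.group_axioms g(1)] by simp
  show "\<theta> \<sigma> = eps_coset (rep \<sigma>)"
    using Qb.G.repr_independence[OF _ g(1) GQ_eps_props(4)] rep g(2) by simp
qed

lemma rep_Qab: "\<sigma> \<in> carrier Gab \<Longrightarrow> x \<in> Qab \<Longrightarrow> rep \<sigma> x = \<sigma> x"
  using rep_props(3) by (metis restrict_apply')

lemma m_props:
  assumes \<sigma>: "\<sigma> \<in> carrier Gab"
  shows "m \<sigma> \<in> Qab" "(m \<sigma>)\<^sup>2 = sgn_of (quad_char s \<sigma>)" "m \<sigma> \<noteq> 0" "rep \<sigma> r = m \<sigma> * r"
proof -
  show "m \<sigma> \<in> Qab"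
    unfolding m_def by (rule ratio_Qab[OF rep_props(1)[OF \<sigma>]])
  show sq: "(m \<sigma>)\<^sup>2 = sgn_of (quad_char s \<sigma>)"
    unfolding m_def ratio_sq[OF rep_props(1)[OF \<sigma>]] rep_props(3)[OF \<sigma>] ..
  then show "m \<sigma> \<noteq> 0"
    using sgn_of_simps(6) by (metis power2_eq_square mult_zero_left)
  show "rep \<sigma> r = m \<sigma> * r"
    using r_nz by (simp add: m_def)
qed

text \<open>If \<tau> fixes s, then m(\<tau>) is 1 or -1 and hence rational. Otherwise it is \<i> or
  its negative, and \<sigma> acts on it through \<open>quad_char \<i>\<close>.\<close>

lemma Gab_m:
  assumes \<sigma>: "\<sigma> \<in> carrier Gab" and \<tau>: "\<tau> \<in> carrier Gab"
  shows "\<sigma> (m \<tau>) = sgn_of (quad_char \<i> \<sigma> * quad_char s \<tau>) * m \<tau>"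
  using square_pm1_cases[OF m_props(2)[OF \<tau>]] i.char_apply[OF \<sigma>] i.s_Qab Ab.sf_simps(2)
  by (auto simp: sgn_of_mult sgn_of_simps Ab.Gal_hom[OF \<sigma>])

abbreviation "f \<equiv> section_cocycle kummer_char \<theta>"

text \<open>The element g entering the cocycle lies in [G,G]. Applied to
  \<open>rep (\<sigma> \<odot> \<tau>) r\<close>, it gives
  \<open>rep \<sigma> (rep \<tau> r)\<close>, which yields the right side; as g fixes
  m(\<sigma>\<tau>) and multiplies r by the Kummer sign, it also yields the left side.\<close>

lemma cocycle_eq:
  assumes \<sigma>: "\<sigma> \<in> carrier Gab" and \<tau>: "\<tau> \<in> carrier Gab"
  shows "m (\<sigma> \<odot> \<tau>) * sgn_of (f (\<sigma>, \<tau>)) = \<sigma> (m \<tau>) * m \<sigma>"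
proof -
  let ?\<sigma>\<tau> = "\<sigma> \<odot> \<tau>"
  have \<sigma>\<tau>: "?\<sigma>\<tau> \<in> carrier Gab"
    using \<sigma> \<tau> by simp
  note R = rep_props(1)[OF \<sigma>] rep_props(1)[OF \<tau>] rep_props(1)[OF \<sigma>\<tau>]
  let ?g = "rep \<sigma> \<otimes>\<^bsub>GQ\<^esub> rep \<tau> \<otimes>\<^bsub>GQ\<^esub> inv\<^bsub>GQ\<^esub> (rep ?\<sigma>\<tau>)"
  have gG: "?g \<in> carrier GQ"
    using R by simp
  have "restrict ?g Qab = \<one>\<^bsub>Gab\<^esub>"
    using R \<sigma> \<tau> by (simp add: Ab.restrict_mult Ab.restrict_inv rep_props(3))
  then have gQ: "?g x = x" if "x \<in> Qab" for x
    using that by (metis Gal_one_apply restrict_apply')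
  then have gC: "?g \<in> GQ_comm"
    using gG by (simp add: GQ_comm_eq)
  have coset: "\<theta> \<sigma> \<otimes>\<^bsub>Gabeps\<^esub> \<theta> \<tau> \<otimes>\<^bsub>Gabeps\<^esub> inv\<^bsub>Gabeps\<^esub> (\<theta> ?\<sigma>\<tau>) = eps_coset ?g"
  proof -
    note n = GQ_eps_props(1)
    have "\<theta> ?\<sigma>\<tau> \<in> carrier Gabeps"
      using R by (auto simp: rep_props(2)[OF \<sigma>\<tau>] Gabeps_def carrier_FactGroup)
    then have "inv\<^bsub>Gabeps\<^esub> (\<theta> ?\<sigma>\<tau>) = eps_coset (inv\<^bsub>GQ\<^esub> (rep ?\<sigma>\<tau>))"
      using normal.inv_FactGroup[OF n, of "\<theta> ?\<sigma>\<tau>"] normal.rcos_inv[OF n R(3)]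
      by (simp add: Gabeps_def rep_props(2)[OF \<sigma>\<tau>])
    then show ?thesis
      using R by (simp add: rep_props(2) \<sigma> \<tau> Gabeps_def normal.rcos_sum[OF n])
  qed
  have "f (\<sigma>, \<tau>) = kummer_char (eps_coset ?g)"
    using \<sigma> \<tau> by (simp add: section_cocycle_def coset)
  then have gr: "?g r = sgn_of (f (\<sigma>, \<tau>)) * r"
    using kummer_char_apply[OF gC] by simp
  have "?g (rep ?\<sigma>\<tau> r) = rep \<sigma> (rep \<tau> r)"
    using R r_Qbar by (simp add: Gal_mult_apply Qb.Gal_hom(7) Qb.Gal_inv_apply)
  moreover have "?g (rep ?\<sigma>\<tau> r) = m ?\<sigma>\<tau> * (sgn_of (f (\<sigma>, \<tau>)) * r)"
    using m_props(1,4)[OF \<sigma>\<tau>] gQ gr Qb.Gal_hom(2)[OF gG, of "m ?\<sigma>\<tau>" r] r_Qbar Ab.sub_Qbar by auto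
  moreover have "rep \<sigma> (rep \<tau> r) = \<sigma> (m \<tau>) * (m \<sigma> * r)"
    using m_props(1,4)[OF \<tau>] m_props(4)[OF \<sigma>] rep_Qab[OF \<sigma>]
      Qb.Gal_hom(2)[OF R(1), of "m \<tau>" r] r_Qbar Ab.sub_Qbar by auto
  ultimately show ?thesis
    using r_nz by simp
qed

lemma sgn_cocycle:
  assumes "\<sigma> \<in> carrier Gab" "\<tau> \<in> carrier Gab"
  shows "sgn_of (f (\<sigma>, \<tau>)) = \<sigma> (m \<tau>) * m \<sigma> / m (\<sigma> \<odot> \<tau>)"
  using cocycle_eq[OF assms] m_props(3)[of "\<sigma> \<odot> \<tau>"] assms by (simp add: field_simps)

text \<open>Evaluation at r is constant on cosets, hence locally constant on the quotient; m is its
  composite with the continuous section, up to division by r.\<close>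

lemma continuous_m: "locally_constant Tab m"
proof -
  have "locally_constant Tabeps (\<lambda>A. (SOME \<rho>. \<rho> \<in> A) r / r)"
    unfolding Tabeps_def
  proof (rule continuous_map_from_quot_topology)
    note ev = Qb.locally_constant_eval[OF r_Qbar]
    show "locally_constant (krull Qbar) (\<lambda>g. (SOME \<rho>. \<rho> \<in> eps_coset g) r / r)"
    proof (rule locally_constant_combine[OF ev ev])
      fix g h assume gh: "g \<in> topspace (krull Qbar)" "h \<in> topspace (krull Qbar)" "g r = h r"
      have "(SOME \<rho>. \<rho> \<in> eps_coset k) r = k r" if k: "k \<in> carrier GQ" for k
        by (rule coset_apply[OF k someI[of "\<lambda>\<rho>. \<rho> \<in> eps_coset k", OF self_coset[OF k]]])
      then show "(SOME \<rho>. \<rho> \<in> eps_coset g) r / r = (SOME \<rho>. \<rho> \<in> eps_coset h) r / r"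
        using gh by simp
    qed
  qed simp
  note E = this
  have "continuous_map Tab Tabeps \<theta>"
    using \<theta> by (simp add: sections_def)
  from continuous_map_compose[OF this E] show ?thesis
    by (simp add: m_def[abs_def] rep_def[abs_def] comp_def)
qed

text \<open>Local constancy is read off the formula for \<open>f\<close>, which involves only values
  of m and of the two characters.\<close>

lemma cocycle_Z2: "f \<in> carrier (cocycles2 Gab Tab)"
  unfolding Coh.Z2_iff
proof (intro conjI ballI)
  show "f \<in> extensional (carrier Gab \<times> carrier Gab)"
    by (simp add: section_cocycle_def)
next
  note c = Coh.continuous_fst_snd[OF continuous_m]
  note ci = Coh.continuous_fst_snd(1)[OF i.char_H1[unfolded Coh.H1_iff, THEN conjunct2, THEN conjunct1]]
  note cs = Coh.continuous_fst_snd(2)[OF char_H1[unfolded Coh.H1_iff, THEN conjunct2, THEN conjunct1]]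
  have "locally_constant (prod_topology Tab Tab) (\<lambda>(\<sigma>, \<tau>). (m \<sigma>, m \<tau>))"
    by (rule locally_constant_combine[OF c(1,2)]) auto
  from locally_constant_combine[OF this c(3), of "\<lambda>(\<sigma>, \<tau>). (m \<sigma>, m \<tau>, m (\<sigma> \<odot> \<tau>))"]
  have 1: "locally_constant (prod_topology Tab Tab) (\<lambda>(\<sigma>, \<tau>). (m \<sigma>, m \<tau>, m (\<sigma> \<odot> \<tau>)))"
    by auto
  have 2: "locally_constant (prod_topology Tab Tab)
      (\<lambda>(\<sigma>, \<tau>). (quad_char \<i> \<sigma>, quad_char s \<tau>))"
    by (rule locally_constant_combine[OF ci cs]) auto
  show "locally_constant (prod_topology Tab Tab) f"
  proof (rule locally_constant_combine[OF 1 2])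
    fix z z'
    assume z: "z \<in> topspace (prod_topology Tab Tab)" "z' \<in> topspace (prod_topology Tab Tab)"
    obtain \<sigma> \<tau> \<sigma>' \<tau>' where zz: "z = (\<sigma>, \<tau>)" "z' = (\<sigma>', \<tau>')"
      by (cases z; cases z')
    with z have G: "\<sigma> \<in> carrier Gab" "\<tau> \<in> carrier Gab" "\<sigma>' \<in> carrier Gab" "\<tau>' \<in> carrier Gab"
      by auto
    assume "(case z of (\<sigma>, \<tau>) \<Rightarrow> (m \<sigma>, m \<tau>, m (\<sigma> \<odot> \<tau>))) = (case z' of (\<sigma>, \<tau>) \<Rightarrow> (m \<sigma>, m \<tau>, m (\<sigma> \<odot> \<tau>)))"
      "(case z of (\<sigma>, \<tau>) \<Rightarrow> (quad_char \<i> \<sigma>, quad_char s \<tau>)) = (case z' of (\<sigma>, \<tau>) \<Rightarrow> (quad_char \<i> \<sigma>, quad_char s \<tau>))"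
    then have "m \<sigma> = m \<sigma>'" "m \<tau> = m \<tau>'" "m (\<sigma> \<odot> \<tau>) = m (\<sigma>' \<odot> \<tau>')"
      "quad_char \<i> \<sigma> = quad_char \<i> \<sigma>'" "quad_char s \<tau> = quad_char s \<tau>'"
      by (simp_all add: zz)
    then have "sgn_of (f (\<sigma>, \<tau>)) = sgn_of (f (\<sigma>', \<tau>'))"
      using G by (simp add: sgn_cocycle Gab_m)
    then show "f z = f z'"
      by (simp only: zz sgn_of_simps)
  qed
next
  fix \<sigma> \<tau> \<eta> assume G: "\<sigma> \<in> carrier Gab" "\<tau> \<in> carrier Gab" "\<eta> \<in> carrier Gab"
  have st: "\<sigma> \<odot> \<tau> \<in> carrier Gab" and te: "\<tau> \<odot> \<eta> \<in> carrier Gab"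
    and ste: "\<sigma> \<odot> \<tau> \<odot> \<eta> \<in> carrier Gab"
    using G by simp_all
  have assoc: "\<sigma> \<odot> (\<tau> \<odot> \<eta>) = \<sigma> \<odot> \<tau> \<odot> \<eta>"
    using G by (simp add: Ab.G.m_assoc)
  \<comment> \<open>Signs are rational, so \<sigma> may be applied to them. This produces the
    twisted terms that cancel as for any twisted coboundary.\<close>
  have "sgn_of (f (\<tau>, \<eta>)) = \<sigma> (sgn_of (f (\<tau>, \<eta>)))"
    using Ab.Gal_hom(15)[OF G(1) sgn_of_simps(7)] by simp
  also have "\<dots> = \<sigma> (\<tau> (m \<eta>)) * \<sigma> (m \<tau>) / \<sigma> (m (\<tau> \<odot> \<eta>))"
    using m_props(1)[OF G(2)] m_props(1)[OF G(3)] m_props(1)[OF te] Ab.sf_simps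
    by (simp add: sgn_cocycle G Ab.Gal_hom[OF G(1)] Ab.Gal_hom(7)[OF G(2)])
  finally have 1: "sgn_of (f (\<tau>, \<eta>)) = \<sigma> (\<tau> (m \<eta>)) * \<sigma> (m \<tau>) / \<sigma> (m (\<tau> \<odot> \<eta>))" .
  have 2: "sgn_of (f (\<sigma>, \<tau> \<odot> \<eta>)) = \<sigma> (m (\<tau> \<odot> \<eta>)) * m \<sigma> / m (\<sigma> \<odot> \<tau> \<odot> \<eta>)"
    using sgn_cocycle[OF G(1) te] by (simp add: assoc)
  have 3: "sgn_of (f (\<sigma> \<odot> \<tau>, \<eta>)) = \<sigma> (\<tau> (m \<eta>)) * m (\<sigma> \<odot> \<tau>) / m (\<sigma> \<odot> \<tau> \<odot> \<eta>)"
    using sgn_cocycle[OF st G(3)] m_props(1)[OF G(3)] by (simp add: Gal_mult_apply G)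
  have nz: "\<sigma> (m (\<tau> \<odot> \<eta>)) \<noteq> 0" "m (\<sigma> \<odot> \<tau>) \<noteq> 0" "m (\<sigma> \<odot> \<tau> \<odot> \<eta>) \<noteq> 0"
    using m_props(1,3)[OF te] m_props(3)[OF st] m_props(3)[OF ste] by (simp_all add: Ab.Gal_hom(9)[OF G(1)])
  have "sgn_of (f (\<tau>, \<eta>)) * sgn_of (f (\<sigma>, \<tau> \<odot> \<eta>)) =
      sgn_of (f (\<sigma> \<odot> \<tau>, \<eta>)) * sgn_of (f (\<sigma>, \<tau>))"
    unfolding 1 2 3 sgn_cocycle[OF G(1,2)] using nz by (simp add: field_simps)
  then have "sgn_of (f (\<tau>, \<eta>) + f (\<sigma>, \<tau> \<odot> \<eta>)) = sgn_of (f (\<sigma> \<odot> \<tau>, \<eta>) + f (\<sigma>, \<tau>))"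
    by (simp only: sgn_of_simps)
  then show "f (\<tau>, \<eta>) + f (\<sigma>, \<tau> \<odot> \<eta>) = f (\<sigma> \<odot> \<tau>, \<eta>) + f (\<sigma>, \<tau>)"
    unfolding sgn_of_simps(5) .
qed

text \<open>Multiplied by the sign of the cup product, the twist squares to 1 and leaves m(\<tau>)
  m(\<sigma>) / m(\<sigma>\<tau>), which is symmetric since \<open>Gab\<close> is
  commutative.\<close>

lemma class_cocycle:
  "class2minus Gab Tab f = class2minus Gab Tab (cup Gab (quad_char \<i>) (quad_char s))"
proof -
  have "sgn_of (f (\<sigma>, \<tau>) + quad_char \<i> \<sigma> * quad_char s \<tau>) =
      sgn_of (f (\<tau>, \<sigma>) + quad_char \<i> \<tau> * quad_char s \<sigma>)"
    if G: "\<sigma> \<in> carrier Gab" "\<tau> \<in> carrier Gab" for \<sigma> \<tau>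
  proof -
    let ?p = "sgn_of (quad_char \<i> \<sigma> * quad_char s \<tau>)"
    let ?q = "sgn_of (quad_char \<i> \<tau> * quad_char s \<sigma>)"
    have "sgn_of (f (\<sigma>, \<tau>)) * ?p = (?p * ?p) * (m \<tau> * m \<sigma> / m (\<sigma> \<odot> \<tau>))"
      by (simp add: sgn_cocycle[OF G] Gab_m[OF G])
    moreover have "sgn_of (f (\<tau>, \<sigma>)) * ?q = (?q * ?q) * (m \<tau> * m \<sigma> / m (\<sigma> \<odot> \<tau>))"
      by (simp add: sgn_cocycle[OF G(2,1)] Gab_m[OF G(2,1)] Ab.m_comm[OF G(2,1)])
    ultimately show ?thesis
      by (simp only: sgn_of_simps)
  qed
  then have "Coh.symmetric (f \<otimes>\<^bsub>cocycles2 Gab Tab\<^esub> cup Gab (quad_char \<i>) (quad_char s))"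
    unfolding sgn_of_simps(5) by (simp add: Coh.symmetric_def Coh.Z2_simps cup_def)
  then show ?thesis
    by (simp add: Coh.class2minus_eq_iff cocycle_Z2 Coh.cup_in_Z2 i.char_H1 char_H1)
qed

end

section \<open>Evaluation of D on the class of s\<close>

context quadratic
begin

text \<open>All sections give the same class and at least one exists, so \<open>the_elem\<close> is
  applied to a singleton.\<close>

lemma push_ext_kummer_char:
  "push_ext kummer_char = class2minus Gab Tab (cup Gab (quad_char \<i>) (quad_char s))"
proof -
  have "class2minus Gab Tab (section_cocycle kummer_char \<theta>) =
      class2minus Gab Tab (cup Gab (quad_char \<i>) (quad_char s))" if "\<theta> \<in> sections" for \<theta>
  proof -
    interpret quadratic_section s \<theta>
      by unfold_locales (rule that)
    show ?thesis
      by (rule class_cocycle)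
  qed
  then have "(\<lambda>\<theta>. class2minus Gab Tab (section_cocycle kummer_char \<theta>)) ` sections =
      {class2minus Gab Tab (cup Gab (quad_char \<i>) (quad_char s))}"
    using sections_nonempty by auto
  then show ?thesis
    by (simp add: push_ext_def)
qed

theorem D_map_sqclass:
  "D_map (sqclass s) = wedge (H1 Gab Tab) (quad_char \<i>) (quad_char s)"
  using Coh.inv_into_cup_map[OF i.char_H1 char_H1]
  by (simp add: D_map_def sqclass_H0 kummer_eq push_ext_kummer_char)

end

theorem mainTheorem3:
  fixes l :: nat
  assumes "prime l"
  shows "D_map (sqclass (of_real (sqrt (real l)))) =
         wedge (H1 Gab Tab) (e_char (- 1)) (e_char (int l))"
proof -
  have l: "real l > 0"
    using assms prime_gt_0_nat by simp
  have csqrt: "csqrt (of_int (int l)) = of_real (sqrt (real l))"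
    using csqrt_of_real_nonneg[of "of_nat l"] by simp
  interpret quadratic "of_real (sqrt (real l))"
    by unfold_locales (use l in \<open>simp_all flip: of_real_power\<close>)
  have "e_char (int l) = quad_char (of_real (sqrt (real l)))"
    unfolding e_char_def csqrt by (rule the_char)
  moreover have "e_char (- 1) = quad_char \<i>"
    unfolding e_char_def using i.the_char by simp
  ultimately show ?thesis
    using D_map_sqclass by simp
qed

end
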